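(* Let $\{\phi_j\}_{j=0}^{\infty}$ be the complete orthonormal trigonometric system in $L_2([t,T])$: $$\phi_0(s)=\frac{1}{\sqrt{T-t}},\quad \phi_{2r-1}(s)=\sqrt{\frac{2}{T-t}}\sin\frac{2\pi r(s-t)}{T-t},\quad \phi_{2r}(s)=\sqrt{\frac{2}{T-t}}\cos\frac{2\pi r(s-t)}{T-t},\quad r\ge1.$$ For $i\in\{1,\dots,m\}$ and $j\ge 0$ let $\zeta_j^{(i)}=\int_t^T\phi_j(s)\,d\mathbf f^{(i)}_s$, and let $$C_{j_3j_2j_1}=\int_t^T\phi_{j_3}(s)\int_t^s\phi_{j_2}(s_1)\int_t^{s_1}\phi_{j_1}(s_2)\,ds_2\,ds_1\,ds .$$ Then for all $i_1,i_2,i_3\in\{1,\dots,m\}$, $$\int_t^{*T}\int_t^{*t_3}\int_t^{*t_2}d\mathbf f^{(i_1)}_{t_1}\,d\mathbf f^{(i_2)}_{t_2}\,d\mathbf f^{(i_3)}_{t_3} =\operatorname*{l.i.m.}_{p_1,p_2,p_3\to\infty}\sum_{j_1=0}^{p_1}\sum_{j_2=0}^{p_2}\sum_{j_3=0}^{p_3}C_{j_3j_2j_1}\,\zeta_{j_1}^{(i_1)}\zeta_{j_2}^{(i_2)}\zeta_{j_3}^{(i_3)},$$ where the limit is in the mean-square sense with $p_1,p_2,p_3$ tending to infinity independently.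
   Context: $(\Omega,\mathrm F,\mathsf P)$ is a complete probability space with a nondecreasing right-continuous filtration $\{\mathrm F_s\}_{s\in[0,T]}$, and $\mathbf f_s=(\mathbf f^{(1)}_s,\dots,\mathbf f^{(m)}_s)$ is a standard $m$-dimensional Wiener process adapted to it, with independent components; $0\le t<T$. $\int^{*}$ denotes the Stratonovich stochastic integral, and the triple integral on the left is the iterated Stratonovich integral (innermost integral over $[t,t_2]$ against $d\mathbf f^{(i_1)}$, then over $[t,t_3]$ against $d\mathbf f^{(i_2)}$, then over $[t,T]$ against $d\mathbf f^{(i_3)}$). $\operatorname{l.i.m.}$ denotes the limit in mean square (in $L_2(\Omega)$). The paper states only "a complete orthonormal system of trigonometric functions"; the specific indexing above is the one used in its proof. *)

theory Defs
  imports "HOL-Probability.Probability"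
begin

definition rc_filtration :: "'a measure \<Rightarrow> (real \<Rightarrow> 'a measure) \<Rightarrow> real \<Rightarrow> bool" where
  "rc_filtration M F T \<longleftrightarrow>
     (\<forall>s\<in>{0..T}. subalgebra M (F s)) \<and>
     (\<forall>s u. 0 \<le> s \<longrightarrow> s \<le> u \<longrightarrow> u \<le> T \<longrightarrow> sets (F s) \<subseteq> sets (F u)) \<and>
     (\<forall>s. 0 \<le> s \<longrightarrow> s < T \<longrightarrow> sets (F s) = (\<Inter>u\<in>{s<..T}. sets (F u)))"

definition std_wiener ::
  "'a measure \<Rightarrow> (real \<Rightarrow> 'a measure) \<Rightarrow> real \<Rightarrow> nat \<Rightarrow> (nat \<Rightarrow> real \<Rightarrow> 'a \<Rightarrow> real) \<Rightarrow> bool" where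
  "std_wiener M F T m f \<longleftrightarrow>
     (\<forall>i\<in>{1..m}. \<forall>s\<in>{0..T}. f i s \<in> borel_measurable (F s)) \<and>
     (\<forall>i\<in>{1..m}. AE \<omega> in M. f i 0 \<omega> = 0) \<and>
     (\<forall>i\<in>{1..m}. AE \<omega> in M. continuous_on {0..T} (\<lambda>s. f i s \<omega>)) \<and>
     (\<forall>s u. 0 \<le> s \<longrightarrow> s < u \<longrightarrow> u \<le> T \<longrightarrow>
        prob_space.indep_set M (sets (F s))
           (sets (vimage_algebra (space M) (\<lambda>\<omega>. \<lambda>i\<in>{1..m}. f i u \<omega> - f i s \<omega>)
                    (PiM {1..m} (\<lambda>_. borel)))) \<and>
        prob_space.indep_vars M (\<lambda>_. borel) (\<lambda>i \<omega>. f i u \<omega> - f i s \<omega>) {1..m} \<and>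
        (\<forall>i\<in>{1..m}. distributed M lborel (\<lambda>\<omega>. f i u \<omega> - f i s \<omega>)
                          (normal_density 0 (sqrt (u - s)))))"

definition is_partition :: "real \<Rightarrow> real \<Rightarrow> (nat \<Rightarrow> real) \<Rightarrow> nat \<Rightarrow> bool" where
  "is_partition a b \<tau> n \<longleftrightarrow> \<tau> 0 = a \<and> \<tau> n = b \<and> (\<forall>k<n. \<tau> k < \<tau> (Suc k))"

definition fine_partitions :: "real \<Rightarrow> real \<Rightarrow> (nat \<Rightarrow> nat \<Rightarrow> real) \<Rightarrow> (nat \<Rightarrow> nat) \<Rightarrow> bool" where
  "fine_partitions a b \<tau> N \<longleftrightarrow> (\<forall>q. is_partition a b (\<tau> q) (N q)) \<and>
     (\<exists>\<delta>::nat \<Rightarrow> real. \<delta> \<longlonglongrightarrow> 0 \<and> (\<forall>q k. k < N q \<longrightarrow> \<tau> q (Suc k) - \<tau> q k \<le> \<delta> q))"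

definition ms_conv :: "'a measure \<Rightarrow> ('b \<Rightarrow> 'a \<Rightarrow> real) \<Rightarrow> ('a \<Rightarrow> real) \<Rightarrow> 'b filter \<Rightarrow> bool" where
  "ms_conv M X Y F \<longleftrightarrow> ((\<lambda>q. \<integral>\<^sup>+ \<omega>. ennreal ((X q \<omega> - Y \<omega>)\<^sup>2) \<partial>M) \<longlongrightarrow> 0) F"

definition has_strat_integral ::
  "'a measure \<Rightarrow> (real \<Rightarrow> 'a \<Rightarrow> real) \<Rightarrow> (real \<Rightarrow> 'a \<Rightarrow> real) \<Rightarrow> real \<Rightarrow> real \<Rightarrow> ('a \<Rightarrow> real) \<Rightarrow> bool" where
  "has_strat_integral M X W a b I \<longleftrightarrow> I \<in> borel_measurable M \<and>
     (\<forall>\<tau> N. fine_partitions a b \<tau> N \<longrightarrow>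
        ms_conv M (\<lambda>q \<omega>. \<Sum>k<N q. (X (\<tau> q k) \<omega> + X (\<tau> q (Suc k)) \<omega>) / 2 *
                               (W (\<tau> q (Suc k)) \<omega> - W (\<tau> q k) \<omega>)) I sequentially)"

definition has_ito_integral_det ::
  "'a measure \<Rightarrow> (real \<Rightarrow> real) \<Rightarrow> (real \<Rightarrow> 'a \<Rightarrow> real) \<Rightarrow> real \<Rightarrow> real \<Rightarrow> ('a \<Rightarrow> real) \<Rightarrow> bool" where
  "has_ito_integral_det M g W a b I \<longleftrightarrow> I \<in> borel_measurable M \<and>
     (\<forall>\<tau> N. fine_partitions a b \<tau> N \<longrightarrow>
        ms_conv M (\<lambda>q \<omega>. \<Sum>k<N q. g (\<tau> q k) * (W (\<tau> q (Suc k)) \<omega> - W (\<tau> q k) \<omega>)) I sequentially)"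

definition iter_strat3 ::
  "'a measure \<Rightarrow> (nat \<Rightarrow> real \<Rightarrow> 'a \<Rightarrow> real) \<Rightarrow> real \<Rightarrow> real \<Rightarrow> nat \<Rightarrow> nat \<Rightarrow> nat \<Rightarrow>
   (real \<Rightarrow> 'a \<Rightarrow> real) \<Rightarrow> ('a \<Rightarrow> real) \<Rightarrow> bool" where
  "iter_strat3 M f t T i1 i2 i3 J2 J3 \<longleftrightarrow>
     (\<forall>s\<in>{t..T}. has_strat_integral M (\<lambda>u \<omega>. f i1 u \<omega> - f i1 t \<omega>) (f i2) t s (J2 s)) \<and>
     has_strat_integral M J2 (f i3) t T J3"

definition trig_phi :: "real \<Rightarrow> real \<Rightarrow> nat \<Rightarrow> real \<Rightarrow> real" where
  "trig_phi t T j s =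
     (if j = 0 then 1 / sqrt (T - t)
      else if odd j then sqrt (2 / (T - t)) * sin (2 * pi * real ((j + 1) div 2) * (s - t) / (T - t))
      else sqrt (2 / (T - t)) * cos (2 * pi * real (j div 2) * (s - t) / (T - t)))"

definition coefC :: "real \<Rightarrow> real \<Rightarrow> nat \<Rightarrow> nat \<Rightarrow> nat \<Rightarrow> real" where
  "coefC t T j3 j2 j1 =
     integral {t..T} (\<lambda>s. trig_phi t T j3 s *
       integral {t..s} (\<lambda>s1. trig_phi t T j2 s1 *
         integral {t..s1} (\<lambda>s2. trig_phi t T j1 s2)))"

end

theory Submission
  imports Defs
begin

text \<open>
  With \<open>\<Phi>\<^sub>j(s)\<close> the integral of \<open>\<phi>\<^sub>j\<close> over \<open>[t, s]\<close>, the partial sums of the expansion are the iterated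
  integrals of the smooth processes \<open>\<Sum>\<^sub>j \<Phi>\<^sub>j(s) \<zeta>\<^sub>j\<close>, which converge to the Wiener process by Parseval's
  identity. Everything reduces to one inequality: by Wick's formula for sixth moments,
  \<open>E(\<Sum> c\<^sub>a\<^sub>b\<^sub>d \<zeta>\<^sub>a \<zeta>\<^sub>b \<zeta>\<^sub>d)\<^sup>2\<close> is bounded, whatever the component indices are, by a multiple of the squared
  norm of \<open>c\<close> plus those of its three contractions. The squared norms are controlled by Bessel's
  inequality; the contractions of the coefficients are the Fourier coefficients of
  \<open>\<Sum>\<^sub>j \<Phi>\<^sub>j(s)\<^sup>2/2\<close>, \<open>\<Sum>\<^sub>j (\<Phi>\<^sub>j(T) - \<Phi>\<^sub>j(s))\<^sup>2/2\<close> and \<open>\<Sum>\<^sub>j \<Phi>\<^sub>j(s)(\<Phi>\<^sub>j(T) - \<Phi>\<^sub>j(s))\<close>, whose limits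
  \<open>(s - t)/2\<close>, \<open>(T - s)/2\<close> and \<open>0\<close> follow from Parseval's identity for indicators of intervals.
  The nested Stratonovich sums over a partition are compared with the expansion by the same
  inequality; Fatou's lemma carries the bounds through all mean-square limits. For the
  trigonometric system, the Parseval defect of the indicator of \<open>[t, s]\<close> is continuous and nonnegative
  in \<open>s\<close>, and the Basel series shows that its integral vanishes.
\<close>

subsection \<open>Mean-square limits\<close>

text \<open>The variables \<open>\<zeta> i j\<close> and the Stratonovich integrals are known only
  as mean-square limits, and products of mean-square convergent sequences need not converge in mean
  square. Hence no second moment is passed to a limit as an equality: it is computed exactly on
  uniform grids, where the moments of the increments factorize, and only an upper bound is carried
  along an almost surely convergent subsequence. Convergence to zero asks for no more.

  The obstacle is coinciding component indices. They bring in contractions of the coefficients,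
  which square summability does not control. A bound containing all three contractions holds for
  every choice of component indices, so equalities between them need no case distinction and no Ito
  correction has to be identified.

  The iterated integrals have to be shown to exist. They are constructed as limits of their own
  expansions, the trapezoidal sums are then shown to converge to them, and any other candidate
  agrees with them almost surely.\<close>

abbreviation msq :: "'a measure \<Rightarrow> ('a \<Rightarrow> real) \<Rightarrow> ennreal" where
  "msq M X \<equiv> \<integral>\<^sup>+ \<omega>. ennreal ((X \<omega>)\<^sup>2) \<partial>M"

lemma ennreal_fast_subseq:
  fixes a :: "nat \<Rightarrow> ennreal" and e :: "nat \<Rightarrow> ennreal"
  assumes "a \<longlonglongrightarrow> 0" "\<And>k. 0 < e k"
  obtains r :: "nat \<Rightarrow> nat" where "strict_mono r" "\<And>k. a (r k) < e k"
proof -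
  have "\<exists>n. \<forall>m\<ge>n. a m < e k" for k
    using order_tendstoD(2)[OF assms(1) assms(2)[of k]] by (simp add: eventually_sequentially)
  then obtain n where n: "\<And>k m. m \<ge> n k \<Longrightarrow> a m < e k" by metis
  \<comment> \<open>The accumulated thresholds, each increased by one, are strictly increasing and
    still dominate every \<open>n k\<close>, so one sequence serves both purposes.\<close>
  define r where "r k = (\<Sum>i\<le>k. n i + 1)" for k
  have "strict_mono r" by (intro strict_monoI_Suc) (simp add: r_def)
  moreover have "n k \<le> r k" for k
    using member_le_sum[of k "{..k}" "\<lambda>i. n i + 1"] by (simp add: r_def)
  ultimately show ?thesis using n that by blast
qed

lemma AE_suminf_finite:
  fixes h :: "nat \<Rightarrow> 'a \<Rightarrow> ennreal"
  assumes [measurable]: "\<And>q. h q \<in> borel_measurable M"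
    and "(\<Sum>q. \<integral>\<^sup>+\<omega>. h q \<omega> \<partial>M) < \<infinity>"
  shows "AE \<omega> in M. (\<Sum>q. h q \<omega>) < \<infinity>"
proof -
  have "(\<integral>\<^sup>+\<omega>. (\<Sum>q. h q \<omega>) \<partial>M) \<noteq> \<infinity>"
    using assms(2) by (subst nn_integral_suminf) auto
  then have "AE \<omega> in M. (\<Sum>q. h q \<omega>) \<noteq> \<infinity>"
    by (intro nn_integral_noteq_infinite) auto
  then show ?thesis by (simp add: less_top)
qed

lemma summable_of_ennreal_suminf:
  fixes a :: "nat \<Rightarrow> real"
  assumes "(\<Sum>q. ennreal \<bar>a q\<bar>) < \<infinity>"
  shows "summable (\<lambda>q. \<bar>a q\<bar>)"
  using assms by (intro summable_suminf_not_top) (auto simp: less_top)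

lemma ennreal_suminf_half_powers: "(\<Sum>k. ennreal ((1/2)^k)) < \<infinity>"
  by (subst suminf_ennreal2) (auto intro!: summable_geometric)

text \<open>Adding the errors over the finite index set yields one subsequence for all indices.
  Along it the mean-square errors are below \<open>(1/2)^k\<close>, hence summable, so the series of
  squared errors is almost surely finite and its terms tend to 0.\<close>

lemma ms_conv_AE_subseq:
  fixes X :: "'i \<Rightarrow> nat \<Rightarrow> 'a \<Rightarrow> real"
  assumes fin: "finite I"
    and conv: "\<And>i. i \<in> I \<Longrightarrow> ms_conv M (X i) (Y i) sequentially"
    and X: "\<And>i q. i \<in> I \<Longrightarrow> X i q \<in> borel_measurable M"
    and Y: "\<And>i. i \<in> I \<Longrightarrow> Y i \<in> borel_measurable M"
  obtains r :: "nat \<Rightarrow> nat" where "strict_mono r"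
    "AE \<omega> in M. \<forall>i\<in>I. (\<lambda>q. X i (r q) \<omega>) \<longlonglongrightarrow> Y i \<omega>"
proof -
  have "(\<lambda>q. \<Sum>i\<in>I. \<integral>\<^sup>+ \<omega>. ennreal ((X i q \<omega> - Y i \<omega>)\<^sup>2) \<partial>M) \<longlonglongrightarrow> (\<Sum>i\<in>I. 0)"
    using conv by (intro tendsto_sum) (auto simp: ms_conv_def)
  then have "(\<lambda>q. \<Sum>i\<in>I. \<integral>\<^sup>+ \<omega>. ennreal ((X i q \<omega> - Y i \<omega>)\<^sup>2) \<partial>M) \<longlonglongrightarrow> 0" by simp
  then obtain r where r: "strict_mono r"
    "\<And>k. (\<Sum>i\<in>I. \<integral>\<^sup>+ \<omega>. ennreal ((X i (r k) \<omega> - Y i \<omega>)\<^sup>2) \<partial>M) < ennreal ((1/2)^k)"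
    by (rule ennreal_fast_subseq[where e = "\<lambda>k. ennreal ((1/2)^k)"]) auto
  have "AE \<omega> in M. (\<lambda>q. X i (r q) \<omega>) \<longlonglongrightarrow> Y i \<omega>" if i: "i \<in> I" for i
  proof -
    have [measurable]: "X i q \<in> borel_measurable M" "Y i \<in> borel_measurable M" for q
      using X Y i by auto
    have "msq M (\<lambda>\<omega>. X i (r k) \<omega> - Y i \<omega>) \<le> ennreal ((1/2)^k)" for k
      using member_le_sum[of i I "\<lambda>i. \<integral>\<^sup>+ \<omega>. ennreal ((X i (r k) \<omega> - Y i \<omega>)\<^sup>2) \<partial>M"] fin i r(2)[of k]
      by (auto intro: order_trans less_imp_le)
    then have "(\<Sum>k. \<integral>\<^sup>+ \<omega>. ennreal ((X i (r k) \<omega> - Y i \<omega>)\<^sup>2) \<partial>M) < \<infinity>"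
      using ennreal_suminf_half_powers by (meson suminf_le summableI order.strict_trans1)
    then have "AE \<omega> in M. (\<Sum>k. ennreal ((X i (r k) \<omega> - Y i \<omega>)\<^sup>2)) < \<infinity>"
      by (intro AE_suminf_finite) auto
    then show ?thesis
    proof eventually_elim
      case (elim \<omega>)
      then have "summable (\<lambda>k. \<bar>(X i (r k) \<omega> - Y i \<omega>)\<^sup>2\<bar>)"
        by (intro summable_of_ennreal_suminf) simp
      then have "(\<lambda>k. (X i (r k) \<omega> - Y i \<omega>)\<^sup>2) \<longlonglongrightarrow> 0"
        using summable_LIMSEQ_zero by fastforce
      then have "(\<lambda>k. sqrt ((X i (r k) \<omega> - Y i \<omega>)\<^sup>2)) \<longlonglongrightarrow> sqrt 0"
        by (intro tendsto_intros)
      then show ?case by (simp add: tendsto_rabs_zero_iff LIM_zero_iff)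
    qed
  qed
  then have "AE \<omega> in M. \<forall>i\<in>I. (\<lambda>q. X i (r q) \<omega>) \<longlonglongrightarrow> Y i \<omega>"
    using fin by (intro AE_finite_allI) auto
  with r(1) show ?thesis by (rule that)
qed

lemma nn_integral_square_Fatou:
  fixes Z :: "nat \<Rightarrow> 'a \<Rightarrow> real"
  assumes [measurable]: "\<And>q. Z q \<in> borel_measurable M"
    and lim: "AE \<omega> in M. (\<lambda>q. Z q \<omega>) \<longlonglongrightarrow> W \<omega>"
    and le: "\<And>q. msq M (Z q) \<le> ennreal (b q)" and b: "b \<longlonglongrightarrow> B"
  shows "msq M W \<le> ennreal B"
proof -
  have "msq M W = (\<integral>\<^sup>+\<omega>. liminf (\<lambda>q. ennreal ((Z q \<omega>)\<^sup>2)) \<partial>M)"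
    using lim
  proof (intro nn_integral_cong_AE, eventually_elim)
    case (elim \<omega>)
    then have "(\<lambda>q. ennreal ((Z q \<omega>)\<^sup>2)) \<longlonglongrightarrow> ennreal ((W \<omega>)\<^sup>2)"
      by (intro tendsto_intros)
    from lim_imp_Liminf[OF trivial_limit_sequentially this] show ?case by simp
  qed
  also have "\<dots> \<le> liminf (\<lambda>q. \<integral>\<^sup>+\<omega>. ennreal ((Z q \<omega>)\<^sup>2) \<partial>M)"
    by (intro nn_integral_liminf) auto
  also have "\<dots> \<le> liminf (\<lambda>q. ennreal (b q))"
    by (intro Liminf_mono always_eventually allI le)
  also have "\<dots> = ennreal B"
    using b by (intro lim_imp_Liminf) (auto intro: tendsto_intros)
  finally show ?thesis .
qed

text \<open>The device that carries second moment bounds to a limit. \<open>W\<close> has to follow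
  from the \<open>Y i\<close> pathwise only, so \<open>Z\<close> may be a polynomial in mean-square
  convergent variables; Fatou's lemma then supplies the inequality.\<close>

lemma ms_limit_bound:
  fixes X :: "'i \<Rightarrow> nat \<Rightarrow> 'a \<Rightarrow> real"
  assumes "finite I"
    and "\<And>i. i \<in> I \<Longrightarrow> ms_conv M (X i) (Y i) sequentially"
    and "\<And>i q. i \<in> I \<Longrightarrow> X i q \<in> borel_measurable M"
    and "\<And>i. i \<in> I \<Longrightarrow> Y i \<in> borel_measurable M"
    and "\<And>q. Z q \<in> borel_measurable M"
    and cont: "\<And>\<omega> r. strict_mono r \<Longrightarrow> (\<And>i. i \<in> I \<Longrightarrow> (\<lambda>q. X i (r q) \<omega>) \<longlonglongrightarrow> Y i \<omega>) \<Longrightarrow>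
       (\<lambda>q. Z (r q) \<omega>) \<longlonglongrightarrow> W \<omega>"
    and "\<And>q. msq M (Z q) \<le> ennreal (b q)" and b: "b \<longlonglongrightarrow> B"
  shows "msq M W \<le> ennreal B"
proof -
  obtain r where r: "strict_mono r" "AE \<omega> in M. \<forall>i\<in>I. (\<lambda>q. X i (r q) \<omega>) \<longlonglongrightarrow> Y i \<omega>"
    by (rule ms_conv_AE_subseq[of I M X Y, OF assms(1-4)])
  show ?thesis
  proof (rule nn_integral_square_Fatou[of "\<lambda>q. Z (r q)" M W "\<lambda>q. b (r q)"])
    show "AE \<omega> in M. (\<lambda>q. Z (r q) \<omega>) \<longlonglongrightarrow> W \<omega>"
      using r(2) by eventually_elim (use cont r(1) in blast)
    show "(\<lambda>q. b (r q)) \<longlonglongrightarrow> B"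
      using b r(1) LIMSEQ_subseq_LIMSEQ by (fastforce simp: o_def)
  qed (use assms in auto)
qed

lemma ms_conv_of_bound:
  assumes "eventually (\<lambda>q. msq M (\<lambda>\<omega>. X q \<omega> - Y \<omega>) \<le> ennreal (b q)) F" "(b \<longlongrightarrow> 0) F"
  shows "ms_conv M X Y F"
  unfolding ms_conv_def
proof (rule tendsto_sandwich[OF _ assms(1) tendsto_const])
  show "((\<lambda>q. ennreal (b q)) \<longlongrightarrow> 0) F"
    using tendsto_ennrealI[OF assms(2)] by simp
qed auto

lemma ms_conv_cong_AE:
  assumes "\<And>q. AE \<omega> in M. X q \<omega> = X' q \<omega>" "AE \<omega> in M. Y \<omega> = Y' \<omega>"
  shows "ms_conv M X Y F \<longleftrightarrow> ms_conv M X' Y' F"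
proof -
  have "msq M (\<lambda>\<omega>. X q \<omega> - Y \<omega>) = msq M (\<lambda>\<omega>. X' q \<omega> - Y' \<omega>)" for q
    by (intro nn_integral_cong_AE) (use assms(1)[of q] assms(2) in eventually_elim, simp)
  then show ?thesis by (simp add: ms_conv_def)
qed

lemma ms_conv_unique:
  assumes "ms_conv M X Y sequentially" "ms_conv M X Y' sequentially"
    and [measurable]: "\<And>q. X q \<in> borel_measurable M" "Y \<in> borel_measurable M" "Y' \<in> borel_measurable M"
  shows "AE \<omega> in M. Y \<omega> = Y' \<omega>"
proof -
  obtain r where r: "strict_mono r"
    "AE \<omega> in M. \<forall>b\<in>UNIV. (\<lambda>q. X (r q) \<omega>) \<longlonglongrightarrow> (if b then Y else Y') \<omega>"
    by (rule ms_conv_AE_subseq[of UNIV M "\<lambda>_::bool. X" "\<lambda>b. if b then Y else Y'"]) (use assms in auto)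
  from r(2) show ?thesis
    proof eventually_elim
    case (elim \<omega>)
    then show ?case using bspec[OF elim, of True] bspec[OF elim, of False] by (auto intro: LIMSEQ_unique)
  qed
qed

lemma ms_convI:
  assumes "\<And>\<epsilon>. 0 < \<epsilon> \<Longrightarrow> eventually (\<lambda>q. msq M (\<lambda>\<omega>. X q \<omega> - Y \<omega>) \<le> ennreal \<epsilon>) F"
  shows "ms_conv M X Y F"
  unfolding ms_conv_def
proof (rule order_tendstoI)
  fix a :: ennreal assume "0 < a"
  then obtain b where b: "0 < b" "b < a" using dense by blast
  then obtain \<epsilon> where \<epsilon>: "b = ennreal \<epsilon>" "0 < \<epsilon>" by (cases b) auto
  show "eventually (\<lambda>q. msq M (\<lambda>\<omega>. X q \<omega> - Y \<omega>) < a) F"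
    using assms[OF \<epsilon>(2)] by eventually_elim (use b \<epsilon>(1) in auto)
qed simp

lemma (in prob_space) ms_complete:
  fixes X :: "nat \<Rightarrow> 'a \<Rightarrow> real"
  assumes [measurable]: "\<And>q. X q \<in> borel_measurable M"
    and cauchy: "\<And>\<epsilon>. 0 < \<epsilon> \<Longrightarrow> \<exists>Q. \<forall>k\<ge>Q. \<forall>m\<ge>k. msq M (\<lambda>\<omega>. X k \<omega> - X m \<omega>) \<le> ennreal \<epsilon>"
  obtains Y where "Y \<in> borel_measurable M" "ms_conv M X Y sequentially"
proof -
  have "\<exists>Q. \<forall>k\<ge>Q. \<forall>m\<ge>k. msq M (\<lambda>\<omega>. X k \<omega> - X m \<omega>) \<le> ennreal ((1/4)^i)" for i :: nat
    by (rule cauchy) simp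
  then obtain Q where Q: "\<And>i k m. Q i \<le> k \<Longrightarrow> k \<le> m \<Longrightarrow>
      msq M (\<lambda>\<omega>. X k \<omega> - X m \<omega>) \<le> ennreal ((1/4)^i)" by metis
  define r where "r k = (\<Sum>i\<le>k. Q i + 1)" for k
  have r: "strict_mono r" by (intro strict_monoI_Suc) (simp add: r_def)
  have Qr: "Q k \<le> r k" for k
    using member_le_sum[of k "{..k}" "\<lambda>i. Q i + 1"] by (simp add: r_def)
  define d where "d k \<omega> = X (r (Suc k)) \<omega> - X (r k) \<omega>" for k \<omega>
  have [measurable]: "d k \<in> borel_measurable M" for k unfolding d_def by measurable
  have d1: "(\<integral>\<^sup>+\<omega>. ennreal \<bar>d k \<omega>\<bar> \<partial>M) \<le> ennreal ((1/2)^k)" for k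
  proof -
    have *: "msq M (d k) \<le> ennreal ((1/4)^k)"
      using Q[OF Qr[of k], of "r (Suc k)"] strict_mono_less_eq[OF r]
      by (simp add: d_def power2_commute)
    \<comment> \<open>Young's inequality with weight \<open>2^k\<close> turns the mean square
      \<open>(1/4)^k\<close> into the first absolute moment \<open>(1/2)^k\<close>, which is
      summable; the rate \<open>1/4\<close> in the choice of \<open>Q\<close> was made for
      this.\<close>
    have "\<bar>x\<bar> \<le> (1/2)^k/2 + 2^k/2 * x\<^sup>2" for x :: real
    proof -
      have "0 \<le> (1/2)^k/2 * (1 - 2^k * \<bar>x\<bar>)\<^sup>2" by simp
      also have "\<dots> = (1/2)^k/2 - \<bar>x\<bar> + 2^k/2 * x\<^sup>2"
        by (simp add: power2_eq_square field_simps abs_mult[symmetric])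
      finally show ?thesis by simp
    qed
    then have "(\<integral>\<^sup>+\<omega>. ennreal \<bar>d k \<omega>\<bar> \<partial>M) \<le> (\<integral>\<^sup>+\<omega>. ennreal ((1/2)^k/2) + ennreal (2^k/2) * ennreal ((d k \<omega>)\<^sup>2) \<partial>M)"
      by (intro nn_integral_mono) (simp flip: ennreal_mult ennreal_plus)
    also have "\<dots> = ennreal ((1/2)^k/2) + ennreal (2^k/2) * msq M (d k)"
      by (simp add: nn_integral_add nn_integral_cmult emeasure_space_1)
    also have "\<dots> \<le> ennreal ((1/2)^k/2) + ennreal (2^k/2) * ennreal ((1/4)^k)"
      by (intro add_left_mono mult_left_mono *) auto
    also have "\<dots> = ennreal ((1/2)^k/2 + 2^k/2 * (1/4)^k)"
      by (simp flip: ennreal_mult ennreal_plus)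
    also have "(1/2)^k/2 + 2^k/2 * (1/4)^k = ((1/2)^k :: real)"
      by (simp add: field_simps flip: power_mult_distrib)
    finally show ?thesis .
  qed
  have "(\<Sum>k. \<integral>\<^sup>+\<omega>. ennreal \<bar>d k \<omega>\<bar> \<partial>M) < \<infinity>"
    using ennreal_suminf_half_powers d1 by (meson suminf_le summableI order.strict_trans1)
  then have "AE \<omega> in M. (\<Sum>k. ennreal \<bar>d k \<omega>\<bar>) < \<infinity>"
    by (intro AE_suminf_finite) auto
  then have conv: "AE \<omega> in M. convergent (\<lambda>k. X (r k) \<omega>)"
  proof eventually_elim
    case (elim \<omega>)
    then have "summable (\<lambda>k. d k \<omega>)"
      by (rule summable_rabs_cancel[OF summable_of_ennreal_suminf])
    then have "convergent (\<lambda>n. \<Sum>k<n. d k \<omega>)"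
      by (simp add: summable_iff_convergent)
    moreover have "(\<Sum>k<n. d k \<omega>) = X (r n) \<omega> - X (r 0) \<omega>" for n
      unfolding d_def by (rule sum_lessThan_telescope)
    ultimately have "convergent (\<lambda>n. X (r n) \<omega> + (- X (r 0) \<omega>))" by simp
    then show ?case by (simp only: convergent_add_const_right_iff)
  qed
  define Y where "Y \<omega> = lim (\<lambda>k. X (r k) \<omega>)" for \<omega>
  have [measurable]: "Y \<in> borel_measurable M"
    unfolding Y_def by (rule borel_measurable_lim_metric) auto
  have "ms_conv M X Y sequentially"
  proof (rule ms_convI)
    fix \<epsilon> :: real assume "0 < \<epsilon>"
    then obtain Q' where Q': "\<And>k m. Q' \<le> k \<Longrightarrow> k \<le> m \<Longrightarrow>
        msq M (\<lambda>\<omega>. X k \<omega> - X m \<omega>) \<le> ennreal \<epsilon>" using cauchy by blast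
    \<comment> \<open>With \<open>m\<close> fixed, Fatou's lemma along the subsequence carries the
      Cauchy bound over to \<open>Y\<close>, so the whole sequence converges and not only the
      subsequence.\<close>
    have "msq M (\<lambda>\<omega>. X m \<omega> - Y \<omega>) \<le> ennreal \<epsilon>" if m: "Q' \<le> m" for m
    proof (rule nn_integral_square_Fatou[of "\<lambda>k \<omega>. X m \<omega> - X (r (k + m)) \<omega>" _ _ "\<lambda>_. \<epsilon>"])
      show "AE \<omega> in M. (\<lambda>k. X m \<omega> - X (r (k + m)) \<omega>) \<longlonglongrightarrow> X m \<omega> - Y \<omega>"
        using conv
      proof eventually_elim
        case (elim \<omega>)
        then have "(\<lambda>k. X (r k) \<omega>) \<longlonglongrightarrow> Y \<omega>" by (simp add: convergent_LIMSEQ_iff Y_def)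
        then show ?case by (intro tendsto_diff tendsto_const LIMSEQ_ignore_initial_segment)
      qed
      show "msq M (\<lambda>\<omega>. X m \<omega> - X (r (k + m)) \<omega>) \<le> ennreal \<epsilon>" for k
        using seq_suble[OF r, of "k + m"] m by (intro Q') auto
    qed auto
    then show "eventually (\<lambda>m. msq M (\<lambda>\<omega>. X m \<omega> - Y \<omega>) \<le> ennreal \<epsilon>) sequentially"
      by (auto simp: eventually_sequentially)
  qed
  then show ?thesis by (intro that[of Y]) auto
qed

subsection \<open>Wick's formula\<close>

text \<open>\<open>wick_sum c E xs\<close> sums, over all positions of \<open>xs\<close>, \<open>c\<close> of the entry times \<open>E\<close> of the remaining list.\<close>

fun wick_sum :: "('b \<Rightarrow> real) \<Rightarrow> ('b list \<Rightarrow> real) \<Rightarrow> 'b list \<Rightarrow> real" where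
  "wick_sum c E [] = 0"
| "wick_sum c E (x # xs) = c x * E xs + wick_sum c (\<lambda>ys. E (x # ys)) xs"

lemma wick_sum_linear:
  "wick_sum c (\<lambda>ys. \<Sum>v\<in>V. k v * E v ys) xs = (\<Sum>v\<in>V. k v * wick_sum c (E v) xs)"
  by (induction xs arbitrary: E) (auto simp: sum.distrib[symmetric] sum_distrib_left algebra_simps)

lemma wick_sum_coeff_linear:
  "wick_sum (\<lambda>g. \<Sum>v\<in>V. k v * c v g) E xs = (\<Sum>v\<in>V. k v * wick_sum (c v) E xs)"
  by (induction xs arbitrary: E) (auto simp: sum.distrib[symmetric] sum_distrib_left sum_distrib_right algebra_simps)

lemma wick_sum_scale: "wick_sum (\<lambda>g. s * c g) E xs = s * wick_sum c E xs"
  by (induction xs arbitrary: E) (auto simp: algebra_simps)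

lemma wick_sum_cong:
  assumes "\<And>ys. set ys \<subseteq> set xs \<Longrightarrow> E ys = E' ys"
  shows "wick_sum c E xs = wick_sum c E' xs"
  using assms
proof (induction xs arbitrary: E E')
  case (Cons x xs)
  have "wick_sum c (\<lambda>ys. E (x # ys)) xs = wick_sum c (\<lambda>ys. E' (x # ys)) xs"
    by (intro Cons.IH Cons.prems) auto
  moreover have "E xs = E' xs" using Cons.prems by auto
  ultimately show ?case by simp
qed simp

text \<open>Removing an occurrence of \<open>a\<close> lowers its exponent by one, and there are
  \<open>count_list xs a\<close> ways to do it. The offset \<open>d\<close> records the entries that
  the recursion of \<open>wick_sum\<close> has already moved in front of the remaining list, which
  is what the induction has to generalize.\<close>

lemma wick_sum_count:
  assumes "finite V" "a \<in> V"
  shows "wick_sum (\<lambda>x. of_bool (x = a)) (\<lambda>ys. \<Prod>v\<in>V. \<mu> (d v + count_list ys v)) xs =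
    real (count_list xs a) * \<mu> (d a + count_list xs a - 1) * (\<Prod>v\<in>V - {a}. \<mu> (d v + count_list xs v))"
proof (induction xs arbitrary: d)
  case (Cons x xs)
  define d' where "d' = d(x := d x + 1)"
  have *: "d v + count_list (x # ys) v = d' v + count_list ys v" for ys v by (simp add: d'_def)
  have IH: "wick_sum (\<lambda>x. of_bool (x = a)) (\<lambda>ys. \<Prod>v\<in>V. \<mu> (d v + count_list (x # ys) v)) xs =
    real (count_list xs a) * \<mu> (d' a + count_list xs a - 1) * (\<Prod>v\<in>V - {a}. \<mu> (d' v + count_list xs v))"
    using Cons.IH[of d'] unfolding * .
  show ?case
  proof (cases "x = a")
    case True
    have "(\<Prod>v\<in>V - {a}. \<mu> (d' v + count_list xs v)) = (\<Prod>v\<in>V - {a}. \<mu> (d v + count_list xs v))"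
      by (intro prod.cong) (auto simp: d'_def True)
    moreover have "(\<Prod>v\<in>V. \<mu> (d v + count_list xs v)) = \<mu> (d a + count_list xs a) * (\<Prod>v\<in>V - {a}. \<mu> (d v + count_list xs v))"
      using assms by (simp add: prod.remove)
    moreover have "(\<Prod>v\<in>V - {a}. \<mu> (d v + count_list (x # xs) v)) = (\<Prod>v\<in>V - {a}. \<mu> (d v + count_list xs v))"
      by (intro prod.cong) (auto simp: True)
    ultimately show ?thesis
      unfolding wick_sum.simps IH using True by (simp add: d'_def algebra_simps)
  next
    case False
    have "(\<Prod>v\<in>V - {a}. \<mu> (d' v + count_list xs v)) = (\<Prod>v\<in>V - {a}. \<mu> (d v + count_list (x # xs) v))"
      by (intro prod.cong) (auto simp: d'_def)
    then show ?thesis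
      unfolding wick_sum.simps IH using False by (simp add: d'_def)
  qed
qed simp

lemma prod_list_eq_prod_count:
  assumes "finite V" "set xs \<subseteq> V"
  shows "(\<Prod>x\<leftarrow>xs. h x :: real) = (\<Prod>v\<in>V. h v ^ count_list xs v)"
  using assms(2)
proof (induction xs)
  case (Cons x xs)
  have "(\<Prod>v\<in>V. h v ^ count_list (x # xs) v) = (\<Prod>v\<in>V. (if v = x then h v else 1) * h v ^ count_list xs v)"
    by (intro prod.cong) auto
  also have "\<dots> = h x * (\<Prod>v\<in>V. h v ^ count_list xs v)"
    using Cons.prems assms(1) by (simp add: prod.distrib)
  finally show ?case using Cons by simp
qed simp

text \<open>Gaussianity enters through moments alone: monomials factorize, and
  \<open>moment_Suc\<close> is Gaussian integration by parts, E Z^(n+1) = v n E Z^(n-1), with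
  \<open>\<sigma>2\<close> as the variance v. At \<open>n = 0\<close> the factor
  \<open>real n\<close> gives first moment 0, so the truncated \<open>n - 1\<close> does no
  harm.\<close>

locale gaussian_family = prob_space M for M :: "'a measure" +
  fixes V :: "'v set" and X :: "'v \<Rightarrow> 'a \<Rightarrow> real" and \<sigma>2 :: real and \<mu> :: "nat \<Rightarrow> real"
  assumes finite_V: "finite V"
    and integrable_monomial: "integrable M (\<lambda>\<omega>. \<Prod>v\<in>V. X v \<omega> ^ e v)"
    and expectation_monomial: "expectation (\<lambda>\<omega>. \<Prod>v\<in>V. X v \<omega> ^ e v) = (\<Prod>v\<in>V. \<mu> (e v))"
    and moment_Suc: "\<mu> (Suc n) = \<sigma>2 * real n * \<mu> (n - 1)"
begin

definition lin :: "('v \<Rightarrow> real) \<Rightarrow> 'a \<Rightarrow> real" where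
  "lin g \<omega> = (\<Sum>v\<in>V. g v * X v \<omega>)"

definition cov :: "('v \<Rightarrow> real) \<Rightarrow> ('v \<Rightarrow> real) \<Rightarrow> real" where
  "cov g h = \<sigma>2 * (\<Sum>v\<in>V. g v * h v)"

text \<open>Raw variables and linear forms are kept side by side so that the forms can be expanded
  one at a time, each step moving one variable into the first list.\<close>

definition mixed :: "'v list \<Rightarrow> ('v \<Rightarrow> real) list \<Rightarrow> 'a \<Rightarrow> real" where
  "mixed xs gs \<omega> = (\<Prod>x\<leftarrow>xs. X x \<omega>) * (\<Prod>g\<leftarrow>gs. lin g \<omega>)"

lemma mixed_Cons: "mixed xs (g # gs) \<omega> = (\<Sum>v\<in>V. g v * mixed (v # xs) gs \<omega>)"
  by (simp add: mixed_def lin_def sum_distrib_left sum_distrib_right algebra_simps)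

lemma integrable_mixed: "set xs \<subseteq> V \<Longrightarrow> integrable M (mixed xs gs)"
proof (induction gs arbitrary: xs)
  case Nil
  then show ?case
    using integrable_monomial[of "count_list xs"]
    by (simp add: mixed_def[abs_def] prod_list_eq_prod_count[OF finite_V])
next
  case (Cons g gs)
  have "integrable M (\<lambda>\<omega>. \<Sum>v\<in>V. g v * mixed (v # xs) gs \<omega>)"
    using Cons by (intro Bochner_Integration.integrable_sum integrable_mult_right) auto
  then show ?case by (simp add: mixed_Cons[abs_def])
qed

lemma expectation_mixed_Cons:
  assumes "set xs \<subseteq> V"
  shows "expectation (mixed xs (g # gs)) = (\<Sum>v\<in>V. g v * expectation (mixed (v # xs) gs))"
proof -
  have "expectation (\<lambda>\<omega>. \<Sum>v\<in>V. g v * mixed (v # xs) gs \<omega>) = (\<Sum>v\<in>V. expectation (\<lambda>\<omega>. g v * mixed (v # xs) gs \<omega>))"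
    using assms by (intro Bochner_Integration.integral_sum integrable_mult_right integrable_mixed) auto
  then show ?thesis by (simp add: mixed_Cons[abs_def])
qed

lemma expectation_mixed_Nil:
  assumes "set xs \<subseteq> V"
  shows "expectation (mixed xs []) = (\<Prod>v\<in>V. \<mu> (count_list xs v))"
  using expectation_monomial[of "count_list xs"] assms
  by (simp add: mixed_def[abs_def] prod_list_eq_prod_count[OF finite_V])

text \<open>Prepending \<open>a\<close> raises the exponent of \<open>a\<close> by one in the
  factorized moment, and \<open>moment_Suc\<close> lowers it by two at the price of
  \<open>\<sigma>2\<close> times the number of occurrences of \<open>a\<close> in \<open>xs\<close>.
  That number counts the positions with which \<open>a\<close> can be paired.\<close>

lemma wick_basis:
  assumes "a \<in> V" "set xs \<subseteq> V"
  shows "expectation (mixed (a # xs) []) =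
    \<sigma>2 * wick_sum (\<lambda>x. of_bool (x = a)) (\<lambda>ys. expectation (mixed ys [])) xs"
proof -
  have "wick_sum (\<lambda>x. of_bool (x = a)) (\<lambda>ys. expectation (mixed ys [])) xs =
      wick_sum (\<lambda>x. of_bool (x = a)) (\<lambda>ys. \<Prod>v\<in>V. \<mu> (0 + count_list ys v)) xs"
    using assms by (intro wick_sum_cong) (auto simp: expectation_mixed_Nil subset_iff)
  also have "\<dots> = real (count_list xs a) * \<mu> (count_list xs a - 1) * (\<Prod>v\<in>V - {a}. \<mu> (count_list xs v))"
    using wick_sum_count[OF finite_V assms(1), of \<mu> "\<lambda>_. 0" xs] by simp
  finally have *: "\<sigma>2 * wick_sum (\<lambda>x. of_bool (x = a)) (\<lambda>ys. expectation (mixed ys [])) xs =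
      \<mu> (Suc (count_list xs a)) * (\<Prod>v\<in>V - {a}. \<mu> (count_list xs v))"
    by (simp add: moment_Suc)
  have "expectation (mixed (a # xs) []) = (\<Prod>v\<in>V. \<mu> (count_list (a # xs) v))"
    using assms by (intro expectation_mixed_Nil) auto
  also have "\<dots> = \<mu> (Suc (count_list xs a)) * (\<Prod>v\<in>V - {a}. \<mu> (count_list (a # xs) v))"
    using assms finite_V by (simp add: prod.remove)
  also have "(\<Prod>v\<in>V - {a}. \<mu> (count_list (a # xs) v)) = (\<Prod>v\<in>V - {a}. \<mu> (count_list xs v))"
    by (intro prod.cong) auto
  finally show ?thesis using * by simp
qed

text \<open>Expanding the first form \<open>g\<close> puts a variable \<open>v\<close> into the list
  of raw variables. The induction hypothesis for \<open>v # xs\<close> then has one additional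
  pairing, of \<open>a\<close> with \<open>v\<close>; summed against \<open>g v\<close> it becomes
  the term \<open>g a\<close> that pairs \<open>a\<close> with the form \<open>g\<close>.\<close>

lemma wick_mixed:
  assumes "a \<in> V" "set xs \<subseteq> V"
  shows "expectation (mixed (a # xs) gs) =
    \<sigma>2 * (wick_sum (\<lambda>x. of_bool (x = a)) (\<lambda>ys. expectation (mixed ys gs)) xs +
          wick_sum (\<lambda>g. g a) (\<lambda>hs. expectation (mixed xs hs)) gs)"
  using assms(2)
proof (induction gs arbitrary: xs)
  case Nil
  then show ?case using wick_basis[OF assms(1)] by simp
next
  case (Cons g gs)
  have perm: "mixed (a # v # xs) gs = mixed (v # a # xs) gs" for v
    by (auto simp: mixed_def fun_eq_iff)
  have "expectation (mixed (a # xs) (g # gs)) = (\<Sum>v\<in>V. g v * expectation (mixed (a # v # xs) gs))"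
    using Cons.prems assms(1) by (subst expectation_mixed_Cons) (auto simp: perm)
  also have "\<dots> = (\<Sum>v\<in>V. g v * (\<sigma>2 * (of_bool (v = a) * expectation (mixed xs gs) +
      wick_sum (\<lambda>x. of_bool (x = a)) (\<lambda>ys. expectation (mixed (v # ys) gs)) xs +
      wick_sum (\<lambda>g. g a) (\<lambda>hs. expectation (mixed (v # xs) hs)) gs)))"
    using Cons.prems by (intro sum.cong refl) (subst Cons.IH, auto simp: algebra_simps)
  also have "\<dots> = \<sigma>2 * ((\<Sum>v\<in>V. g v * of_bool (v = a) * expectation (mixed xs gs)) +
      (\<Sum>v\<in>V. g v * wick_sum (\<lambda>x. of_bool (x = a)) (\<lambda>ys. expectation (mixed (v # ys) gs)) xs) +
      (\<Sum>v\<in>V. g v * wick_sum (\<lambda>g. g a) (\<lambda>hs. expectation (mixed (v # xs) hs)) gs))"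
    by (simp add: sum_distrib_left sum.distrib[symmetric] algebra_simps)
  also have "(\<Sum>v\<in>V. g v * of_bool (v = a) * expectation (mixed xs gs)) = g a * expectation (mixed xs gs)"
    using finite_V assms(1) by (simp add: of_bool_def if_distrib[of "\<lambda>x. _ * x"] if_distrib[of "\<lambda>x. x * _"] cong: if_cong)
  also have "(\<Sum>v\<in>V. g v * wick_sum (\<lambda>x. of_bool (x = a)) (\<lambda>ys. expectation (mixed (v # ys) gs)) xs) =
      wick_sum (\<lambda>x. of_bool (x = a)) (\<lambda>ys. expectation (mixed ys (g # gs))) xs"
    unfolding wick_sum_linear[symmetric]
    using Cons.prems by (intro wick_sum_cong) (auto simp: expectation_mixed_Cons subset_iff)
  also have "(\<Sum>v\<in>V. g v * wick_sum (\<lambda>g. g a) (\<lambda>hs. expectation (mixed (v # xs) hs)) gs) =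
      wick_sum (\<lambda>g. g a) (\<lambda>hs. expectation (mixed xs (g # hs))) gs"
    unfolding wick_sum_linear[symmetric]
    using Cons.prems by (intro wick_sum_cong) (auto simp: expectation_mixed_Cons)
  finally show ?case by (simp add: algebra_simps)
qed

lemma wick_lin:
  "expectation (mixed [] (h # gs)) = wick_sum (cov h) (\<lambda>hs. expectation (mixed [] hs)) gs"
proof -
  have "expectation (mixed [] (h # gs)) = (\<Sum>v\<in>V. h v * expectation (mixed [v] gs))"
    by (simp add: expectation_mixed_Cons)
  also have "\<dots> = (\<Sum>v\<in>V. h v * (\<sigma>2 * wick_sum (\<lambda>g. g v) (\<lambda>hs. expectation (mixed [] hs)) gs))"
    by (intro sum.cong refl) (simp add: wick_mixed)
  also have "\<dots> = \<sigma>2 * wick_sum (\<lambda>g. \<Sum>v\<in>V. h v * g v) (\<lambda>hs. expectation (mixed [] hs)) gs"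
    unfolding wick_sum_coeff_linear by (simp add: sum_distrib_left algebra_simps)
  also have "\<dots> = wick_sum (cov h) (\<lambda>hs. expectation (mixed [] hs)) gs"
    by (simp add: cov_def[abs_def] wick_sum_scale)
  finally show ?thesis .
qed

lemma expectation_mixed_empty: "expectation (mixed [] []) = 1"
  by (simp add: mixed_def[abs_def] prob_space)

lemma integrable_lin4: "integrable M (\<lambda>\<omega>. lin a \<omega> * lin b \<omega> * (lin c \<omega> * lin d \<omega>))"
  using integrable_mixed[of "[]" "[a, b, c, d]"] by (simp add: mixed_def[abs_def] mult_ac)

lemma integrable_lin6: "integrable M (\<lambda>\<omega>. lin a \<omega> * lin b \<omega> * lin c \<omega> * (lin d \<omega> * lin e \<omega> * lin f \<omega>))"
  using integrable_mixed[of "[]" "[a, b, c, d, e, f]"] by (simp add: mixed_def[abs_def] mult_ac)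

lemma expectation_lin4:
  "expectation (\<lambda>\<omega>. lin a \<omega> * lin b \<omega> * (lin c \<omega> * lin d \<omega>)) =
    cov a b * cov c d + cov a c * cov b d + cov a d * cov b c"
proof -
  have "expectation (\<lambda>\<omega>. lin a \<omega> * lin b \<omega> * (lin c \<omega> * lin d \<omega>)) = expectation (mixed [] [a, b, c, d])"
    by (simp add: mixed_def[abs_def] mult_ac)
  also have "\<dots> = cov a b * cov c d + cov a c * cov b d + cov a d * cov b c"
    by (simp add: wick_lin expectation_mixed_empty)
  finally show ?thesis .
qed

text \<open>The fifteen perfect pairings of six forms, grouped by the partner of
  \<open>a\<close>.\<close>

lemma expectation_lin6:
  "expectation (\<lambda>\<omega>. lin a \<omega> * lin b \<omega> * lin c \<omega> * (lin d \<omega> * lin e \<omega> * lin f \<omega>)) =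
    cov a b * (cov c d * cov e f + cov c e * cov d f + cov c f * cov d e) +
    cov a c * (cov b d * cov e f + cov b e * cov d f + cov b f * cov d e) +
    cov a d * (cov b c * cov e f + cov b e * cov c f + cov b f * cov c e) +
    cov a e * (cov b c * cov d f + cov b d * cov c f + cov b f * cov c d) +
    cov a f * (cov b c * cov d e + cov b d * cov c e + cov b e * cov c d)"
proof -
  have "expectation (\<lambda>\<omega>. lin a \<omega> * lin b \<omega> * lin c \<omega> * (lin d \<omega> * lin e \<omega> * lin f \<omega>)) = expectation (mixed [] [a, b, c, d, e, f])"
    by (simp add: mixed_def[abs_def] mult_ac)
  also have "\<dots> = cov a b * (cov c d * cov e f + cov c e * cov d f + cov c f * cov d e) +
    cov a c * (cov b d * cov e f + cov b e * cov d f + cov b f * cov d e) +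
    cov a d * (cov b c * cov e f + cov b e * cov c f + cov b f * cov c e) +
    cov a e * (cov b c * cov d f + cov b d * cov c f + cov b f * cov c d) +
    cov a f * (cov b c * cov d e + cov b d * cov c e + cov b e * cov c d)"
    by (simp add: wick_lin expectation_mixed_empty algebra_simps)
  finally show ?thesis .
qed

end

subsection \<open>Increments of the Wiener process\<close>

text \<open>The moments of the centred normal law of variance \<open>v\<close>: for n = 2k the
  quotient of factorials and powers of 2 is the double factorial (2k-1)!!.\<close>

definition normal_moment :: "real \<Rightarrow> nat \<Rightarrow> real" where
  "normal_moment v n = (if even n then v ^ (n div 2) * fact n / (2 ^ (n div 2) * fact (n div 2)) else 0)"

lemma normal_moment_Suc: "normal_moment v (Suc n) = v * real n * normal_moment v (n - 1)"
proof (cases "odd n")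
  case True
  then obtain k where n: "n = 2 * k + 1" by (auto elim: oddE)
  have *: "v * w * (2 * x * (y * F)) / (2 * p * (x * g)) = v * y * (w * F / (p * g))"
    if "x \<noteq> 0" for w x y F p g :: real
    using that by simp
  have "normal_moment v (Suc n) =
      v * v ^ k * (2 * (real k + 1) * ((2 * real k + 1) * fact (2 * k))) / (2 * 2 ^ k * ((real k + 1) * fact k))"
    by (simp add: normal_moment_def n algebra_simps)
  also have "\<dots> = v * real n * normal_moment v (n - 1)"
    by (subst *) (auto simp: normal_moment_def n)
  finally show ?thesis .
qed (cases n; simp add: normal_moment_def)

lemma has_bochner_integral_normal_moment:
  assumes "0 < v"
  shows "has_bochner_integral lborel (\<lambda>x. normal_density 0 (sqrt v) x * x ^ n) (normal_moment v n)"
proof (cases "even n")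
  case True
  then obtain k where n: "n = 2 * k" by (auto elim: evenE)
  show ?thesis using normal_moment_even[of "sqrt v" 0 k] assms
    by (simp add: n normal_moment_def power_divide field_simps)
next
  case False
  then obtain k where n: "n = 2 * k + 1" by (auto elim: oddE)
  show ?thesis using normal_moment_odd[of "sqrt v" 0 k] assms
    by (simp add: n normal_moment_def)
qed

lemma (in prob_space) indep_var_of_indep_set:
  assumes ind: "indep_set (sets A) (sets B)"
    and sp: "space A = space M" "space B = space M"
    and X: "X \<in> measurable A S" and Y: "Y \<in> measurable B R"
  shows "indep_var S X R Y"
proof -
  have sA: "sets A \<subseteq> events" and sB: "sets B \<subseteq> events"
    using indep_setD_ev1[OF ind] indep_setD_ev2[OF ind] .
  have rX: "random_variable S X"
    using X sA sp by (auto simp: measurable_def)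
  have rY: "random_variable R Y"
    using Y sB sp by (auto simp: measurable_def)
  have 1: "sigma_sets (space M) {X -` C \<inter> space M |C. C \<in> sets S} \<subseteq> sets A"
    using X sp by (subst sp(1)[symmetric], intro sets.sigma_sets_subset) (auto dest: measurable_sets)
  have 2: "sigma_sets (space M) {Y -` C \<inter> space M |C. C \<in> sets R} \<subseteq> sets B"
    using Y sp by (subst sp(2)[symmetric], intro sets.sigma_sets_subset) (auto dest: measurable_sets)
  show ?thesis
    unfolding indep_var_eq using rX rY ind 1 2 unfolding indep_sets2_eq by blast
qed

text \<open>Lebesgue measure on the interval, of total mass \<open>b - a\<close>; despite the name
  it is not normalized.\<close>

abbreviation unif_on :: "real \<Rightarrow> real \<Rightarrow> real measure" where
  "unif_on a b \<equiv> restrict_space lborel {a..b}"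

lemma borel_measurable_unif_on:
  "g \<in> borel_measurable borel \<Longrightarrow> g \<in> borel_measurable (unif_on a b)"
  by (intro measurable_restrict_space1) simp

lemma emeasure_unif_on: "a \<le> b \<Longrightarrow> emeasure (unif_on a b) {a..b} = ennreal (b - a)"
  by (simp add: emeasure_restrict_space)

lemma finite_measure_unif_on: "a \<le> b \<Longrightarrow> finite_measure (unif_on a b)"
  by (intro finite_measureI) (simp add: emeasure_unif_on space_restrict_space)

lemma measure_unif_on: "a \<le> b \<Longrightarrow> measure (unif_on a b) {a..b} = b - a"
  by (simp add: measure_def emeasure_unif_on)

lemma integrable_unif_on_bounded:
  fixes g :: "real \<Rightarrow> real"
  assumes "a \<le> b" "g \<in> borel_measurable (unif_on a b)" "\<And>s. s \<in> {a..b} \<Longrightarrow> \<bar>g s\<bar> \<le> K"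
  shows "integrable (unif_on a b) g"
  using assms
  by (intro finite_measure.integrable_const_bound[OF finite_measure_unif_on, of _ _ _ K] AE_I2)
     (auto simp: space_restrict_space)

lemma integral_unif_on_le:
  fixes g :: "real \<Rightarrow> real"
  assumes "a \<le> b" "g \<in> borel_measurable (unif_on a b)" "\<And>s. s \<in> {a..b} \<Longrightarrow> \<bar>g s\<bar> \<le> K"
  shows "integral\<^sup>L (unif_on a b) g \<le> K * (b - a)"
proof -
  have "integral\<^sup>L (unif_on a b) g \<le> integral\<^sup>L (unif_on a b) (\<lambda>_. K)"
    using assms finite_measure_unif_on[of a b]
    by (intro integral_mono integrable_unif_on_bounded[of _ _ _ K])
       (force simp: space_restrict_space finite_measure.integrable_const)+
  then show ?thesis using assms by (simp add: measure_unif_on space_restrict_space mult.commute)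
qed

text \<open>The length of the overlap of two intervals, in the form in which polarization of the
  variances \<open>\<bar>v - u\<bar>\<close> produces the covariance of two Wiener
  increments.\<close>

lemma integral_unif_on_indicators:
  assumes "t \<le> a" "a \<le> b" "b \<le> T" "t \<le> c" "c \<le> d" "d \<le> T"
  shows "(\<integral>s. indicator {a<..b} s * indicator {c<..d} s \<partial>unif_on t T) =
    (\<bar>d - a\<bar> + \<bar>b - c\<bar> - \<bar>b - d\<bar> - \<bar>a - c\<bar>) / (2::real)"
proof -
  have "(\<integral>s. (indicator {a<..b} s * indicator {c<..d} s :: real) \<partial>unif_on t T) =
      (\<integral>s. indicator {t..T} s *\<^sub>R (indicator {a<..b} s * indicator {c<..d} s :: real) \<partial>lborel)"
    by (subst integral_restrict_space) auto
  also have "\<dots> = (\<integral>s. indicator {max a c<..min b d} s \<partial>lborel)"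
    using assms by (intro Bochner_Integration.integral_cong) (auto simp: indicator_def)
  also have "\<dots> = max 0 (min b d - max a c)"
    by (cases "max a c \<le> min b d") auto
  also have "\<dots> = (\<bar>d - a\<bar> + \<bar>b - c\<bar> - \<bar>b - d\<bar> - \<bar>a - c\<bar>) / 2"
    using assms by (auto simp: max_def min_def abs_if)
  finally show ?thesis .
qed

section \<open>Partitions and step functions\<close>

abbreviation cell :: "(nat \<Rightarrow> real) \<Rightarrow> nat \<Rightarrow> real \<Rightarrow> real" where
  "cell \<tau> k \<equiv> indicator {\<tau> k<..\<tau> (Suc k)}"

lemma is_partition_mono:
  assumes "is_partition a b \<tau> N" "k \<le> l" "l \<le> N"
  shows "\<tau> k \<le> \<tau> l"
  using assms(2,3)
proof (induction l rule: dec_induct)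
  case (step n)
  then have "\<tau> n < \<tau> (Suc n)" using assms(1) by (auto simp: is_partition_def)
  then show ?case using step by simp
qed simp

lemma is_partition_bounds:
  assumes "is_partition a b \<tau> N" "k \<le> N"
  shows "a \<le> \<tau> k" "\<tau> k \<le> b"
  using is_partition_mono[OF assms(1), of 0 k] is_partition_mono[OF assms(1), of k N] assms
  unfolding is_partition_def by simp_all

lemma is_partition_cell:
  assumes "is_partition a b \<tau> N" "a < s" "s \<le> b"
  obtains k where "k < N" "\<tau> k < s" "s \<le> \<tau> (Suc k)"
proof -
  have N: "s \<le> \<tau> N" using assms by (simp add: is_partition_def)
  define l where "l = (LEAST l. s \<le> \<tau> l)"
  have l: "s \<le> \<tau> l" unfolding l_def using N by (rule LeastI)
  have lN: "l \<le> N" unfolding l_def using N by (rule Least_le)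
  have "l \<noteq> 0"
  proof
    assume "l = 0"
    with l assms show False by (simp add: is_partition_def)
  qed
  then obtain k where k: "l = Suc k" by (cases l) auto
  have "\<not> s \<le> \<tau> k" using not_less_Least[of k "\<lambda>l. s \<le> \<tau> l"] k l_def by auto
  then show ?thesis using that[of k] l lN k by auto
qed

lemma sum_cells:
  fixes x :: "nat \<Rightarrow> real"
  assumes "is_partition a b \<tau> N" "k < N" "\<tau> k < s" "s \<le> \<tau> (Suc k)"
  shows "(\<Sum>l<N. x l * cell \<tau> l s) = x k"
proof -
  have "cell \<tau> l s = (if l = k then 1 else 0::real)" if "l < N" for l
  proof (cases l k rule: linorder_cases)
    case less
    then have "\<tau> (Suc l) \<le> \<tau> k" using assms by (intro is_partition_mono[OF assms(1)]) auto
    then show ?thesis using assms less by auto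
  next
    case greater
    then have "\<tau> (Suc k) \<le> \<tau> l" using assms that by (intro is_partition_mono[OF assms(1)]) auto
    then show ?thesis using assms greater by auto
  qed (use assms in auto)
  then have "(\<Sum>l<N. x l * cell \<tau> l s) = (\<Sum>l<N. x l * (if l = k then 1 else 0))"
    by (intro sum.cong) auto
  also have "\<dots> = x k" using assms by (simp add: if_distrib cong: if_cong)
  finally show ?thesis .
qed

text \<open>The \<open>q\<close>-th grid has \<open>Suc q\<close> cells, so that there is at least
  one cell and the mesh is a proper quotient for every \<open>q\<close>.\<close>

definition unif_part :: "real \<Rightarrow> real \<Rightarrow> nat \<Rightarrow> nat \<Rightarrow> real" where
  "unif_part a b q k = a + real k * ((b - a) / real (Suc q))"

lemma unif_part_step:
  "unif_part a b q (Suc k) - unif_part a b q k = (b - a) / real (Suc q)"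
  unfolding unif_part_def of_nat_Suc distrib_right by simp

lemma is_partition_uniform: "a < b \<Longrightarrow> is_partition a b (unif_part a b q) (Suc q)"
proof -
  assume ab: "a < b"
  have "unif_part a b q k < unif_part a b q (Suc k)" for k
    using unif_part_step[of a b q k] ab by (simp add: algebra_simps)
  then show ?thesis
    by (simp add: is_partition_def) (simp add: unif_part_def del: of_nat_Suc)
qed

lemma uniform_mesh_tendsto_0: "(\<lambda>q. (b - a) / real (Suc q)) \<longlonglongrightarrow> 0"
  using LIMSEQ_Suc[OF lim_const_over_n[of "b - a"]] by simp

lemma fine_partitions_uniform: "a < b \<Longrightarrow> fine_partitions a b (unif_part a b) Suc"
  unfolding fine_partitions_def
  by (intro conjI allI impI exI[of _ "\<lambda>q. (b - a) / real (Suc q)"] is_partition_uniform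
      uniform_mesh_tendsto_0) (simp_all only: unif_part_step order_refl)

section \<open>Moments of the increments of the Wiener process\<close>

locale wiener = prob_space M
  for M :: "'a measure" +
  fixes F :: "real \<Rightarrow> 'a measure" and f :: "nat \<Rightarrow> real \<Rightarrow> 'a \<Rightarrow> real" and m :: nat and t T :: real
  assumes filt: "rc_filtration M F T" and wien: "std_wiener M F T m f"
    and t0: "0 \<le> t" and tT: "t < T"
begin

lemma f_measurable_filtration: "i \<in> {1..m} \<Longrightarrow> s \<in> {0..T} \<Longrightarrow> f i s \<in> borel_measurable (F s)"
  using wien by (auto simp: std_wiener_def)

lemma filtration_mono: "0 \<le> s \<Longrightarrow> s \<le> u \<Longrightarrow> u \<le> T \<Longrightarrow> subalgebra (F u) (F s)"
  using filt by (auto simp: rc_filtration_def subalgebra_def)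

lemma filtration_space: "s \<in> {0..T} \<Longrightarrow> space (F s) = space M"
  using filt by (auto simp: rc_filtration_def subalgebra_def)

lemma f_measurable: "i \<in> {1..m} \<Longrightarrow> s \<in> {0..T} \<Longrightarrow> f i s \<in> borel_measurable M"
  using filt by (intro measurable_from_subalg[OF _ f_measurable_filtration]) (simp_all add: rc_filtration_def)

lemma f_measurable': "i \<in> {1..m} \<Longrightarrow> s \<in> {t..T} \<Longrightarrow> f i s \<in> borel_measurable M"
  using f_measurable t0 by auto

lemma increment_moment:
  assumes "i \<in> {1..m}" "0 \<le> s" "s < u" "u \<le> T"
  shows "integrable M (\<lambda>\<omega>. (f i u \<omega> - f i s \<omega>) ^ n)"
    and "expectation (\<lambda>\<omega>. (f i u \<omega> - f i s \<omega>) ^ n) = normal_moment (u - s) n"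
proof -
  have D: "distributed M lborel (\<lambda>\<omega>. f i u \<omega> - f i s \<omega>) (normal_density 0 (sqrt (u - s)))"
    using wien assms by (auto simp: std_wiener_def)
  have B: "has_bochner_integral lborel (\<lambda>x. normal_density 0 (sqrt (u - s)) x * x ^ n) (normal_moment (u - s) n)"
    using assms by (intro has_bochner_integral_normal_moment) simp
  show "integrable M (\<lambda>\<omega>. (f i u \<omega> - f i s \<omega>) ^ n)"
    using distributed_integrable[OF D, of "\<lambda>x. x ^ n"] B by (auto simp: has_bochner_integral_iff)
  show "expectation (\<lambda>\<omega>. (f i u \<omega> - f i s \<omega>) ^ n) = normal_moment (u - s) n"
    using distributed_integral[OF D, of "\<lambda>x. x ^ n"] B by (auto simp: has_bochner_integral_iff)
qed

lemma increment_vector_moment: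
  assumes "0 \<le> s" "s < u" "u \<le> T"
  shows "integrable M (\<lambda>\<omega>. \<Prod>i\<in>{1..m}. (f i u \<omega> - f i s \<omega>) ^ e i)"
    and "expectation (\<lambda>\<omega>. \<Prod>i\<in>{1..m}. (f i u \<omega> - f i s \<omega>) ^ e i) = (\<Prod>i\<in>{1..m}. normal_moment (u - s) (e i))"
proof -
  have "indep_vars (\<lambda>_. borel) (\<lambda>i \<omega>. f i u \<omega> - f i s \<omega>) {1..m}"
    using wien assms by (auto simp: std_wiener_def)
  then have I: "indep_vars (\<lambda>_. borel) (\<lambda>i \<omega>. (f i u \<omega> - f i s \<omega>) ^ e i) {1..m}"
    by (rule indep_vars_compose2) auto
  show "integrable M (\<lambda>\<omega>. \<Prod>i\<in>{1..m}. (f i u \<omega> - f i s \<omega>) ^ e i)"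
    using assms increment_moment by (intro indep_vars_integrable[OF _ I]) auto
  show "expectation (\<lambda>\<omega>. \<Prod>i\<in>{1..m}. (f i u \<omega> - f i s \<omega>) ^ e i) = (\<Prod>i\<in>{1..m}. normal_moment (u - s) (e i))"
    using assms increment_moment by (subst indep_vars_lebesgue_integral[OF _ I]) (auto intro!: prod.cong)
qed

text \<open>The product over the first \<open>K\<close> cells is known at time
  \<open>\<tau> K\<close>, and the vector of increments over the next cell is independent of that
  past, so the moment factorizes cell by cell. Measurability with respect to
  \<open>F (\<tau> K)\<close> is part of the claim because the induction step rests on it.\<close>

lemma grid_moment:
  fixes e :: "nat \<Rightarrow> nat \<Rightarrow> nat"
  assumes part: "is_partition t T \<tau> N" and "K \<le> N"
  defines "P \<equiv> \<lambda>K \<omega>. \<Prod>k<K. \<Prod>i\<in>{1..m}. (f i (\<tau> (Suc k)) \<omega> - f i (\<tau> k) \<omega>) ^ e i k"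
  shows "P K \<in> borel_measurable (F (\<tau> K)) \<and> integrable M (P K) \<and>
    expectation (P K) = (\<Prod>k<K. \<Prod>i\<in>{1..m}. normal_moment (\<tau> (Suc k) - \<tau> k) (e i k))"
  using \<open>K \<le> N\<close>
proof (induction K)
  case 0
  then show ?case by (simp add: P_def prob_space)
next
  case (Suc K)
  define s u where "s = \<tau> K" and "u = \<tau> (Suc K)"
  have su: "0 \<le> s" "s < u" "u \<le> T"
    using Suc.prems part is_partition_bounds[OF part, of K] is_partition_bounds[OF part, of "Suc K"] t0
    by (auto simp: s_def u_def is_partition_def)
  define Q where "Q \<omega> = (\<Prod>i\<in>{1..m}. (f i u \<omega> - f i s \<omega>) ^ e i K)" for \<omega>
  have PS: "P (Suc K) = (\<lambda>\<omega>. P K \<omega> * Q \<omega>)"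
    by (simp add: P_def Q_def s_def u_def fun_eq_iff)
  have IH: "P K \<in> borel_measurable (F s)" "integrable M (P K)"
    "expectation (P K) = (\<Prod>k<K. \<Prod>i\<in>{1..m}. normal_moment (\<tau> (Suc k) - \<tau> k) (e i k))"
    using Suc by (auto simp: s_def)
  have sub: "subalgebra (F u) (F s)" using su by (intro filtration_mono) auto
  have fu: "f i u \<in> borel_measurable (F u)" "f i s \<in> borel_measurable (F u)" if "i \<in> {1..m}" for i
    using that su f_measurable_filtration[of i u] measurable_from_subalg[OF sub f_measurable_filtration[of i s]] by auto
  have Qm: "Q \<in> borel_measurable (F u)"
    unfolding Q_def using fu by (intro borel_measurable_prod borel_measurable_power borel_measurable_diff) auto
  have Pm: "P K \<in> borel_measurable (F u)" by (rule measurable_from_subalg[OF sub IH(1)])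
  let ?B = "vimage_algebra (space M) (\<lambda>\<omega>. \<lambda>i\<in>{1..m}. f i u \<omega> - f i s \<omega>) (PiM {1..m} (\<lambda>_. borel :: real measure))"
  have ind: "indep_set (sets (F s)) (sets ?B)"
    using wien su by (auto simp: std_wiener_def)
  have vm: "(\<lambda>\<omega>. \<lambda>i\<in>{1..m}. f i u \<omega> - f i s \<omega>) \<in> measurable ?B (PiM {1..m} (\<lambda>_. borel))"
    by (rule measurable_vimage_algebra1) (auto simp: space_PiM)
  \<comment> \<open>Independence is given for the sigma-algebra generated by the whole vector of
    increments, so \<open>Q\<close> is exhibited as a measurable function of that vector.\<close>
  have "(\<lambda>x. \<Prod>i\<in>{1..m}. x i ^ e i K) \<in> borel_measurable (PiM {1..m} (\<lambda>_. borel :: real measure))"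
    by measurable
  from measurable_compose[OF vm this]
  have "(\<lambda>\<omega>. \<Prod>i\<in>{1..m}. (\<lambda>i\<in>{1..m}. f i u \<omega> - f i s \<omega>) i ^ e i K) \<in> borel_measurable ?B" .
  also have "(\<lambda>\<omega>. \<Prod>i\<in>{1..m}. (\<lambda>i\<in>{1..m}. f i u \<omega> - f i s \<omega>) i ^ e i K) = Q"
    unfolding Q_def by (intro ext prod.cong) auto
  finally have QB: "Q \<in> borel_measurable ?B" .
  have iv: "indep_var borel (P K) borel Q"
    by (rule indep_var_of_indep_set[OF ind _ _ IH(1) QB]) (use su filtration_space in auto)
  note Qi = increment_vector_moment[OF su, of "\<lambda>i. e i K", folded Q_def]
  have "integrable M (P (Suc K))"
    unfolding PS by (rule indep_var_integrable[OF iv IH(2) Qi(1)])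
  moreover have "expectation (P (Suc K)) = expectation (P K) * expectation Q"
    unfolding PS by (rule indep_var_lebesgue_integral[OF iv IH(2) Qi(1)])
  moreover have "P (Suc K) \<in> borel_measurable (F (\<tau> (Suc K)))"
    unfolding PS u_def[symmetric] using Pm Qm by (rule borel_measurable_times)
  ultimately show ?case
    using IH(3) Qi(2) by (simp add: s_def u_def)
qed

definition incr :: "nat \<Rightarrow> nat \<times> nat \<Rightarrow> 'a \<Rightarrow> real" where
  "incr q = (\<lambda>(i, k) \<omega>. f i (unif_part t T q (Suc k)) \<omega> - f i (unif_part t T q k) \<omega>)"

text \<open>On a uniform grid all increments have the same variance, which is why a single
  \<open>\<sigma>2\<close> and a single moment sequence suffice. The index set pairs components with
  cells.\<close>

sublocale grid: gaussian_family M "{1..m} \<times> {..<Suc q}" "incr q" "(T - t) / real (Suc q)"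
  "normal_moment ((T - t) / real (Suc q))" for q
proof unfold_locales
  fix e :: "nat \<times> nat \<Rightarrow> nat"
  have eq: "(\<lambda>\<omega>. \<Prod>v\<in>{1..m} \<times> {..<Suc q}. incr q v \<omega> ^ e v) = (\<lambda>\<omega>. \<Prod>k<Suc q. \<Prod>i\<in>{1..m}.
      (f i (unif_part t T q (Suc k)) \<omega> - f i (unif_part t T q k) \<omega>) ^ e (i, k))"
    by (subst prod.swap) (simp add: prod.cartesian_product incr_def case_prod_unfold del: prod.lessThan_Suc)
  note G = grid_moment[OF is_partition_uniform[OF tT, of q], of "Suc q" "\<lambda>i k. e (i, k)"]
  show "integrable M (\<lambda>\<omega>. \<Prod>v\<in>{1..m} \<times> {..<Suc q}. incr q v \<omega> ^ e v)"
    unfolding eq using G by blast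
  have "expectation (\<lambda>\<omega>. \<Prod>v\<in>{1..m} \<times> {..<Suc q}. incr q v \<omega> ^ e v) =
      (\<Prod>k<Suc q. \<Prod>i\<in>{1..m}. normal_moment ((T - t) / real (Suc q)) (e (i, k)))"
    unfolding eq using G by (simp add: unif_part_step del: prod.lessThan_Suc)
  then show "expectation (\<lambda>\<omega>. \<Prod>v\<in>{1..m} \<times> {..<Suc q}. incr q v \<omega> ^ e v) =
      (\<Prod>v\<in>{1..m} \<times> {..<Suc q}. normal_moment ((T - t) / real (Suc q)) (e v))"
    by (subst (asm) prod.swap) (simp add: prod.cartesian_product case_prod_unfold del: prod.lessThan_Suc)
next
  show "normal_moment ((T - t) / real (Suc q)) (Suc n) =
      (T - t) / real (Suc q) * real n * normal_moment ((T - t) / real (Suc q)) (n - 1)" for n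
    by (rule normal_moment_Suc)
qed simp

lemma increment_variance:
  assumes "i \<in> {1..m}" "u \<in> {t..T}" "v \<in> {t..T}"
  shows "integrable M (\<lambda>\<omega>. (f i v \<omega> - f i u \<omega>)\<^sup>2)" "expectation (\<lambda>\<omega>. (f i v \<omega> - f i u \<omega>)\<^sup>2) = \<bar>v - u\<bar>"
proof -
  have "integrable M (\<lambda>\<omega>. (f i v \<omega> - f i u \<omega>)\<^sup>2) \<and> expectation (\<lambda>\<omega>. (f i v \<omega> - f i u \<omega>)\<^sup>2) = \<bar>v - u\<bar>"
  proof (cases u v rule: linorder_cases)
    case less
    then show ?thesis using increment_moment[of i u v 2] assms t0 by (simp add: normal_moment_def fact_2)
  next
    case greater
    then show ?thesis using increment_moment[of i v u 2] assms t0
      by (simp add: normal_moment_def fact_2 power2_commute[of "f i v _"])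
  qed simp
  then show "integrable M (\<lambda>\<omega>. (f i v \<omega> - f i u \<omega>)\<^sup>2)" "expectation (\<lambda>\<omega>. (f i v \<omega> - f i u \<omega>)\<^sup>2) = \<bar>v - u\<bar>"
    by auto
qed

text \<open>The product of two increments is a combination of four squared increments, so variances
  determine it for intervals in any relative position and overlaps need not be subdivided.\<close>

lemma increment_covariance:
  assumes i: "i \<in> {1..m}" and ab: "t \<le> a" "a \<le> b" "b \<le> T" and cd: "t \<le> c" "c \<le> d" "d \<le> T"
  shows "integrable M (\<lambda>\<omega>. (f i b \<omega> - f i a \<omega>) * (f i d \<omega> - f i c \<omega>))"
    and "expectation (\<lambda>\<omega>. (f i b \<omega> - f i a \<omega>) * (f i d \<omega> - f i c \<omega>)) =
      (\<integral>s. indicator {a<..b} s * indicator {c<..d} s \<partial>unif_on t T)"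
proof -
  have eq: "(\<lambda>\<omega>. (f i b \<omega> - f i a \<omega>) * (f i d \<omega> - f i c \<omega>)) =
    (\<lambda>\<omega>. ((f i d \<omega> - f i a \<omega>)\<^sup>2 + (f i b \<omega> - f i c \<omega>)\<^sup>2 - (f i b \<omega> - f i d \<omega>)\<^sup>2 - (f i a \<omega> - f i c \<omega>)\<^sup>2) / 2)"
    by (simp add: fun_eq_iff power2_eq_square algebra_simps)
  show "integrable M (\<lambda>\<omega>. (f i b \<omega> - f i a \<omega>) * (f i d \<omega> - f i c \<omega>))"
    unfolding eq using assms by (intro integrable_divide_zero Bochner_Integration.integrable_add Bochner_Integration.integrable_diff increment_variance) auto
  show "expectation (\<lambda>\<omega>. (f i b \<omega> - f i a \<omega>) * (f i d \<omega> - f i c \<omega>)) =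
      (\<integral>s. indicator {a<..b} s * indicator {c<..d} s \<partial>unif_on t T)"
    unfolding eq integral_unif_on_indicators[OF ab cd] using assms
    by (simp add: increment_variance)
qed

text \<open>The Ito isometry for a finite family of intervals that may overlap. This generality lets
  sums over two different partitions be compared without a common refinement.\<close>

lemma increment_isometry:
  assumes i: "i \<in> {1..m}" and fin: "finite A"
    and uv: "\<And>a. a \<in> A \<Longrightarrow> t \<le> u a \<and> u a \<le> v a \<and> v a \<le> T"
  shows "msq M (\<lambda>\<omega>. \<Sum>a\<in>A. c a * (f i (v a) \<omega> - f i (u a) \<omega>)) =
    ennreal (\<integral>s. (\<Sum>a\<in>A. c a * indicator {u a<..v a} s)\<^sup>2 \<partial>unif_on t T)"
proof -
  have eq1: "(\<Sum>a\<in>A. c a * (f i (v a) \<omega> - f i (u a) \<omega>))\<^sup>2 =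
      (\<Sum>a\<in>A. \<Sum>b\<in>A. c a * c b * ((f i (v a) \<omega> - f i (u a) \<omega>) * (f i (v b) \<omega> - f i (u b) \<omega>)))" for \<omega>
    by (simp add: power2_eq_square sum_product algebra_simps)
  have eq2: "(\<Sum>a\<in>A. c a * indicator {u a<..v a} s)\<^sup>2 =
      (\<Sum>a\<in>A. \<Sum>b\<in>A. c a * c b * (indicator {u a<..v a} s * indicator {u b<..v b} s :: real))" for s
    by (simp add: power2_eq_square sum_product algebra_simps)
  have int: "integrable M (\<lambda>\<omega>. (\<Sum>a\<in>A. c a * (f i (v a) \<omega> - f i (u a) \<omega>))\<^sup>2)"
    unfolding eq1 using i uv
    by (intro Bochner_Integration.integrable_sum integrable_mult_right increment_covariance) auto
  have intU: "integrable (unif_on t T) (\<lambda>s. indicator {u a<..v a} s * indicator {u b<..v b} s :: real)" for a b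
    using tT by (intro integrable_unif_on_bounded[of _ _ _ 1] borel_measurable_unif_on) (auto simp: indicator_def)
  have "expectation (\<lambda>\<omega>. (\<Sum>a\<in>A. c a * (f i (v a) \<omega> - f i (u a) \<omega>))\<^sup>2) =
      (\<Sum>a\<in>A. \<Sum>b\<in>A. c a * c b * expectation (\<lambda>\<omega>. (f i (v a) \<omega> - f i (u a) \<omega>) * (f i (v b) \<omega> - f i (u b) \<omega>)))"
    unfolding eq1 using i uv
    by (simp add: Bochner_Integration.integral_sum increment_covariance)
  also have "\<dots> = (\<Sum>a\<in>A. \<Sum>b\<in>A. c a * c b * (\<integral>s. indicator {u a<..v a} s * indicator {u b<..v b} s \<partial>unif_on t T))"
    using i uv by (intro sum.cong refl) (simp add: increment_covariance)
  also have "\<dots> = (\<integral>s. (\<Sum>a\<in>A. c a * indicator {u a<..v a} s)\<^sup>2 \<partial>unif_on t T)"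
    unfolding eq2 using intU by (simp add: Bochner_Integration.integral_sum)
  finally have "expectation (\<lambda>\<omega>. (\<Sum>a\<in>A. c a * (f i (v a) \<omega> - f i (u a) \<omega>))\<^sup>2) =
      (\<integral>s. (\<Sum>a\<in>A. c a * indicator {u a<..v a} s)\<^sup>2 \<partial>unif_on t T)" .
  moreover have "msq M (\<lambda>\<omega>. \<Sum>a\<in>A. c a * (f i (v a) \<omega> - f i (u a) \<omega>)) =
      ennreal (expectation (\<lambda>\<omega>. (\<Sum>a\<in>A. c a * (f i (v a) \<omega> - f i (u a) \<omega>))\<^sup>2))"
    by (rule nn_integral_eq_integral[OF int]) simp
  ultimately show ?thesis by metis
qed

end

subsection \<open>Orthonormal systems on an interval\<close>

lemma integral_unif_on_indicator_FTC:
  fixes h H :: "real \<Rightarrow> real"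
  assumes ab: "t \<le> a" "a \<le> b" "b \<le> T" and h: "continuous_on {t..T} h"
    and H: "\<And>x. x \<in> {t..T} \<Longrightarrow> (H has_real_derivative h x) (at x within {t..T})"
  shows "(\<integral>s. h s * indicator {a<..b} s \<partial>unif_on t T) = H b - H a"
proof -
  have "(\<integral>s. h s * indicator {a<..b} s \<partial>unif_on t T) =
      (\<integral>s. indicator {t..T} s *\<^sub>R (h s * indicator {a<..b} s) \<partial>lborel)"
    by (subst integral_restrict_space) auto
  also have "\<dots> = (\<integral>s. indicator {a..b} s *\<^sub>R h s \<partial>lborel)"
  proof (rule integral_cong_AE)
    have *: "(\<lambda>s. indicator {a..b} s *\<^sub>R h s) \<in> borel_measurable borel"
      using h ab by (intro borel_measurable_continuous_on_indicator) (auto intro: continuous_on_subset)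
    then show "(\<lambda>s. indicator {a..b} s *\<^sub>R h s) \<in> borel_measurable lborel" by simp
    have "(\<lambda>s. indicator {t..T} s *\<^sub>R (h s * indicator {a<..b} s)) = (\<lambda>s. indicator {a<..b} s * (indicator {a..b} s *\<^sub>R h s))"
      using ab by (auto simp: fun_eq_iff indicator_def)
    also have "\<dots> \<in> borel_measurable lborel"
      using * by (intro borel_measurable_times) auto
    finally show "(\<lambda>s. indicator {t..T} s *\<^sub>R (h s * indicator {a<..b} s)) \<in> borel_measurable lborel" .
    show "AE s in lborel. indicator {t..T} s *\<^sub>R (h s * indicator {a<..b} s) = indicator {a..b} s *\<^sub>R h s"
      using AE_lborel_singleton[of a] by eventually_elim (use ab in \<open>auto simp: indicator_def\<close>)
  qed
  also have "\<dots> = H b - H a"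
  proof (rule integral_FTC_atLeastAtMost[OF ab(2)])
    show "(H has_vector_derivative h x) (at x within {a..b})" if "a \<le> x" "x \<le> b" for x
      using H[of x] that ab
      by (auto simp: has_real_derivative_iff_has_vector_derivative intro: has_vector_derivative_within_subset)
    show "continuous_on {a..b} h" using h ab by (auto intro: continuous_on_subset)
  qed
  finally show ?thesis .
qed

lemma integral_unif_on_FTC:
  fixes h H :: "real \<Rightarrow> real"
  assumes "t \<le> T" "continuous_on {t..T} h"
    and H: "\<And>x. x \<in> {t..T} \<Longrightarrow> (H has_real_derivative h x) (at x within {t..T})"
  shows "(\<integral>s. h s \<partial>unif_on t T) = H T - H t"
proof -
  have "(\<integral>s. h s \<partial>unif_on t T) = (\<integral>s. indicator {t..T} s *\<^sub>R h s \<partial>lborel)"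
    by (subst integral_restrict_space) auto
  also have "\<dots> = H T - H t"
    using H by (intro integral_FTC_atLeastAtMost assms) (simp add: has_real_derivative_iff_has_vector_derivative)
  finally show ?thesis .
qed

lemma integral_unif_on_eq_integral:
  fixes h :: "real \<Rightarrow> real"
  assumes "t \<le> T" "continuous_on {t..T} h"
  shows "(\<integral>s. h s \<partial>unif_on t T) = integral {t..T} h"
  using integral_unif_on_FTC[OF assms integral_has_real_derivative[OF assms(2)]] by simp

lemma abs_sum_product_le:
  fixes x y :: "'b \<Rightarrow> real"
  shows "\<bar>\<Sum>k\<in>A. x k * y k\<bar> \<le> ((\<Sum>k\<in>A. (x k)\<^sup>2) + (\<Sum>k\<in>A. (y k)\<^sup>2)) / 2"
proof -
  have "\<bar>\<Sum>k\<in>A. x k * y k\<bar> \<le> (\<Sum>k\<in>A. \<bar>x k * y k\<bar>)" by (rule sum_abs)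
  also have "\<dots> \<le> (\<Sum>k\<in>A. ((x k)\<^sup>2 + (y k)\<^sup>2) / 2)"
  proof (rule sum_mono)
    fix k
    have "0 \<le> (\<bar>x k\<bar> - \<bar>y k\<bar>)\<^sup>2" by simp
    then show "\<bar>x k * y k\<bar> \<le> ((x k)\<^sup>2 + (y k)\<^sup>2) / 2" by (simp add: power2_diff abs_mult)
  qed
  also have "\<dots> = ((\<Sum>k\<in>A. (x k)\<^sup>2) + (\<Sum>k\<in>A. (y k)\<^sup>2)) / 2"
    by (simp add: sum.distrib flip: sum_divide_distrib)
  finally show ?thesis .
qed

lemma abs_sum_product_le_bound:
  fixes x y :: "'b \<Rightarrow> real"
  assumes "(\<Sum>j\<in>J. (x j)\<^sup>2) \<le> K" "(\<Sum>j\<in>J. (y j)\<^sup>2) \<le> K"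
  shows "\<bar>\<Sum>j\<in>J. x j * y j\<bar> \<le> K"
  using abs_sum_product_le[of x y J] assms by simp

text \<open>\<open>\<Phi> j\<close> is the antiderivative of \<open>\<phi> j\<close> that vanishes
  at \<open>t\<close>; coefficients of indicators are differences of its values. The Lipschitz bound
  serves the existence of the Ito integrals. With orthonormality alone, Bessel's inequality is
  available but not Parseval's identity.\<close>

locale orthonormal_system =
  fixes t T :: real and \<phi> \<Phi> :: "nat \<Rightarrow> real \<Rightarrow> real"
  assumes t_less_T: "t < T"
    and Phi_deriv: "(\<Phi> j has_real_derivative \<phi> j s) (at s)"
    and phi_Lipschitz: "\<exists>K. \<forall>x y. \<bar>\<phi> j x - \<phi> j y\<bar> \<le> K * \<bar>x - y\<bar>"
    and Phi_t: "\<Phi> j t = 0"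
    and ortho: "(\<integral>s. \<phi> i s * \<phi> j s \<partial>unif_on t T) = of_bool (i = j)"
begin

abbreviation "U \<equiv> unif_on t T"
abbreviation "L \<equiv> T - t"
abbreviation "fcoeff k g \<equiv> \<integral>s. \<phi> k s * g s \<partial>U"

text \<open>Bounded measurable functions on the interval contain continuous functions and Borel
  indicators and are closed under sums and products, so integrability conditions reduce to
  structural rules.\<close>

definition nice :: "(real \<Rightarrow> real) \<Rightarrow> bool" where
  "nice h \<longleftrightarrow> h \<in> borel_measurable U \<and> (\<exists>K. \<forall>s\<in>{t..T}. \<bar>h s\<bar> \<le> K)"

lemma nice_integrable: "nice h \<Longrightarrow> integrable U h"
  using t_less_T unfolding nice_def by (auto intro: integrable_unif_on_bounded)

lemma nice_const: "nice (\<lambda>_. c)"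
  by (auto simp: nice_def)

lemma nice_indicator: "A \<in> sets borel \<Longrightarrow> nice (indicator A)"
  unfolding nice_def
  by (intro conjI exI[of _ 1] borel_measurable_unif_on) (auto simp: indicator_def)

lemma nice_add: "nice g \<Longrightarrow> nice h \<Longrightarrow> nice (\<lambda>s. g s + h s)"
  unfolding nice_def
proof (elim conjE exE)
  fix K K' assume "\<forall>s\<in>{t..T}. \<bar>g s\<bar> \<le> K" "\<forall>s\<in>{t..T}. \<bar>h s\<bar> \<le> K'"
    and [measurable]: "g \<in> borel_measurable U" "h \<in> borel_measurable U"
  then show "(\<lambda>s. g s + h s) \<in> borel_measurable U \<and> (\<exists>K. \<forall>s\<in>{t..T}. \<bar>g s + h s\<bar> \<le> K)"
    by (intro conjI exI[of _ "K + K'"]) (force intro: order_trans[OF abs_triangle_ineq] add_mono)+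
qed

lemma nice_mult: "nice g \<Longrightarrow> nice h \<Longrightarrow> nice (\<lambda>s. g s * h s)"
  unfolding nice_def
proof (elim conjE exE)
  fix K K' assume K: "\<forall>s\<in>{t..T}. \<bar>g s\<bar> \<le> K" "\<forall>s\<in>{t..T}. \<bar>h s\<bar> \<le> K'"
    and [measurable]: "g \<in> borel_measurable U" "h \<in> borel_measurable U"
  have "\<bar>g s * h s\<bar> \<le> K * K'" if "s \<in> {t..T}" for s
    unfolding abs_mult using K that by (intro mult_mono) (auto intro: order_trans[OF abs_ge_zero])
  then show "(\<lambda>s. g s * h s) \<in> borel_measurable U \<and> (\<exists>K. \<forall>s\<in>{t..T}. \<bar>g s * h s\<bar> \<le> K)"
    by (intro conjI exI[of _ "K * K'"]) auto
qed

lemma nice_diff: "nice g \<Longrightarrow> nice h \<Longrightarrow> nice (\<lambda>s. g s - h s)"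
  using nice_add[of g "\<lambda>s. - 1 * h s"] nice_mult[OF nice_const[of "-1"], of h] by simp

lemma nice_power2: "nice g \<Longrightarrow> nice (\<lambda>s. (g s)\<^sup>2)"
  using nice_mult[of g g] by (simp add: power2_eq_square)

lemma nice_sum: "(\<And>a. a \<in> A \<Longrightarrow> nice (g a)) \<Longrightarrow> nice (\<lambda>s. \<Sum>a\<in>A. g a s)"
  by (induction A rule: infinite_finite_induct) (auto intro: nice_add nice_const)

lemma nice_continuous:
  assumes "continuous_on {t..T} h"
  shows "nice h"
proof -
  have "h \<in> borel_measurable (restrict_space borel {t..T})"
    using assms by (rule borel_measurable_continuous_on_restrict)
  moreover have "borel_measurable U = borel_measurable (restrict_space borel {t..T})"
    by (intro measurable_cong_sets refl sets_restrict_space_cong) simp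
  moreover have "bounded (h ` {t..T})"
    using assms by (intro compact_imp_bounded compact_continuous_image) auto
  ultimately show ?thesis by (auto simp: nice_def bounded_iff)
qed

lemma continuous_phi: "continuous_on A (\<phi> j)"
proof -
  obtain K where K: "\<And>x y. \<bar>\<phi> j x - \<phi> j y\<bar> \<le> K * \<bar>x - y\<bar>" using phi_Lipschitz by blast
  have "0 \<le> K" using K[of 0 1] by (simp add: order_trans[OF abs_ge_zero])
  then have "K-lipschitz_on A (\<phi> j)"
    using K by (intro lipschitz_onI) (auto simp: dist_real_def)
  then show ?thesis by (rule lipschitz_on_continuous_on)
qed

lemma continuous_Phi: "continuous_on A (\<Phi> j)"
  by (rule DERIV_continuous_on[OF has_field_derivative_at_within[OF Phi_deriv]])

lemma nice_phi: "nice (\<phi> j)" and nice_Phi: "nice (\<Phi> j)"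
  by (auto intro: nice_continuous continuous_phi continuous_Phi)

lemmas nice_intros = nice_phi nice_Phi nice_const nice_add nice_diff nice_mult nice_power2 nice_sum nice_indicator

lemma integral_nice_bound:
  assumes "nice g" "\<And>s. s \<in> {t..T} \<Longrightarrow> \<bar>g s\<bar> \<le> K"
  shows "integral\<^sup>L U g \<le> K * L"
  using assms t_less_T by (intro integral_unif_on_le) (auto simp: nice_def)

lemma integral_indicator_phi:
  assumes "t \<le> a" "a \<le> b" "b \<le> T"
  shows "(\<integral>s. \<phi> j s * indicator {a<..b} s \<partial>U) = \<Phi> j b - \<Phi> j a"
  by (rule integral_unif_on_indicator_FTC[OF assms continuous_phi has_field_derivative_at_within[OF Phi_deriv]])

lemma integral_indicator: "t \<le> a \<Longrightarrow> a \<le> b \<Longrightarrow> b \<le> T \<Longrightarrow> (\<integral>s. indicator {a<..b} s \<partial>U) = b - a"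
  using integral_unif_on_indicator_FTC[of t a b T "\<lambda>_. 1" "\<lambda>x. x"] by simp

lemma AE_U: "AE s in U. s \<in> {t<..T}"
proof -
  have "AE s in U. s \<noteq> t"
    using AE_lborel_singleton[of t] by (subst AE_restrict_space_iff) (auto elim: eventually_mono)
  moreover have "AE s in U. s \<in> {t..T}"
    by (intro AE_I2) (simp add: space_restrict_space)
  ultimately show ?thesis by eventually_elim auto
qed

lemmas integral_FTC = integral_unif_on_FTC[OF less_imp_le[OF t_less_T]]

lemma integral_square_expansion:
  assumes "nice g"
  shows "(\<integral>s. (g s - (\<Sum>j\<in>J. a j * \<phi> j s))\<^sup>2 \<partial>U) =
    (\<integral>s. (g s)\<^sup>2 \<partial>U) - 2 * (\<Sum>j\<in>J. a j * (fcoeff j g)) + (\<Sum>j\<in>J. (a j)\<^sup>2)"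
proof (cases "finite J")
  case True
  have eq: "(g s - (\<Sum>j\<in>J. a j * \<phi> j s))\<^sup>2 =
      (g s)\<^sup>2 - 2 * (\<Sum>j\<in>J. a j * (\<phi> j s * g s)) + (\<Sum>i\<in>J. \<Sum>j\<in>J. a i * a j * (\<phi> i s * \<phi> j s))" for s
  proof -
    have "(\<Sum>j\<in>J. a j * \<phi> j s)\<^sup>2 = (\<Sum>i\<in>J. \<Sum>j\<in>J. a i * a j * (\<phi> i s * \<phi> j s))"
      by (simp add: power2_eq_square sum_product algebra_simps)
    moreover have "(\<Sum>j\<in>J. a j * \<phi> j s) * g s = (\<Sum>j\<in>J. a j * (\<phi> j s * g s))"
      by (simp add: sum_distrib_right mult.assoc)
    moreover have "(x - y)\<^sup>2 = x\<^sup>2 - 2 * (y * x) + y\<^sup>2" for x y :: real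
      by (simp add: power2_eq_square algebra_simps)
    ultimately show ?thesis by metis
  qed
  have i1: "integrable U (\<lambda>s. (g s)\<^sup>2)" "integrable U (\<lambda>s. \<phi> j s * g s)" "integrable U (\<lambda>s. \<phi> i s * \<phi> j s)" for i j
    by (intro nice_integrable nice_intros assms)+
  have "(\<integral>s. (g s - (\<Sum>j\<in>J. a j * \<phi> j s))\<^sup>2 \<partial>U) =
      (\<integral>s. (g s)\<^sup>2 \<partial>U) - 2 * (\<Sum>j\<in>J. a j * (fcoeff j g)) +
      (\<Sum>i\<in>J. \<Sum>j\<in>J. a i * a j * (fcoeff i (\<phi> j)))"
    unfolding eq using i1 by simp
  also have "(\<Sum>i\<in>J. \<Sum>j\<in>J. a i * a j * (fcoeff i (\<phi> j))) = (\<Sum>j\<in>J. (a j)\<^sup>2)"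
    using True by (simp add: ortho of_bool_def power2_eq_square if_distrib[of "\<lambda>x. _ * x"] cong: if_cong)
  finally show ?thesis .
qed simp

lemma bessel:
  assumes "nice g"
  shows "(\<Sum>j\<in>J. (fcoeff j g)\<^sup>2) \<le> (\<integral>s. (g s)\<^sup>2 \<partial>U)"
proof -
  have "0 \<le> (\<integral>s. (g s - (\<Sum>j\<in>J. fcoeff j g * \<phi> j s))\<^sup>2 \<partial>U)" by simp
  then show ?thesis unfolding integral_square_expansion[OF assms]
    by (simp add: power2_eq_square)
qed

lemma Phi_eq: "s \<in> {t..T} \<Longrightarrow> \<Phi> j s = (\<integral>u. \<phi> j u * indicator {t<..s} u \<partial>U)"
  using integral_indicator_phi[of t s j] Phi_t by simp

text \<open>Bessel's inequality for the indicator of \<open>{t<..s}\<close>, whose coefficients are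
  the values \<open>\<Phi> j s\<close>.\<close>

lemma sum_Phi_square_le:
  assumes "s \<in> {t..T}"
  shows "(\<Sum>j\<in>J. (\<Phi> j s)\<^sup>2) \<le> s - t"
proof -
  have "(\<integral>u. (indicator {t<..s} u)\<^sup>2 \<partial>U) = (\<integral>u. (indicator {t<..s} u :: real) \<partial>U)"
    by (intro Bochner_Integration.integral_cong) (auto simp: indicator_def)
  then show ?thesis
    using bessel[of "indicator {t<..s}" J] integral_indicator[of t s] Phi_eq[OF assms] assms
    by (simp add: nice_indicator)
qed

lemma sum_Phi_square_le': "s \<in> {t..T} \<Longrightarrow> (\<Sum>j\<in>J. (\<Phi> j s)\<^sup>2) \<le> L"
  using sum_Phi_square_le[of s J] by auto

lemma sum_Phi_Phi_le: "a \<in> {t..T} \<Longrightarrow> b \<in> {t..T} \<Longrightarrow> \<bar>\<Sum>j\<in>J. \<Phi> j a * \<Phi> j b\<bar> \<le> L"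
  by (intro abs_sum_product_le_bound sum_Phi_square_le')

end

text \<open>Completeness in the form in which it is used: Parseval's identity for the indicators of
  \<open>{t<..s}\<close>.\<close>

locale orthonormal_basis = orthonormal_system +
  assumes parseval: "s \<in> {t..T} \<Longrightarrow> (\<lambda>n. \<Sum>j\<le>n. (\<Phi> j s)\<^sup>2) \<longlonglongrightarrow> s - t"
begin

text \<open>Parseval's identity is given for single indicators, not for their sum and difference.
  Bessel's inequality for these two functions bounds the mixed sum from above and below, and the gap
  \<open>d n\<close> is half the total of the two Parseval defects.\<close>

lemma parseval_polarized:
  assumes a: "a \<in> {t..T}" and b: "b \<in> {t..T}"
  shows "(\<lambda>n. \<Sum>j\<le>n. \<Phi> j a * \<Phi> j b) \<longlonglongrightarrow> min a b - t"
proof -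
  define d where "d n = ((a - t - (\<Sum>j\<le>n. (\<Phi> j a)\<^sup>2)) + (b - t - (\<Sum>j\<le>n. (\<Phi> j b)\<^sup>2))) / 2" for n
  have d: "d \<longlonglongrightarrow> 0"
    unfolding d_def using parseval[OF a] parseval[OF b] by (auto intro!: tendsto_eq_intros)
  have 1: "(\<integral>s. indicator {t<..a} s * indicator {t<..b} s \<partial>U) = min a b - t"
    using integral_unif_on_indicators[of t t a T t b] a b by (auto simp: min_def)
  have *: "(\<Sum>j\<le>n. (\<Phi> j a)\<^sup>2) + (\<Sum>j\<le>n. (\<Phi> j b)\<^sup>2) + 2 * c * (\<Sum>j\<le>n. \<Phi> j a * \<Phi> j b) \<le> (a - t) + (b - t) + 2 * c * (min a b - t)"
    if "c\<^sup>2 = 1" for c :: real and n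
  proof -
    define g where "g s = indicator {t<..a} s + c * indicator {t<..b} s" for s
    have g: "nice g" unfolding g_def by (intro nice_intros) auto
    have i: "integrable U (\<lambda>s. \<phi> j s * indicator {t<..a} s)" "integrable U (\<lambda>s. \<phi> j s * indicator {t<..b} s)"
      "integrable U (indicator {t<..a} :: real \<Rightarrow> real)" "integrable U (indicator {t<..b} :: real \<Rightarrow> real)"
      "integrable U (\<lambda>s. indicator {t<..a} s * indicator {t<..b} s :: real)" for j
      by (intro nice_integrable nice_intros; simp)+
    have "fcoeff j g = (\<integral>s. \<phi> j s * indicator {t<..a} s + c * (\<phi> j s * indicator {t<..b} s) \<partial>U)" for j
      by (intro Bochner_Integration.integral_cong) (auto simp: g_def algebra_simps)
    then have l: "fcoeff j g = \<Phi> j a + c * \<Phi> j b" for j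
      using i a b by (simp add: integral_indicator_phi Phi_t)
    have "(\<integral>s. (g s)\<^sup>2 \<partial>U) = (\<integral>s. indicator {t<..a} s + indicator {t<..b} s + 2 * c * (indicator {t<..a} s * indicator {t<..b} s) \<partial>U)"
      by (intro Bochner_Integration.integral_cong) (auto simp: g_def indicator_def power2_sum that power_mult_distrib)
    also have "\<dots> = (a - t) + (b - t) + 2 * c * (min a b - t)"
      using i a b integral_indicator[of t a] integral_indicator[of t b] by (simp add: 1)
    finally have "(\<Sum>j\<le>n. (\<Phi> j a + c * \<Phi> j b)\<^sup>2) \<le> (a - t) + (b - t) + 2 * c * (min a b - t)"
      using bessel[OF g, of "{..n}"] l by simp
    moreover have "(\<Sum>j\<le>n. (\<Phi> j a + c * \<Phi> j b)\<^sup>2) =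
        (\<Sum>j\<le>n. (\<Phi> j a)\<^sup>2) + (\<Sum>j\<le>n. (\<Phi> j b)\<^sup>2) + 2 * c * (\<Sum>j\<le>n. \<Phi> j a * \<Phi> j b)"
      by (simp add: power2_sum power_mult_distrib that sum.distrib sum_distrib_left algebra_simps)
    ultimately show ?thesis by simp
  qed
  have lower: "x + y + 2 * (-1) * z \<le> p + q + 2 * (-1) * w \<Longrightarrow> w - ((p - x) + (q - y)) / 2 \<le> z"
    and upper: "x + y + 2 * 1 * z \<le> p + q + 2 * 1 * w \<Longrightarrow> z \<le> w + ((p - x) + (q - y)) / 2"
    for x y z p q w :: real by (simp_all add: field_simps)
  show ?thesis
  proof (rule tendsto_sandwich[of "\<lambda>n. min a b - t - d n" _ _ "\<lambda>n. min a b - t + d n"])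
    show "eventually (\<lambda>n. min a b - t - d n \<le> (\<Sum>j\<le>n. \<Phi> j a * \<Phi> j b)) sequentially"
      "eventually (\<lambda>n. (\<Sum>j\<le>n. \<Phi> j a * \<Phi> j b) \<le> min a b - t + d n) sequentially"
    proof (safe intro!: always_eventually)
      fix n
      show "min a b - t - d n \<le> (\<Sum>j\<le>n. \<Phi> j a * \<Phi> j b)"
        unfolding d_def by (rule lower, rule *) simp
      show "(\<Sum>j\<le>n. \<Phi> j a * \<Phi> j b) \<le> min a b - t + d n"
        unfolding d_def by (rule upper, rule *) simp
    qed
  qed (auto intro!: tendsto_eq_intros d)
qed

end

subsection \<open>Coefficients and their contractions\<close>

context orthonormal_basis
begin

text \<open>The coefficient of the double integral up to \<open>s\<close>, outer index first.
  \<open>C\<close> lists its indices from the innermost outwards, which reverses the order of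
  \<open>coefC\<close>.\<close>

definition G :: "nat \<Rightarrow> nat \<Rightarrow> real \<Rightarrow> real" where
  "G i j s = integral {t..s} (\<lambda>u. \<phi> i u * \<Phi> j u)"

definition C :: "nat \<Rightarrow> nat \<Rightarrow> nat \<Rightarrow> real" where
  "C j1 j2 j3 = fcoeff j3 (G j2 j1)"

lemma Phi_within: "(\<Phi> j has_real_derivative \<phi> j s) (at s within S)"
  by (rule has_field_derivative_at_within[OF Phi_deriv])

lemma G_t: "G i j t = 0"
  by (simp add: G_def)

lemma G_deriv: "s \<in> {t..T} \<Longrightarrow> (G i j has_real_derivative \<phi> i s * \<Phi> j s) (at s within {t..T})"
  unfolding G_def
  by (intro integral_has_real_derivative continuous_on_mult continuous_phi continuous_Phi)

lemma continuous_G: "continuous_on {t..T} (G i j)"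
  by (rule DERIV_continuous_on[OF G_deriv])

lemma nice_G: "nice (G i j)"
  by (rule nice_continuous[OF continuous_G])

lemmas nice_rules = nice_G nice_intros

lemma G_diff:
  assumes "t \<le> a" "a \<le> b" "b \<le> T"
  shows "G i j b - G i j a = (\<integral>s. \<phi> i s * \<Phi> j s * indicator {a<..b} s \<partial>U)"
  by (rule integral_unif_on_indicator_FTC[OF assms _ G_deriv, symmetric])
     (intro continuous_on_mult continuous_phi continuous_Phi)

lemma G_eq:
  assumes "s \<in> {t..T}"
  shows "G i j s = (\<integral>u. \<phi> i u * \<Phi> j u * indicator {t<..s} u \<partial>U)"
  using G_diff[of t s i j] assms by (simp add: G_t)

lemma G_diag:
  assumes "s \<in> {t..T}"
  shows "G j j s = (\<Phi> j s)\<^sup>2 / 2"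
proof -
  have "((\<lambda>u. (\<Phi> j u)\<^sup>2 / 2) has_real_derivative \<phi> j u * \<Phi> j u) (at u within {t..T})" for u
    by (auto intro!: derivative_eq_intros Phi_within)
  then have "(\<integral>u. \<phi> j u * \<Phi> j u * indicator {t<..s} u \<partial>U) = (\<Phi> j s)\<^sup>2 / 2 - (\<Phi> j t)\<^sup>2 / 2"
    using assms
    by (intro integral_unif_on_indicator_FTC continuous_on_mult continuous_phi continuous_Phi) auto
  then show ?thesis using assms by (simp add: G_eq Phi_t)
qed

text \<open>Integration by parts exposes the inner index: the value becomes a Fourier coefficient
  with respect to \<open>\<phi> j\<close>, as is needed when the outer index is summed and the inner
  one is free.\<close>

lemma G_by_parts:
  assumes "s \<in> {t..T}"
  shows "G i j s = (\<integral>u. \<phi> j u * ((\<Phi> i s - \<Phi> i u) * indicator {t<..s} u) \<partial>U)"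
proof -
  have "((\<lambda>u. \<Phi> j u * (\<Phi> i s - \<Phi> i u) + G i j u) has_real_derivative \<phi> j u * (\<Phi> i s - \<Phi> i u)) (at u within {t..T})"
    if "u \<in> {t..T}" for u
    using that by (auto intro!: derivative_eq_intros Phi_within G_deriv simp: algebra_simps)
  then have "(\<integral>u. \<phi> j u * (\<Phi> i s - \<Phi> i u) * indicator {t<..s} u \<partial>U) =
      (\<Phi> j s * (\<Phi> i s - \<Phi> i s) + G i j s) - (\<Phi> j t * (\<Phi> i s - \<Phi> i t) + G i j t)"
    using assms
    by (intro integral_unif_on_indicator_FTC continuous_intros continuous_phi continuous_Phi) auto
  then show ?thesis by (simp add: G_t Phi_t mult.assoc)
qed

text \<open>Integration by parts in the outermost variable exposes the middle index. Subtracting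
  \<open>\<Phi> j3 T\<close> makes the boundary term at \<open>T\<close> vanish, and
  \<open>G\<close> vanishes at \<open>t\<close>.\<close>

lemma C_eq: "C j1 j2 j3 = (\<integral>s. \<phi> j2 s * \<Phi> j1 s * (\<Phi> j3 T - \<Phi> j3 s) \<partial>U)"
proof -
  have "((\<lambda>s. (\<Phi> j3 s - \<Phi> j3 T) * G j2 j1 s) has_real_derivative
      \<phi> j3 s * G j2 j1 s - \<phi> j2 s * \<Phi> j1 s * (\<Phi> j3 T - \<Phi> j3 s)) (at s within {t..T})"
    if "s \<in> {t..T}" for s
    using that by (auto intro!: derivative_eq_intros Phi_within G_deriv simp: algebra_simps)
  then have "(\<integral>s. \<phi> j3 s * G j2 j1 s - \<phi> j2 s * \<Phi> j1 s * (\<Phi> j3 T - \<Phi> j3 s) \<partial>U) =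
      (\<Phi> j3 T - \<Phi> j3 T) * G j2 j1 T - (\<Phi> j3 t - \<Phi> j3 T) * G j2 j1 t"
    by (intro integral_FTC continuous_intros continuous_phi continuous_Phi continuous_G)
  moreover have "integrable U (\<lambda>s. \<phi> j3 s * G j2 j1 s)"
    "integrable U (\<lambda>s. \<phi> j2 s * \<Phi> j1 s * (\<Phi> j3 T - \<Phi> j3 s))"
    by (intro nice_integrable nice_rules)+
  ultimately show ?thesis by (simp add: C_def G_t)
qed

text \<open>With two indices equal to \<open>j\<close>, each of the three contractions is the
  \<open>k\<close>-th Fourier coefficient of a function that depends on \<open>j\<close> only. Sums
  over \<open>j\<close> can then be taken inside the integral and sums over \<open>k\<close> are
  left to Bessel's inequality.\<close>

lemma C_contract12: "C j j k = (\<integral>s. \<phi> k s * ((\<Phi> j s)\<^sup>2 / 2) \<partial>U)"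
  unfolding C_def by (intro Bochner_Integration.integral_cong refl) (simp add: G_diag space_restrict_space)

lemma C_contract13: "C j k j = (\<integral>s. \<phi> k s * (\<Phi> j s * (\<Phi> j T - \<Phi> j s)) \<partial>U)"
  by (simp add: C_eq mult.assoc)

lemma C_contract23: "C k j j = (\<integral>s. \<phi> k s * ((\<Phi> j T - \<Phi> j s)\<^sup>2 / 2) \<partial>U)"
proof -
  have "((\<lambda>s. - (\<Phi> j T - \<Phi> j s)\<^sup>2 / 2 * \<Phi> k s) has_real_derivative
      \<phi> j s * \<Phi> k s * (\<Phi> j T - \<Phi> j s) - \<phi> k s * ((\<Phi> j T - \<Phi> j s)\<^sup>2 / 2)) (at s within {t..T})" for s
    by (auto intro!: derivative_eq_intros Phi_within simp: field_simps power2_eq_square)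
  then have "(\<integral>s. \<phi> j s * \<Phi> k s * (\<Phi> j T - \<Phi> j s) - \<phi> k s * ((\<Phi> j T - \<Phi> j s)\<^sup>2 / 2) \<partial>U) =
      - (\<Phi> j T - \<Phi> j T)\<^sup>2 / 2 * \<Phi> k T - (- (\<Phi> j T - \<Phi> j t)\<^sup>2 / 2 * \<Phi> k t)"
    by (intro integral_FTC continuous_intros continuous_phi continuous_Phi) auto
  moreover have "integrable U (\<lambda>s. \<phi> j s * \<Phi> k s * (\<Phi> j T - \<Phi> j s))"
    "integrable U (\<lambda>s. \<phi> k s * ((\<Phi> j T - \<Phi> j s)\<^sup>2 / 2))"
    unfolding divide_inverse by (intro nice_integrable nice_rules)+
  ultimately show ?thesis by (simp add: C_eq Phi_t)
qed

section \<open>Bessel bounds for families and convergence of Fourier coefficients\<close>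

lemma sum_integral_phi:
  assumes "\<And>j. j \<in> J \<Longrightarrow> nice (g j)"
  shows "(\<Sum>j\<in>J. \<integral>s. \<phi> k s * g j s \<partial>U) = (\<integral>s. \<phi> k s * (\<Sum>j\<in>J. g j s) \<partial>U)"
proof -
  have "(\<integral>s. (\<Sum>j\<in>J. \<phi> k s * g j s) \<partial>U) = (\<Sum>j\<in>J. \<integral>s. \<phi> k s * g j s \<partial>U)"
    using assms by (intro Bochner_Integration.integral_sum nice_integrable nice_rules)
  then show ?thesis by (simp add: sum_distrib_left)
qed

lemma bessel_family:
  assumes nice: "\<And>a. a \<in> A \<Longrightarrow> nice (D a)"
    and le: "\<And>s. s \<in> {t..T} \<Longrightarrow> (\<Sum>a\<in>A. (D a s)\<^sup>2) \<le> K"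
  shows "(\<Sum>a\<in>A. \<Sum>k\<in>J. (fcoeff k (D a))\<^sup>2) \<le> K * L"
proof -
  have "(\<Sum>a\<in>A. \<Sum>k\<in>J. (fcoeff k (D a))\<^sup>2) \<le> (\<Sum>a\<in>A. \<integral>s. (D a s)\<^sup>2 \<partial>U)"
    using nice by (intro sum_mono bessel)
  also have "\<dots> = (\<integral>s. (\<Sum>a\<in>A. (D a s)\<^sup>2) \<partial>U)"
    using nice by (intro Bochner_Integration.integral_sum[symmetric] nice_integrable nice_rules)
  also have "\<dots> \<le> K * L"
    using nice le by (intro integral_nice_bound nice_rules) (auto simp: sum_nonneg)
  finally show ?thesis .
qed

text \<open>For fixed \<open>j\<close>, Bessel's inequality in \<open>i\<close> is applied to
  \<open>\<Phi> j\<close> cut off to the interval between \<open>a\<close> and \<open>b\<close>; the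
  remaining sum of \<open>(\<Phi> j s)\<^sup>2\<close> is at most \<open>L\<close> at every
  point.\<close>

lemma sum_G_diff_square_le:
  assumes "a \<in> {t..T}" "b \<in> {t..T}"
  shows "(\<Sum>j\<in>J. \<Sum>i\<in>I. (G i j b - G i j a)\<^sup>2) \<le> \<bar>b - a\<bar> * L"
proof -
  have *: "(\<Sum>j\<in>J. \<Sum>i\<in>I. (G i j b - G i j a)\<^sup>2) \<le> (b - a) * L"
    if ab: "t \<le> a" "a \<le> b" "b \<le> T" for a b
  proof -
    have "(\<Sum>j\<in>J. \<Sum>i\<in>I. (G i j b - G i j a)\<^sup>2) =
        (\<Sum>j\<in>J. \<Sum>i\<in>I. (\<integral>s. \<phi> i s * (\<Phi> j s * indicator {a<..b} s) \<partial>U)\<^sup>2)"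
      by (simp add: G_diff[OF ab] mult.assoc)
    also have "\<dots> \<le> (\<Sum>j\<in>J. \<integral>s. (\<Phi> j s * indicator {a<..b} s)\<^sup>2 \<partial>U)"
      by (intro sum_mono bessel nice_rules) auto
    also have "\<dots> = (\<integral>s. (\<Sum>j\<in>J. (\<Phi> j s * indicator {a<..b} s)\<^sup>2) \<partial>U)"
      by (intro Bochner_Integration.integral_sum[symmetric] nice_integrable nice_rules) auto
    also have "\<dots> \<le> (\<integral>s. L * indicator {a<..b} s \<partial>U)"
    proof (intro integral_mono nice_integrable nice_rules)
      fix s assume "s \<in> space U"
      then have s: "s \<in> {t..T}" by (simp add: space_restrict_space)
      show "(\<Sum>j\<in>J. (\<Phi> j s * indicator {a<..b} s)\<^sup>2) \<le> L * indicator {a<..b} s"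
        using sum_Phi_square_le'[OF s, of J] by (auto simp: indicator_def)
    qed auto
    also have "\<dots> = (b - a) * L"
      using integral_indicator[OF ab] by simp
    finally show ?thesis .
  qed
  show ?thesis
  proof (cases "a \<le> b")
    case True
    then show ?thesis using *[of a b] assms by simp
  next
    case False
    then show ?thesis using *[of b a] assms by (simp add: power2_commute[of "G _ _ b"])
  qed
qed

lemma sum_G_square_le:
  assumes "s \<in> {t..T}"
  shows "(\<Sum>j\<in>J. \<Sum>i\<in>I. (G i j s)\<^sup>2) \<le> L * L"
proof -
  have "(\<Sum>j\<in>J. \<Sum>i\<in>I. (G i j s)\<^sup>2) \<le> (s - t) * L"
    using sum_G_diff_square_le[of t s I J] t_less_T assms by (simp add: G_t)
  also have "\<dots> \<le> L * L" using assms t_less_T by (intro mult_right_mono) auto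
  finally show ?thesis .
qed

text \<open>Pointwise convergence is asked for only when \<open>t < s\<close>, because step
  functions over left-open cells vanish at \<open>t\<close> whatever the approximated function does
  there.\<close>

lemma integral_square_tendsto:
  assumes "\<And>n. nice (h n)" "nice h'" "\<And>n s. s \<in> {t..T} \<Longrightarrow> \<bar>h n s\<bar> \<le> K"
    and "\<And>s. t < s \<Longrightarrow> s \<le> T \<Longrightarrow> (\<lambda>n. h n s) \<longlonglongrightarrow> h' s"
  shows "(\<lambda>n. \<integral>s. (h n s)\<^sup>2 \<partial>U) \<longlonglongrightarrow> (\<integral>s. (h' s)\<^sup>2 \<partial>U)"
proof (rule integral_dominated_convergence[where w = "\<lambda>_. K\<^sup>2"])
  show "(\<lambda>s. (h' s)\<^sup>2) \<in> borel_measurable U" "(\<lambda>s. (h n s)\<^sup>2) \<in> borel_measurable U" for n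
    using nice_power2[OF assms(2)] nice_power2[OF assms(1)] by (auto simp: nice_def)
  show "integrable U (\<lambda>_. K\<^sup>2)" by (intro nice_integrable nice_rules)
  show "AE s in U. (\<lambda>n. (h n s)\<^sup>2) \<longlonglongrightarrow> (h' s)\<^sup>2"
    using AE_U by eventually_elim (intro tendsto_power assms(4), auto)
  show "AE s in U. norm ((h n s)\<^sup>2) \<le> K\<^sup>2" for n
  proof (intro AE_I2)
    fix s assume "s \<in> space U"
    then have "\<bar>h n s\<bar> \<le> K" using assms(3) by (simp add: space_restrict_space)
    then show "norm ((h n s)\<^sup>2) \<le> K\<^sup>2" by (simp add: abs_le_square_iff[symmetric])
  qed
qed

text \<open>The difference splits into coefficients of \<open>g n - g'\<close>, coefficients of
  \<open>g q - g'\<close> and the tail beyond \<open>p\<close> of the coefficients of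
  \<open>g'\<close>; Bessel's inequality bounds the first two by integrals and makes the third
  small. The cutoff \<open>p\<close> of the free index and the index \<open>q\<close> of the
  function are independent because they come from different sides of a box.\<close>

lemma truncated_coefficients:
  assumes g: "\<And>n. nice (g n)" "nice g'" "\<And>n s. s \<in> {t..T} \<Longrightarrow> \<bar>g n s\<bar> \<le> K"
    and lim: "\<And>s. s \<in> {t..T} \<Longrightarrow> (\<lambda>n. g n s) \<longlonglongrightarrow> g' s" and "0 < \<epsilon>"
  shows "\<exists>Q. \<forall>p\<ge>Q. \<forall>q\<ge>Q. \<forall>n\<ge>Q.
    (\<Sum>k\<le>n. (fcoeff k (g n) - of_bool (k \<le> p) * (fcoeff k (g q)))\<^sup>2) \<le> \<epsilon>"
proof -
  define a where "a k = fcoeff k g'" for k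
  define e where "e n = (\<integral>s. (g n s - g' s)\<^sup>2 \<partial>U)" for n
  obtain K' where K': "\<forall>s\<in>{t..T}. \<bar>g' s\<bar> \<le> K'" using g(2) unfolding nice_def by blast
  have "(\<lambda>n. \<integral>s. (g n s - g' s)\<^sup>2 \<partial>U) \<longlonglongrightarrow> (\<integral>s. 0\<^sup>2 \<partial>U)"
  proof (rule integral_square_tendsto[where K = "K + K'"])
    show "\<bar>g n s - g' s\<bar> \<le> K + K'" if "s \<in> {t..T}" for n s
      using g(3)[OF that, of n] bspec[OF K' that] by linarith
    show "(\<lambda>n. g n s - g' s) \<longlonglongrightarrow> 0" if "t < s" "s \<le> T" for s
      using LIM_zero[OF lim[of s]] that by simp
  qed (intro nice_rules g)+
  then have e: "e \<longlonglongrightarrow> 0" by (simp add: e_def[abs_def])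
  have "summable (\<lambda>k. (a k)\<^sup>2)"
    using bessel[OF g(2)] by (intro bounded_imp_summable[of _ "\<integral>s. (g' s)\<^sup>2 \<partial>U"]) (auto simp: a_def)
  then have "\<exists>N. \<forall>m\<ge>N. \<forall>n. norm (sum (\<lambda>k. (a k)\<^sup>2) {m..<n}) < \<epsilon> / 9"
    using \<open>0 < \<epsilon>\<close> unfolding summable_Cauchy by (metis divide_pos_pos zero_less_numeral)
  then obtain N where N: "\<And>m n. N \<le> m \<Longrightarrow> (\<Sum>k\<in>{m..<n}. (a k)\<^sup>2) < \<epsilon> / 9"
    by (auto simp: sum_nonneg)
  obtain N' where N': "\<And>n. N' \<le> n \<Longrightarrow> e n < \<epsilon> / 9"
    using order_tendstoD(2)[OF e, of "\<epsilon> / 9"] \<open>0 < \<epsilon>\<close> by (auto simp: eventually_sequentially)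
  show ?thesis
  proof (intro exI[of _ "max N N'"] allI impI)
    fix p q n assume "max N N' \<le> p" "max N N' \<le> q" "max N N' \<le> n"
    then have *: "N \<le> Suc p" "N' \<le> q" "N' \<le> n" by auto
    define b where "b n k = (\<integral>s. \<phi> k s * (g n s - g' s) \<partial>U)" for n k
    have b: "fcoeff k (g n) = b n k + a k" for n k
    proof -
      have "integrable U (\<lambda>s. \<phi> k s * g n s)" "integrable U (\<lambda>s. \<phi> k s * g' s)"
        by (intro nice_integrable nice_rules g)+
      then show ?thesis by (simp add: a_def b_def right_diff_distrib)
    qed
    have be: "(\<Sum>k\<le>m. (b n k)\<^sup>2) \<le> e n" for n m
      unfolding b_def e_def by (intro bessel nice_rules g)
    \<comment> \<open>Each of the three parts enters with the factor 3, whence the thresholds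
      \<open>\<epsilon> / 9\<close>.\<close>
    have three: "(x - y + z)\<^sup>2 \<le> 3 * x\<^sup>2 + 3 * y\<^sup>2 + 3 * z\<^sup>2" for x y z :: real
    proof -
      have "0 \<le> (x + y)\<^sup>2 + (y + z)\<^sup>2 + (x - z)\<^sup>2" by simp
      then show ?thesis by (simp add: power2_eq_square algebra_simps)
    qed
    have "(\<Sum>k\<le>n. (fcoeff k (g n) - of_bool (k \<le> p) * (fcoeff k (g q)))\<^sup>2) \<le>
        (\<Sum>k\<le>n. 3 * (b n k)\<^sup>2 + 3 * (b q k)\<^sup>2 + 3 * (of_bool (p < k) * (a k)\<^sup>2))"
    proof (rule sum_mono)
      fix k
      show "(fcoeff k (g n) - of_bool (k \<le> p) * (fcoeff k (g q)))\<^sup>2 \<le>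
          3 * (b n k)\<^sup>2 + 3 * (b q k)\<^sup>2 + 3 * (of_bool (p < k) * (a k)\<^sup>2)"
      proof (cases "k \<le> p")
        case True
        then show ?thesis using three[of "b n k" "b q k" 0] by (simp add: b)
      next
        case False
        then show ?thesis using three[of "b n k" 0 "a k"] by (simp add: b, insert zero_le_power2[of "b q k"], linarith)
      qed
    qed
    also have "\<dots> = 3 * (\<Sum>k\<le>n. (b n k)\<^sup>2) + 3 * (\<Sum>k\<le>n. (b q k)\<^sup>2) + 3 * (\<Sum>k\<le>n. of_bool (p < k) * (a k)\<^sup>2)"
      by (simp only: sum.distrib sum_distrib_left)
    also have "(\<Sum>k\<le>n. of_bool (p < k) * (a k)\<^sup>2) = (\<Sum>k\<in>{Suc p..<Suc n}. (a k)\<^sup>2)"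
      by (intro sum.mono_neutral_cong_right) auto
    also have "3 * (\<Sum>k\<le>n. (b n k)\<^sup>2) + 3 * (\<Sum>k\<le>n. (b q k)\<^sup>2) + 3 * (\<Sum>k\<in>{Suc p..<Suc n}. (a k)\<^sup>2) \<le>
        3 * (\<epsilon> / 9) + 3 * (\<epsilon> / 9) + 3 * (\<epsilon> / 9)"
      using be[where n=n and m=n] be[where n=q and m=n] N'[of n] N'[of q] N[of "Suc p" "Suc n"] *
      by (intro add_mono mult_left_mono) (auto intro: order_trans less_imp_le)
    finally show "(\<Sum>k\<le>n. (fcoeff k (g n) - of_bool (k \<le> p) * (fcoeff k (g q)))\<^sup>2) \<le> \<epsilon>"
      by simp
  qed
qed

end

text \<open>The bounds that Wick's formula gives for the second moments of quadratic and cubic forms in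
  independent standard Gaussian variables: the sums of squares come from the pairings between the two
  copies of the form, the other terms from the pairings that contract a copy with itself.\<close>

definition tensor_bound2 :: "nat \<Rightarrow> (nat \<Rightarrow> nat \<Rightarrow> real) \<Rightarrow> real" where
  "tensor_bound2 n c = 2 * (\<Sum>j1\<le>n. \<Sum>j2\<le>n. (c j1 j2)\<^sup>2) + (\<Sum>j\<le>n. c j j)\<^sup>2"

definition tensor_bound3 :: "nat \<Rightarrow> (nat \<Rightarrow> nat \<Rightarrow> nat \<Rightarrow> real) \<Rightarrow> real" where
  "tensor_bound3 n c = 6 * (\<Sum>j1\<le>n. \<Sum>j2\<le>n. \<Sum>j3\<le>n. (c j1 j2 j3)\<^sup>2) +
     3 * ((\<Sum>k\<le>n. (\<Sum>j\<le>n. c j j k)\<^sup>2) + (\<Sum>k\<le>n. (\<Sum>j\<le>n. c j k j)\<^sup>2) + (\<Sum>k\<le>n. (\<Sum>j\<le>n. c k j j)\<^sup>2))"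

section \<open>Smallness of the coefficients outside a large box\<close>

lemma incseq_bounded_tail:
  fixes A :: "nat \<Rightarrow> real"
  assumes "incseq A" "\<And>n. A n \<le> K" "0 < \<epsilon>"
  obtains Q where "\<And>n. A n - A Q \<le> \<epsilon>"
proof -
  have bdd: "bdd_above (range A)" using assms(2) by (auto simp: bdd_above_def)
  have "A \<longlonglongrightarrow> (SUP n. A n)" by (rule LIMSEQ_incseq_SUP[OF bdd assms(1)])
  then have "eventually (\<lambda>q. (SUP n. A n) - \<epsilon> < A q) sequentially"
    using assms(3) by (intro order_tendstoD(1)) auto
  then obtain Q where "(SUP n. A n) - \<epsilon> < A Q" by (auto simp: eventually_sequentially)
  moreover have "A n \<le> (SUP n. A n)" for n by (rule cSUP_upper[OF _ bdd]) simp
  ultimately show ?thesis by (intro that[of Q]) (smt (verit))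
qed

text \<open>The partial sums over the cubes increase and are bounded, so the mass beyond some cube
  is at most \<open>\<epsilon>\<close>. The estimate is uniform in \<open>n\<close> and in every set
  \<open>B\<close> that contains a large cube, in particular in boxes with unequal sides.\<close>

lemma sum_outside_cube:
  fixes c :: "'x \<Rightarrow> real"
  assumes "mono S" "\<And>n::nat. finite (S n)" "\<And>n. (\<Sum>x\<in>S n. (c x)\<^sup>2) \<le> K" "0 < \<epsilon>"
  obtains Q :: nat where "\<And>q n B. Q \<le> q \<Longrightarrow> S q \<subseteq> B \<Longrightarrow> (\<Sum>x\<in>S n. (of_bool (x \<notin> B) * c x)\<^sup>2) \<le> \<epsilon>"
proof -
  define A where "A n = (\<Sum>x\<in>S n. (c x)\<^sup>2)" for n
  have "incseq A"
    unfolding A_def using assms(1,2) by (auto simp: mono_def intro!: sum_mono2)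
  then obtain Q where Q: "\<And>n. A n - A Q \<le> \<epsilon>"
    using assms(3,4) incseq_bounded_tail[of A K \<epsilon>] unfolding A_def by blast
  show ?thesis
  proof (rule that[of Q])
    fix q n B assume q: "Q \<le> q" "S q \<subseteq> B"
    have SQ: "S Q \<subseteq> B" using q assms(1) by (auto simp: mono_def)
    define N where "N = max n Q"
    have N: "S n \<subseteq> S N" "S Q \<subseteq> S N" using assms(1) by (auto simp: mono_def N_def)
    have "(\<Sum>x\<in>S n. (of_bool (x \<notin> B) * c x)\<^sup>2) \<le> (\<Sum>x\<in>S N. (of_bool (x \<notin> B) * c x)\<^sup>2)"
      using N assms(2) by (intro sum_mono2) auto
    also have "\<dots> \<le> (\<Sum>x\<in>S N - S Q. (c x)\<^sup>2)"
    proof -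
      have "(\<Sum>x\<in>S N. (of_bool (x \<notin> B) * c x)\<^sup>2) = (\<Sum>x\<in>S N - S Q. (of_bool (x \<notin> B) * c x)\<^sup>2)"
        using SQ assms(2) by (intro sum.mono_neutral_right) auto
      also have "\<dots> \<le> (\<Sum>x\<in>S N - S Q. (c x)\<^sup>2)" by (intro sum_mono) auto
      finally show ?thesis .
    qed
    also have "\<dots> = A N - A Q"
      unfolding A_def using N assms(2) by (intro sum_diff) auto
    finally show "(\<Sum>x\<in>S n. (of_bool (x \<notin> B) * c x)\<^sup>2) \<le> \<epsilon>" using Q[of N] by simp
  qed
qed

text \<open>A contraction of coefficients restricted to the complement of a box. \<open>b\<close>
  stands for the condition on the free index and \<open>r\<close> for the smaller of the two sides
  belonging to the contracted indices.\<close>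

lemma sum_outside_box:
  fixes a :: "nat \<Rightarrow> real"
  shows "(\<Sum>j\<le>n. of_bool (\<not> (b \<and> j \<le> r)) * a j) = (\<Sum>j\<le>n. a j) - of_bool b * (\<Sum>j\<le>min r n. a j)"
proof (cases b)
  case True
  have "(\<Sum>j\<le>n. of_bool (\<not> j \<le> r) * a j) = (\<Sum>j\<le>n. a j - of_bool (j \<le> r) * a j)"
    by (intro sum.cong) auto
  also have "\<dots> = (\<Sum>j\<le>n. a j) - (\<Sum>j\<le>n. of_bool (j \<le> r) * a j)" by (simp add: sum_subtractf)
  also have "(\<Sum>j\<le>n. of_bool (j \<le> r) * a j) = (\<Sum>j\<le>min r n. a j)"
    by (intro sum.mono_neutral_cong_right) auto
  finally show ?thesis using True by simp
qed simp

context orthonormal_basis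
begin

lemma sum_C_square_le: "(\<Sum>j1\<le>n. \<Sum>j2\<le>n. \<Sum>j3\<le>n. (C j1 j2 j3)\<^sup>2) \<le> L * L * L"
proof -
  have "(\<Sum>x\<in>{..n} \<times> {..n}. \<Sum>k\<le>n. (\<integral>s. \<phi> k s * G (snd x) (fst x) s \<partial>U)\<^sup>2) \<le> L * L * L"
  proof (rule bessel_family)
    show "(\<Sum>x\<in>{..n} \<times> {..n}. (G (snd x) (fst x) s)\<^sup>2) \<le> L * L" if "s \<in> {t..T}" for s
      using sum_G_square_le[OF that, of "{..n}" "{..n}"] by (simp add: sum.cartesian_product case_prod_unfold)
  qed (rule nice_G)
  moreover have "(\<Sum>x\<in>{..n} \<times> {..n}. h x) = (\<Sum>j1\<le>n. \<Sum>j2\<le>n. h (j1, j2))" for h :: "nat \<times> nat \<Rightarrow> real"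
    by (simp add: sum.cartesian_product case_prod_unfold)
  ultimately show ?thesis by (simp add: C_def)
qed

definition c12 :: "nat \<Rightarrow> real \<Rightarrow> real" where "c12 n s = (\<Sum>j\<le>n. (\<Phi> j s)\<^sup>2 / 2)"
definition c13 :: "nat \<Rightarrow> real \<Rightarrow> real" where "c13 n s = (\<Sum>j\<le>n. \<Phi> j s * (\<Phi> j T - \<Phi> j s))"
definition c23 :: "nat \<Rightarrow> real \<Rightarrow> real" where "c23 n s = (\<Sum>j\<le>n. (\<Phi> j T - \<Phi> j s)\<^sup>2 / 2)"

lemma T_in: "T \<in> {t..T}" and t_in: "t \<in> {t..T}"
  using t_less_T by auto

lemma c13_eq: "c13 n s = (\<Sum>j\<le>n. \<Phi> j s * \<Phi> j T) - (\<Sum>j\<le>n. (\<Phi> j s)\<^sup>2)"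
  by (simp add: c13_def right_diff_distrib sum_subtractf power2_eq_square)

lemma c23_eq: "c23 n s = ((\<Sum>j\<le>n. (\<Phi> j T)\<^sup>2) + (\<Sum>j\<le>n. (\<Phi> j s)\<^sup>2)) / 2 - (\<Sum>j\<le>n. \<Phi> j s * \<Phi> j T)"
proof -
  have "c23 n s = (\<Sum>j\<le>n. ((\<Phi> j T)\<^sup>2 + (\<Phi> j s)\<^sup>2) / 2 - \<Phi> j s * \<Phi> j T)"
    unfolding c23_def by (intro sum.cong) (auto simp: power2_eq_square field_simps)
  then show ?thesis by (simp add: sum_subtractf sum.distrib flip: sum_divide_distrib)
qed

lemma nice_c: "nice (c12 n)" "nice (c13 n)" "nice (c23 n)"
  unfolding c12_def[abs_def] c13_def[abs_def] c23_def[abs_def] divide_inverse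
  by (intro nice_rules)+

lemma c_le:
  assumes "s \<in> {t..T}"
  shows "\<bar>c12 n s\<bar> \<le> 2 * L" "\<bar>c13 n s\<bar> \<le> 2 * L" "\<bar>c23 n s\<bar> \<le> 2 * L"
proof -
  note le = sum_Phi_square_le'[OF assms, of "{..n}"] sum_Phi_square_le'[OF T_in, of "{..n}"]
    sum_Phi_Phi_le[OF assms T_in, of "{..n}"]
  have nn: "0 \<le> (\<Sum>j\<le>n. (\<Phi> j s)\<^sup>2)" "0 \<le> (\<Sum>j\<le>n. (\<Phi> j T)\<^sup>2)" by (auto intro: sum_nonneg)
  show "\<bar>c12 n s\<bar> \<le> 2 * L" using le nn unfolding c12_def by (simp flip: sum_divide_distrib)
  have *: "\<bar>z - x\<bar> \<le> 2 * K" "\<bar>(y + x) / 2 - z\<bar> \<le> 2 * K"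
    if "x \<le> K" "y \<le> K" "\<bar>z\<bar> \<le> K" "0 \<le> x" "0 \<le> y" for x y z K :: real
    using that by (auto simp: field_simps abs_le_iff)
  show "\<bar>c13 n s\<bar> \<le> 2 * L" unfolding c13_eq by (rule *(1)[OF le nn])
  show "\<bar>c23 n s\<bar> \<le> 2 * L" unfolding c23_eq by (rule *(2)[OF le nn])
qed

lemma c_tendsto:
  assumes "s \<in> {t..T}"
  shows "(\<lambda>n. c12 n s) \<longlonglongrightarrow> (s - t) / 2" "(\<lambda>n. c13 n s) \<longlonglongrightarrow> 0" "(\<lambda>n. c23 n s) \<longlonglongrightarrow> (T - s) / 2"
proof -
  note lims = parseval[OF assms] parseval[OF T_in] parseval_polarized[OF assms T_in]
  show "(\<lambda>n. c12 n s) \<longlonglongrightarrow> (s - t) / 2"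
    unfolding c12_def sum_divide_distrib[symmetric] by (intro tendsto_intros lims) simp
  have "(\<lambda>n. c13 n s) \<longlonglongrightarrow> (min s T - t) - (s - t)" unfolding c13_eq by (intro tendsto_intros lims)
  then show "(\<lambda>n. c13 n s) \<longlonglongrightarrow> 0" using assms by (simp add: min_def split: if_splits)
  have "(\<lambda>n. c23 n s) \<longlonglongrightarrow> ((T - t) + (s - t)) / 2 - (min s T - t)"
    unfolding c23_eq by (intro tendsto_intros lims) simp
  moreover have "((T - t) + (s - t)) / 2 - (min s T - t) = (T - s) / 2"
    using assms by (auto simp: min_def field_simps)
  ultimately show "(\<lambda>n. c23 n s) \<longlonglongrightarrow> (T - s) / 2" by (simp only:)
qed

lemma contract_C:
  "(\<Sum>j\<le>n. C j j k) = fcoeff k (c12 n)"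
  "(\<Sum>j\<le>n. C j k j) = fcoeff k (c13 n)"
  "(\<Sum>j\<le>n. C k j j) = fcoeff k (c23 n)"
  unfolding C_contract12 C_contract13 C_contract23 c12_def c13_def c23_def divide_inverse
  by (intro sum_integral_phi nice_rules)+

text \<open>Restriction to the complement of the box does not disturb the form of the contractions:
  each becomes a full contraction minus a truncated one, exactly the difference treated in
  \<open>truncated_coefficients\<close>. The threshold depends on neither the shape of the box nor
  the outer cutoff \<open>n\<close>, so the three limits may be taken independently.\<close>

lemma tensor_bound3_outside_box:
  assumes "0 < \<epsilon>"
  obtains Q where "\<And>p1 p2 p3 n. Q \<le> p1 \<Longrightarrow> Q \<le> p2 \<Longrightarrow> Q \<le> p3 \<Longrightarrow> Q \<le> n \<Longrightarrow>
    tensor_bound3 n (\<lambda>j1 j2 j3. of_bool (\<not> (j1 \<le> p1 \<and> j2 \<le> p2 \<and> j3 \<le> p3)) * C j1 j2 j3) \<le> \<epsilon>"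
proof -
  \<comment> \<open>\<open>tensor_bound3\<close> has weight 6 on the squared norm and 3 on each of
    three contractions, 15 in all.\<close>
  define \<delta> where "\<delta> = \<epsilon> / 15"
  have \<delta>: "0 < \<delta>" using assms by (simp add: \<delta>_def)
  have nl: "nice (\<lambda>s. (s - t) / 2)" "nice (\<lambda>s. (T - s) / 2)"
    by (auto intro!: nice_continuous continuous_intros)
  define S where "S n = {..n} \<times> {..n} \<times> {..n}" for n :: nat
  define c where "c x = C (fst x) (fst (snd x)) (snd (snd x))" for x
  have S3: "(\<Sum>x\<in>S n. h x) = (\<Sum>j1\<le>n. \<Sum>j2\<le>n. \<Sum>j3\<le>n. h (j1, j2, j3))" for h :: "_ \<Rightarrow> real" and n
    by (simp add: S_def sum.cartesian_product case_prod_unfold)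
  obtain Q0 where Q0: "\<And>q n B. Q0 \<le> q \<Longrightarrow> S q \<subseteq> B \<Longrightarrow> (\<Sum>x\<in>S n. (of_bool (x \<notin> B) * c x)\<^sup>2) \<le> \<delta>"
  proof (rule sum_outside_cube[of S c "L * L * L" \<delta>])
    show "mono S" by (auto simp: mono_def S_def)
    show "(\<Sum>x\<in>S n. (c x)\<^sup>2) \<le> L * L * L" for n
      unfolding S3 c_def using sum_C_square_le[of n] by simp
  qed (auto simp: S_def \<delta>)
  have "\<exists>Q. \<forall>p\<ge>Q. \<forall>q\<ge>Q. \<forall>n\<ge>Q.
    (\<Sum>k\<le>n. (fcoeff k (c12 n) - of_bool (k \<le> p) * (fcoeff k (c12 q)))\<^sup>2) \<le> \<delta>"
    by (rule truncated_coefficients[OF nice_c(1) nl(1) c_le(1) c_tendsto(1) \<delta>])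
  then obtain Q1 where Q1: "\<And>p q n. Q1 \<le> p \<Longrightarrow> Q1 \<le> q \<Longrightarrow> Q1 \<le> n \<Longrightarrow>
    (\<Sum>k\<le>n. (fcoeff k (c12 n) - of_bool (k \<le> p) * (fcoeff k (c12 q)))\<^sup>2) \<le> \<delta>"
    by blast
  have "\<exists>Q. \<forall>p\<ge>Q. \<forall>q\<ge>Q. \<forall>n\<ge>Q.
    (\<Sum>k\<le>n. (fcoeff k (c13 n) - of_bool (k \<le> p) * (fcoeff k (c13 q)))\<^sup>2) \<le> \<delta>"
    by (rule truncated_coefficients[OF nice_c(2) nice_const c_le(2) c_tendsto(2) \<delta>])
  then obtain Q2 where Q2: "\<And>p q n. Q2 \<le> p \<Longrightarrow> Q2 \<le> q \<Longrightarrow> Q2 \<le> n \<Longrightarrow>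
    (\<Sum>k\<le>n. (fcoeff k (c13 n) - of_bool (k \<le> p) * (fcoeff k (c13 q)))\<^sup>2) \<le> \<delta>"
    by blast
  have "\<exists>Q. \<forall>p\<ge>Q. \<forall>q\<ge>Q. \<forall>n\<ge>Q.
    (\<Sum>k\<le>n. (fcoeff k (c23 n) - of_bool (k \<le> p) * (fcoeff k (c23 q)))\<^sup>2) \<le> \<delta>"
    by (rule truncated_coefficients[OF nice_c(3) nl(2) c_le(3) c_tendsto(3) \<delta>])
  then obtain Q3 where Q3: "\<And>p q n. Q3 \<le> p \<Longrightarrow> Q3 \<le> q \<Longrightarrow> Q3 \<le> n \<Longrightarrow>
    (\<Sum>k\<le>n. (fcoeff k (c23 n) - of_bool (k \<le> p) * (fcoeff k (c23 q)))\<^sup>2) \<le> \<delta>"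
    by blast
  define Q where "Q = Max {Q0, Q1, Q2, Q3}"
  have Qge: "Q0 \<le> Q" "Q1 \<le> Q" "Q2 \<le> Q" "Q3 \<le> Q" by (auto simp: Q_def)
  show ?thesis
  proof (rule that[of Q])
    fix p1 p2 p3 n assume p: "Q \<le> p1" "Q \<le> p2" "Q \<le> p3" "Q \<le> n"
    let ?c = "\<lambda>j1 j2 j3. of_bool (\<not> (j1 \<le> p1 \<and> j2 \<le> p2 \<and> j3 \<le> p3)) * C j1 j2 j3"
    have "(\<Sum>x\<in>S n. (of_bool (x \<notin> {..p1} \<times> {..p2} \<times> {..p3}) * c x)\<^sup>2) \<le> \<delta>"
      using Qge p by (intro Q0[of Q]) (auto simp: S_def)
    then have 0: "(\<Sum>j1\<le>n. \<Sum>j2\<le>n. \<Sum>j3\<le>n. (?c j1 j2 j3)\<^sup>2) \<le> \<delta>"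
      unfolding S3 c_def by simp
    \<comment> \<open>On the diagonal the two side conditions merge into
      \<open>j \<le> min p1 p2\<close>, while \<open>k \<le> p3\<close> concerns the free index
      only. The other two contractions permute these roles.\<close>
    have "(\<Sum>j\<le>n. ?c j j k) = (\<Sum>j\<le>n. of_bool (\<not> (k \<le> p3 \<and> j \<le> min p1 p2)) * C j j k)" for k
      by (intro sum.cong arg_cong2[where f="(*)"] arg_cong[where f=of_bool]) auto
    then have 1: "(\<Sum>k\<le>n. (\<Sum>j\<le>n. ?c j j k)\<^sup>2) \<le> \<delta>"
      unfolding sum_outside_box contract_C using Q1[of p3 "min (min p1 p2) n" n] Qge p by simp
    have "(\<Sum>j\<le>n. ?c j k j) = (\<Sum>j\<le>n. of_bool (\<not> (k \<le> p2 \<and> j \<le> min p1 p3)) * C j k j)" for k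
      by (intro sum.cong arg_cong2[where f="(*)"] arg_cong[where f=of_bool]) auto
    then have 2: "(\<Sum>k\<le>n. (\<Sum>j\<le>n. ?c j k j)\<^sup>2) \<le> \<delta>"
      unfolding sum_outside_box contract_C using Q2[of p2 "min (min p1 p3) n" n] Qge p by simp
    have "(\<Sum>j\<le>n. ?c k j j) = (\<Sum>j\<le>n. of_bool (\<not> (k \<le> p1 \<and> j \<le> min p2 p3)) * C k j j)" for k
      by (intro sum.cong arg_cong2[where f="(*)"] arg_cong[where f=of_bool]) auto
    then have 3: "(\<Sum>k\<le>n. (\<Sum>j\<le>n. ?c k j j)\<^sup>2) \<le> \<delta>"
      unfolding sum_outside_box contract_C using Q3[of p1 "min (min p2 p3) n" n] Qge p by simp
    have "tensor_bound3 n ?c \<le> 6 * \<delta> + 3 * (\<delta> + \<delta> + \<delta>)"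
      unfolding tensor_bound3_def by (intro add_mono mult_left_mono 0 1 2 3) auto
    then show "tensor_bound3 n ?c \<le> \<epsilon>" by (simp add: \<delta>_def)
  qed
qed

text \<open>Here the contraction leaves no free index: it is a scalar, the trace, and the Cauchy
  property of its partial sums replaces the argument with truncated coefficients.\<close>

lemma tensor_bound2_outside_box:
  assumes s: "s \<in> {t..T}" and "0 < \<epsilon>"
  obtains Q where "\<And>p n. Q \<le> p \<Longrightarrow> Q \<le> n \<Longrightarrow>
    tensor_bound2 n (\<lambda>j1 j2. of_bool (\<not> (j1 \<le> p \<and> j2 \<le> p)) * G j2 j1 s) \<le> \<epsilon>"
proof -
  define \<delta> where "\<delta> = \<epsilon> / 3"
  have \<delta>: "0 < \<delta>" using assms by (simp add: \<delta>_def)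
  define S where "S n = {..n} \<times> {..n}" for n :: nat
  define c where "c x = G (snd x) (fst x) s" for x
  have S2: "(\<Sum>x\<in>S n. h x) = (\<Sum>j1\<le>n. \<Sum>j2\<le>n. h (j1, j2))" for h :: "_ \<Rightarrow> real" and n
    by (simp add: S_def sum.cartesian_product case_prod_unfold)
  obtain Q0 where Q0: "\<And>q n B. Q0 \<le> q \<Longrightarrow> S q \<subseteq> B \<Longrightarrow> (\<Sum>x\<in>S n. (of_bool (x \<notin> B) * c x)\<^sup>2) \<le> \<delta>"
  proof (rule sum_outside_cube[of S c "L * L" \<delta>])
    show "mono S" by (auto simp: mono_def S_def)
    show "(\<Sum>x\<in>S n. (c x)\<^sup>2) \<le> L * L" for n
      unfolding S2 c_def using sum_G_square_le[OF s] by simp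
  qed (auto simp: S_def \<delta>)
  have "(\<lambda>n. (\<Sum>j\<le>n. G j j s)) \<longlonglongrightarrow> (s - t) / 2"
    using c_tendsto(1)[OF s] by (simp add: G_diag[OF s] c12_def)
  then have "Cauchy (\<lambda>n. (\<Sum>j\<le>n. G j j s))" by (rule LIMSEQ_imp_Cauchy)
  then obtain Q1 where Q1: "\<And>m n. Q1 \<le> m \<Longrightarrow> Q1 \<le> n \<Longrightarrow> \<bar>(\<Sum>j\<le>m. G j j s) - (\<Sum>j\<le>n. G j j s)\<bar> < sqrt \<delta>"
    using \<delta> by (auto simp: Cauchy_def dist_real_def) (metis real_sqrt_gt_zero)
  show ?thesis
  proof (rule that[of "max Q0 Q1"])
    fix p n assume p: "max Q0 Q1 \<le> p" "max Q0 Q1 \<le> n"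
    let ?c = "\<lambda>j1 j2. of_bool (\<not> (j1 \<le> p \<and> j2 \<le> p)) * G j2 j1 s"
    have "(\<Sum>x\<in>S n. (of_bool (x \<notin> {..p} \<times> {..p}) * c x)\<^sup>2) \<le> \<delta>"
      using p by (intro Q0[of "max Q0 Q1"]) (auto simp: S_def)
    then have 0: "(\<Sum>j1\<le>n. \<Sum>j2\<le>n. (?c j1 j2)\<^sup>2) \<le> \<delta>"
      unfolding S2 c_def by simp
    have "(\<Sum>j\<le>n. ?c j j) = (\<Sum>j\<le>n. of_bool (\<not> (True \<and> j \<le> p)) * G j j s)"
      by (intro sum.cong) auto
    then have "\<bar>\<Sum>j\<le>n. ?c j j\<bar> \<le> sqrt \<delta>"
      unfolding sum_outside_box using Q1[of n "min p n"] p by simp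
    then have "(\<Sum>j\<le>n. ?c j j)\<^sup>2 \<le> (sqrt \<delta>)\<^sup>2" 
      by (subst abs_le_square_iff[symmetric]) (simp only: abs_of_nonneg[OF real_sqrt_ge_zero[OF less_imp_le[OF \<delta>]]])
    then have "tensor_bound2 n ?c \<le> 2 * \<delta> + \<delta>"
      unfolding tensor_bound2_def using \<delta> by (intro add_mono mult_left_mono 0) auto
    then show "tensor_bound2 n ?c \<le> \<epsilon>" by (simp add: \<delta>_def)
  qed
qed

end

subsection \<open>Trapezoidal sums\<close>

context orthonormal_basis
begin

lemma integral_square_le:
  assumes "nice d" "\<And>s. s \<in> {t..T} \<Longrightarrow> \<bar>d s\<bar> \<le> \<delta>"
  shows "(\<integral>s. (d s)\<^sup>2 \<partial>U) \<le> \<delta>\<^sup>2 * L"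
proof (rule integral_nice_bound)
  show "nice (\<lambda>s. (d s)\<^sup>2)" by (intro nice_power2 assms)
  show "\<bar>(d s)\<^sup>2\<bar> \<le> \<delta>\<^sup>2" if "s \<in> {t..T}" for s
    using power_mono[OF assms(2)[OF that] abs_ge_zero, of 2] by simp
qed

lemma integral_phi_step:
  assumes part: "is_partition t b \<tau> N" and "b \<le> T"
  shows "(\<integral>s. \<phi> j s * (\<Sum>l<N. x l * cell \<tau> l s) \<partial>U) = (\<Sum>l<N. x l * (\<Phi> j (\<tau> (Suc l)) - \<Phi> j (\<tau> l)))"
proof -
  have "(\<Sum>l<N. \<integral>s. \<phi> j s * (x l * cell \<tau> l s) \<partial>U) =
      (\<integral>s. \<phi> j s * (\<Sum>l<N. x l * cell \<tau> l s) \<partial>U)"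
    by (intro sum_integral_phi nice_rules) auto
  moreover have "(\<integral>s. \<phi> j s * (x l * cell \<tau> l s) \<partial>U) = x l * (\<Phi> j (\<tau> (Suc l)) - \<Phi> j (\<tau> l))"
    if "l < N" for l
  proof -
    have "t \<le> \<tau> l" "\<tau> l \<le> \<tau> (Suc l)" "\<tau> (Suc l) \<le> T"
      using that is_partition_bounds[OF part, of l] is_partition_bounds[OF part, of "Suc l"]
        is_partition_mono[OF part, of l "Suc l"] \<open>b \<le> T\<close> by auto
    then have "fcoeff j (cell \<tau> l) = \<Phi> j (\<tau> (Suc l)) - \<Phi> j (\<tau> l)"
      by (rule integral_indicator_phi)
    moreover have "(\<integral>s. \<phi> j s * (x l * cell \<tau> l s) \<partial>U) =
        (\<integral>s. x l * (\<phi> j s * cell \<tau> l s) \<partial>U)"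
      by (simp add: mult.left_commute)
    ultimately show ?thesis by simp
  qed
  ultimately show ?thesis by simp
qed

text \<open>Cells are left-open, so the starting point lies in none of them; this is why
  \<open>s = t\<close> is a separate case in the pointwise estimates.\<close>

lemma step_at_start:
  assumes "is_partition t b \<tau> N"
  shows "(\<Sum>l<N. x l * cell \<tau> l t) = (0::real)"
  using is_partition_bounds(1)[OF assms] by (intro sum.neutral) (auto simp: indicator_def not_less)

lemma sum_Phi_diff_square_le:
  assumes "a \<in> {t..T}" "b \<in> {t..T}"
  shows "(\<Sum>j\<in>J. (\<Phi> j b - \<Phi> j a)\<^sup>2) \<le> \<bar>b - a\<bar>"
proof -
  have *: "(\<Sum>j\<in>J. (\<Phi> j b - \<Phi> j a)\<^sup>2) \<le> b - a" if ab: "t \<le> a" "a \<le> b" "b \<le> T" for a b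
  proof -
    have "(\<integral>u. (indicator {a<..b} u)\<^sup>2 \<partial>U) = (\<integral>u. (indicator {a<..b} u :: real) \<partial>U)"
      by (intro Bochner_Integration.integral_cong) (auto simp: indicator_def)
    then show ?thesis
      using bessel[of "indicator {a<..b}" J] integral_indicator[OF ab] integral_indicator_phi[OF ab]
      by (simp add: nice_indicator)
  qed
  show ?thesis
  proof (cases "a \<le> b")
    case True
    then show ?thesis using *[of a b] assms by simp
  next
    case False
    then show ?thesis using *[of b a] assms by (simp add: power2_commute[of "\<Phi> _ b"])
  qed
qed

text \<open>Applying the trapezoidal rule to truncated expansions again gives forms in the
  \<open>\<zeta>\<close> variables, with these coefficients. \<open>C_trap\<close> contains the
  exact \<open>G\<close> because the inner integral enters the outer sums through its own expansion,
  not through sums.\<close>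

definition G_trap :: "(nat \<Rightarrow> real) \<Rightarrow> nat \<Rightarrow> nat \<Rightarrow> nat \<Rightarrow> real" where
  "G_trap \<tau> N j1 j2 = (\<Sum>l<N. (\<Phi> j1 (\<tau> l) + \<Phi> j1 (\<tau> (Suc l))) / 2 * (\<Phi> j2 (\<tau> (Suc l)) - \<Phi> j2 (\<tau> l)))"

definition C_trap :: "(nat \<Rightarrow> real) \<Rightarrow> nat \<Rightarrow> nat \<Rightarrow> nat \<Rightarrow> nat \<Rightarrow> real" where
  "C_trap \<tau> N j1 j2 j3 = (\<Sum>l<N. (G j2 j1 (\<tau> l) + G j2 j1 (\<tau> (Suc l))) / 2 * (\<Phi> j3 (\<tau> (Suc l)) - \<Phi> j3 (\<tau> l)))"

lemma mean_square_le: "((x + y) / 2 - z)\<^sup>2 \<le> ((x - z)\<^sup>2 + (y - z)\<^sup>2) / (2::real)"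
proof -
  have "0 \<le> (x - y)\<^sup>2" by simp
  then show ?thesis by (simp add: power2_eq_square field_simps)
qed

text \<open>The squared norm is controlled by Bessel's inequality for the interpolation error
  \<open>D\<close>. The trace error is exactly zero: on the diagonal the trapezoidal rule
  telescopes, (x+y)/2 * (y-x) = (y^2-x^2)/2, and this is where the symmetric evaluation of the
  Stratonovich sums matters.\<close>

lemma tensor_bound2_trapezoid:
  assumes s: "s \<in> {t..T}" and part: "is_partition t s \<tau> N"
    and mesh: "\<And>l. l < N \<Longrightarrow> \<tau> (Suc l) - \<tau> l \<le> \<delta>" and "0 \<le> \<delta>"
  shows "tensor_bound2 n (\<lambda>j1 j2. G_trap \<tau> N j1 j2 - G j2 j1 s) \<le> 2 * (\<delta> * L)"
proof -
  define D where "D j u = (\<Sum>l<N. (\<Phi> j (\<tau> l) + \<Phi> j (\<tau> (Suc l))) / 2 * cell \<tau> l u) - \<Phi> j u * indicator {t<..s} u" for j u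
  have nD: "nice (D j)" for j unfolding D_def by (intro nice_rules) auto
  have eq: "G_trap \<tau> N j1 j2 - G j2 j1 s = fcoeff j2 (D j1)" for j1 j2
  proof -
    have i: "integrable U (\<lambda>u. \<phi> j2 u * (\<Sum>l<N. (\<Phi> j1 (\<tau> l) + \<Phi> j1 (\<tau> (Suc l))) / 2 * cell \<tau> l u))"
      "integrable U (\<lambda>u. \<phi> j2 u * (\<Phi> j1 u * indicator {t<..s} u))"
      by (intro nice_integrable nice_rules; simp)+
    show ?thesis
      unfolding D_def right_diff_distrib Bochner_Integration.integral_diff[OF i]
      using s by (subst integral_phi_step[OF part]) (auto simp: G_trap_def G_eq mult.assoc)
  qed
  have "(\<Sum>j\<le>n. (D j u)\<^sup>2) \<le> \<delta>" if u: "u \<in> {t..T}" for u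
  proof (cases "t < u \<and> u \<le> s")
    case True
    then obtain k where k: "k < N" "\<tau> k < u" "u \<le> \<tau> (Suc k)"
      using is_partition_cell[OF part, of u] by auto
    have kin: "\<tau> k \<in> {t..T}" "\<tau> (Suc k) \<in> {t..T}"
      using k s is_partition_bounds[OF part, of k] is_partition_bounds[OF part, of "Suc k"] by auto
    have "D j u = (\<Phi> j (\<tau> k) + \<Phi> j (\<tau> (Suc k))) / 2 - \<Phi> j u" for j
      unfolding D_def using True by (subst sum_cells[OF part k]) simp
    then have "(\<Sum>j\<le>n. (D j u)\<^sup>2) \<le> (\<Sum>j\<le>n. ((\<Phi> j (\<tau> k) - \<Phi> j u)\<^sup>2 + (\<Phi> j (\<tau> (Suc k)) - \<Phi> j u)\<^sup>2) / 2)"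
      by (auto intro: sum_mono mean_square_le)
    also have "\<dots> = ((\<Sum>j\<le>n. (\<Phi> j (\<tau> k) - \<Phi> j u)\<^sup>2) + (\<Sum>j\<le>n. (\<Phi> j (\<tau> (Suc k)) - \<Phi> j u)\<^sup>2)) / 2"
      by (simp add: sum.distrib flip: sum_divide_distrib)
    also have "\<dots> \<le> (\<bar>\<tau> k - u\<bar> + \<bar>\<tau> (Suc k) - u\<bar>) / 2"
      using kin u by (intro divide_right_mono add_mono sum_Phi_diff_square_le) auto
    also have "\<dots> \<le> \<delta>" using k mesh[OF k(1)] \<open>0 \<le> \<delta>\<close> by simp
    finally show ?thesis .
  next
    case False
    have "D j u = 0" for j
    proof -
      have "(\<Sum>l<N. x l * cell \<tau> l u) = (0::real)" for x
      proof (rule sum.neutral, rule ballI)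
        fix l assume "l \<in> {..<N}"
        then show "x l * cell \<tau> l u = 0"
          using False u is_partition_bounds[OF part, of l] is_partition_bounds[OF part, of "Suc l"]
          by (auto simp: indicator_def)
      qed
      then show ?thesis unfolding D_def by (subst \<open>\<And>x. _ = 0\<close>) (use False in auto)
    qed
    then show ?thesis using \<open>0 \<le> \<delta>\<close> by simp
  qed
  then have 1: "(\<Sum>j1\<le>n. \<Sum>j2\<le>n. (G_trap \<tau> N j1 j2 - G j2 j1 s)\<^sup>2) \<le> \<delta> * L"
    unfolding eq by (intro bessel_family nD)
  have "G_trap \<tau> N j j = G j j s" for j
  proof -
    have "G_trap \<tau> N j j = (\<Sum>l<N. (\<Phi> j (\<tau> (Suc l)))\<^sup>2 / 2 - (\<Phi> j (\<tau> l))\<^sup>2 / 2)"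
      unfolding G_trap_def by (intro sum.cong) (auto simp: power2_eq_square field_simps)
    also have "\<dots> = (\<Phi> j (\<tau> N))\<^sup>2 / 2 - (\<Phi> j (\<tau> 0))\<^sup>2 / 2"
      by (rule sum_lessThan_telescope)
    also have "\<dots> = G j j s" using part s by (simp add: is_partition_def G_diag Phi_t)
    finally show ?thesis .
  qed
  then show ?thesis unfolding tensor_bound2_def using 1 by simp
qed

section \<open>Trapezoidal errors of the triple coefficients on a fixed partition\<close>

context
  fixes \<tau> :: "nat \<Rightarrow> real" and N :: nat and \<delta> :: real
  assumes part: "is_partition t T \<tau> N" and mesh: "\<And>l. l < N \<Longrightarrow> \<tau> (Suc l) - \<tau> l \<le> \<delta>"
begin

lemma tau_in: "l \<le> N \<Longrightarrow> \<tau> l \<in> {t..T}"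
  using is_partition_bounds[OF part] by auto

lemma mesh_nonneg: "0 \<le> \<delta>"
proof -
  have "N \<noteq> 0"
  proof
    assume "N = 0"
    then show False using part t_less_T by (simp add: is_partition_def)
  qed
  then show ?thesis using mesh[of 0] is_partition_mono[OF part, of 0 "Suc 0"] by auto
qed

text \<open>The contractions of \<open>C_trap - C\<close> over the index pairs 12, 13 and 23 are the coefficients of
  \<open>\<Sum>\<^sub>j D12 j j\<close>, \<open>\<Sum>\<^sub>j D13 j - c13\<close> and \<open>\<Sum>\<^sub>j D23 j - c23\<close>.\<close>

definition D12 :: "nat \<Rightarrow> nat \<Rightarrow> real \<Rightarrow> real" where
  "D12 j1 j2 s = (\<Sum>l<N. (G j2 j1 (\<tau> l) + G j2 j1 (\<tau> (Suc l))) / 2 * cell \<tau> l s) - G j2 j1 s"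

definition D13 :: "nat \<Rightarrow> real \<Rightarrow> real" where
  "D13 j v = (\<Sum>l<N. (indicator {t<..\<tau> l} v + indicator {t<..\<tau> (Suc l)} v) / 2 *
     (\<Phi> j v * (\<Phi> j (\<tau> (Suc l)) - \<Phi> j (\<tau> l))))"

definition D23 :: "nat \<Rightarrow> real \<Rightarrow> real" where
  "D23 j u = (\<Sum>l<N. ((\<Phi> j (\<tau> l) - \<Phi> j u) * indicator {t<..\<tau> l} u +
     (\<Phi> j (\<tau> (Suc l)) - \<Phi> j u) * indicator {t<..\<tau> (Suc l)} u) / 2 * (\<Phi> j (\<tau> (Suc l)) - \<Phi> j (\<tau> l)))"

lemma nice_D: "nice (D12 j1 j2)" "nice (D13 j)" "nice (D23 j)"
  unfolding D12_def[abs_def] D13_def[abs_def] D23_def[abs_def] divide_inverse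
  by (intro nice_rules; simp)+

lemma C_trap_diff: "C_trap \<tau> N j1 j2 j3 - C j1 j2 j3 = fcoeff j3 (D12 j1 j2)"
proof -
  have i: "integrable U (\<lambda>s. \<phi> j3 s * (\<Sum>l<N. (G j2 j1 (\<tau> l) + G j2 j1 (\<tau> (Suc l))) / 2 * cell \<tau> l s))"
    "integrable U (\<lambda>s. \<phi> j3 s * G j2 j1 s)"
    by (intro nice_integrable nice_rules; simp)+
  show ?thesis
    unfolding D12_def right_diff_distrib Bochner_Integration.integral_diff[OF i]
    by (subst integral_phi_step[OF part]) (auto simp: C_trap_def C_def)
qed

lemma D12_cell:
  assumes "k < N" "\<tau> k < s" "s \<le> \<tau> (Suc k)"
  shows "D12 j1 j2 s = (G j2 j1 (\<tau> k) + G j2 j1 (\<tau> (Suc k))) / 2 - G j2 j1 s"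
  unfolding D12_def by (subst sum_cells[OF part assms]) simp

lemma D12_start: "D12 j1 j2 t = 0"
  unfolding D12_def by (subst step_at_start[OF part]) (simp add: G_t)

lemma sum_D12_square_le:
  assumes s: "s \<in> {t..T}"
  shows "(\<Sum>j1\<le>n. \<Sum>j2\<le>n. (D12 j1 j2 s)\<^sup>2) \<le> \<delta> * L"
proof (cases "s = t")
  case True
  then show ?thesis using mesh_nonneg t_less_T by (simp add: D12_start)
next
  case False
  then obtain k where k: "k < N" "\<tau> k < s" "s \<le> \<tau> (Suc k)"
    using is_partition_cell[OF part, of s] s by auto
  have kin: "\<tau> k \<in> {t..T}" "\<tau> (Suc k) \<in> {t..T}" using k tau_in by auto
  have "(\<Sum>j1\<le>n. \<Sum>j2\<le>n. (D12 j1 j2 s)\<^sup>2) \<le>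
      (\<Sum>j1\<le>n. \<Sum>j2\<le>n. ((G j2 j1 (\<tau> k) - G j2 j1 s)\<^sup>2 + (G j2 j1 (\<tau> (Suc k)) - G j2 j1 s)\<^sup>2) / 2)"
    unfolding D12_cell[OF k] by (intro sum_mono mean_square_le)
  also have "\<dots> = ((\<Sum>j1\<le>n. \<Sum>j2\<le>n. (G j2 j1 (\<tau> k) - G j2 j1 s)\<^sup>2) + (\<Sum>j1\<le>n. \<Sum>j2\<le>n. (G j2 j1 (\<tau> (Suc k)) - G j2 j1 s)\<^sup>2)) / 2"
    by (simp add: sum.distrib flip: sum_divide_distrib)
  also have "\<dots> \<le> (\<bar>\<tau> k - s\<bar> * L + \<bar>\<tau> (Suc k) - s\<bar> * L) / 2"
    using kin s by (intro divide_right_mono add_mono sum_G_diff_square_le) auto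
  also have "\<dots> = (\<tau> (Suc k) - \<tau> k) / 2 * L" using k by (simp add: field_simps)
  also have "\<dots> \<le> \<delta> * L"
    using k mesh[OF k(1)] mesh_nonneg t_less_T by (intro mult_right_mono) auto
  finally show ?thesis .
qed

lemma sum_C_trap_diff_square_le: "(\<Sum>j1\<le>n. \<Sum>j2\<le>n. \<Sum>j3\<le>n. (C_trap \<tau> N j1 j2 j3 - C j1 j2 j3)\<^sup>2) \<le> \<delta> * L * L"
proof -
  have *: "(\<Sum>x\<in>{..n} \<times> {..n}. h x) = (\<Sum>j1\<le>n. \<Sum>j2\<le>n. h (j1, j2))" for h :: "nat \<times> nat \<Rightarrow> real"
    by (simp add: sum.cartesian_product case_prod_unfold)
  have "(\<Sum>x\<in>{..n} \<times> {..n}. \<Sum>k\<le>n. (\<integral>s. \<phi> k s * D12 (fst x) (snd x) s \<partial>U)\<^sup>2) \<le> \<delta> * L * L"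
    by (rule bessel_family) (simp_all only: nice_D * fst_conv snd_conv sum_D12_square_le)
  then show ?thesis unfolding C_trap_diff * by simp
qed

lemma contract12_trap: "(\<Sum>j\<le>n. C_trap \<tau> N j j k - C j j k) = (\<integral>s. \<phi> k s * (\<Sum>j\<le>n. D12 j j s) \<partial>U)"
  unfolding C_trap_diff by (intro sum_integral_phi nice_D)

lemma integral_diff_phi:
  assumes "nice g" "nice h"
  shows "(\<integral>s. \<phi> k s * (g s - h s) \<partial>U) = fcoeff k g - fcoeff k h"
proof -
  have "integrable U (\<lambda>s. \<phi> k s * g s)" "integrable U (\<lambda>s. \<phi> k s * h s)"
    by (intro nice_integrable nice_rules assms)+
  then show ?thesis by (simp add: right_diff_distrib)
qed

lemma C_trap13: "C_trap \<tau> N j k j = fcoeff k (D13 j)"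
proof -
  have "fcoeff k (D13 j) = (\<Sum>l<N. \<integral>v. \<phi> k v * ((indicator {t<..\<tau> l} v + indicator {t<..\<tau> (Suc l)} v) / 2 *
     (\<Phi> j v * (\<Phi> j (\<tau> (Suc l)) - \<Phi> j (\<tau> l)))) \<partial>U)"
    unfolding D13_def divide_inverse by (intro sum_integral_phi[symmetric] nice_rules; simp)
  also have "\<dots> = C_trap \<tau> N j k j"
    unfolding C_trap_def
  proof (rule sum.cong)
    fix l assume "l \<in> {..<N}"
    then have l: "\<tau> l \<in> {t..T}" "\<tau> (Suc l) \<in> {t..T}" using tau_in by auto
    let ?d = "\<Phi> j (\<tau> (Suc l)) - \<Phi> j (\<tau> l)"
    have i: "integrable U (\<lambda>v. \<phi> k v * \<Phi> j v * indicator {t<..\<tau> l} v)"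
      "integrable U (\<lambda>v. \<phi> k v * \<Phi> j v * indicator {t<..\<tau> (Suc l)} v)"
      by (intro nice_integrable nice_rules; simp)+
    have "(\<integral>v. \<phi> k v * ((indicator {t<..\<tau> l} v + indicator {t<..\<tau> (Suc l)} v) / 2 * (\<Phi> j v * ?d)) \<partial>U) =
        (\<integral>v. (\<phi> k v * \<Phi> j v * indicator {t<..\<tau> l} v + \<phi> k v * \<Phi> j v * indicator {t<..\<tau> (Suc l)} v) * (?d / 2) \<partial>U)"
      by (intro Bochner_Integration.integral_cong) (auto simp: field_simps)
    also have "\<dots> = (G k j (\<tau> l) + G k j (\<tau> (Suc l))) / 2 * ?d"
      using i l by (simp add: G_eq)
    finally show "(\<integral>v. \<phi> k v * ((indicator {t<..\<tau> l} v + indicator {t<..\<tau> (Suc l)} v) / 2 * (\<Phi> j v * ?d)) \<partial>U) =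
        (G k j (\<tau> l) + G k j (\<tau> (Suc l))) / 2 * ?d" .
  qed simp
  finally show ?thesis by simp
qed

text \<open>The free index \<open>k\<close> is now the innermost one, so the coefficients
  \<open>G j k\<close> at the nodes are rewritten by \<open>G_by_parts\<close>.\<close>

lemma C_trap23: "C_trap \<tau> N k j j = fcoeff k (D23 j)"
proof -
  have "fcoeff k (D23 j) = (\<Sum>l<N. \<integral>u. \<phi> k u * (((\<Phi> j (\<tau> l) - \<Phi> j u) * indicator {t<..\<tau> l} u +
     (\<Phi> j (\<tau> (Suc l)) - \<Phi> j u) * indicator {t<..\<tau> (Suc l)} u) / 2 * (\<Phi> j (\<tau> (Suc l)) - \<Phi> j (\<tau> l))) \<partial>U)"
    unfolding D23_def divide_inverse by (intro sum_integral_phi[symmetric] nice_rules; simp)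
  also have "\<dots> = C_trap \<tau> N k j j"
    unfolding C_trap_def
  proof (rule sum.cong)
    fix l assume "l \<in> {..<N}"
    then have l: "\<tau> l \<in> {t..T}" "\<tau> (Suc l) \<in> {t..T}" using tau_in by auto
    let ?d = "\<Phi> j (\<tau> (Suc l)) - \<Phi> j (\<tau> l)"
    let ?a = "\<lambda>u. \<phi> k u * ((\<Phi> j (\<tau> l) - \<Phi> j u) * indicator {t<..\<tau> l} u)"
    let ?b = "\<lambda>u. \<phi> k u * ((\<Phi> j (\<tau> (Suc l)) - \<Phi> j u) * indicator {t<..\<tau> (Suc l)} u)"
    have i: "integrable U ?a" "integrable U ?b"
      by (intro nice_integrable nice_rules; simp)+
    have "(\<integral>u. \<phi> k u * (((\<Phi> j (\<tau> l) - \<Phi> j u) * indicator {t<..\<tau> l} u +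
       (\<Phi> j (\<tau> (Suc l)) - \<Phi> j u) * indicator {t<..\<tau> (Suc l)} u) / 2 * ?d) \<partial>U) = (\<integral>u. (?a u + ?b u) * (?d / 2) \<partial>U)"
      by (intro Bochner_Integration.integral_cong) (auto simp: field_simps)
    also have "\<dots> = (G j k (\<tau> l) + G j k (\<tau> (Suc l))) / 2 * ?d"
      using i l by (simp add: G_by_parts)
    finally show "(\<integral>u. \<phi> k u * (((\<Phi> j (\<tau> l) - \<Phi> j u) * indicator {t<..\<tau> l} u +
       (\<Phi> j (\<tau> (Suc l)) - \<Phi> j u) * indicator {t<..\<tau> (Suc l)} u) / 2 * ?d) \<partial>U) =
       (G j k (\<tau> l) + G j k (\<tau> (Suc l))) / 2 * ?d" .
  qed simp
  finally show ?thesis by simp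
qed

lemma contract13_trap:
  "(\<Sum>j\<le>n. C_trap \<tau> N j k j - C j k j) = (\<integral>s. \<phi> k s * ((\<Sum>j\<le>n. D13 j s) - c13 n s) \<partial>U)"
  by (simp add: sum_subtractf contract_C C_trap13 sum_integral_phi nice_D integral_diff_phi nice_sum nice_c)

lemma contract23_trap:
  "(\<Sum>j\<le>n. C_trap \<tau> N k j j - C k j j) = (\<integral>s. \<phi> k s * ((\<Sum>j\<le>n. D23 j s) - c23 n s) \<partial>U)"
  by (simp add: sum_subtractf contract_C C_trap23 sum_integral_phi nice_D integral_diff_phi nice_sum nice_c)

text \<open>On a cell the summed error is the mean of \<open>c12 n\<close> at the two end points
  minus its value at \<open>s\<close>. As \<open>c12 n\<close> tends to \<open>(s - t) / 2\<close>,
  what remains is the error of replacing a linear function by the mean of its end values; the 4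
  combines the two halvings.\<close>

lemma trap12_tendsto:
  "(\<lambda>n. \<integral>s. (\<Sum>j\<le>n. D12 j j s)\<^sup>2 \<partial>U) \<longlonglongrightarrow>
    (\<integral>s. ((\<Sum>l<N. ((\<tau> l - t) + (\<tau> (Suc l) - t)) / 4 * cell \<tau> l s) - (s - t) / 2)\<^sup>2 \<partial>U)"
  (is "_ \<longlonglongrightarrow> (\<integral>s. (?d s)\<^sup>2 \<partial>U)")
proof (rule integral_square_tendsto[where K = "4 * L"])
  have "nice (\<lambda>s. (s - t) / 2)" by (auto intro!: nice_continuous continuous_intros)
  then show "nice ?d" by (intro nice_rules) auto
  show "nice (\<lambda>s. \<Sum>j\<le>n. D12 j j s)" for n by (intro nice_sum nice_D)
  have eq: "(\<Sum>j\<le>n. D12 j j s) = (c12 n (\<tau> k) + c12 n (\<tau> (Suc k))) / 2 - c12 n s"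
    if "s \<in> {t..T}" "k < N" "\<tau> k < s" "s \<le> \<tau> (Suc k)" for n s k
  proof -
    have kin: "\<tau> k \<in> {t..T}" "\<tau> (Suc k) \<in> {t..T}" using that tau_in by auto
    show ?thesis
      unfolding D12_cell[OF that(2-4)] G_diag[OF kin(1)] G_diag[OF kin(2)] G_diag[OF that(1)] c12_def
      by (simp add: sum_subtractf sum.distrib flip: sum_divide_distrib)
  qed
  show "\<bar>\<Sum>j\<le>n. D12 j j s\<bar> \<le> 4 * L" if s: "s \<in> {t..T}" for n s
  proof (cases "s = t")
    case True
    then show ?thesis using t_less_T by (simp add: D12_start)
  next
    case False
    then obtain k where k: "k < N" "\<tau> k < s" "s \<le> \<tau> (Suc k)"
      using is_partition_cell[OF part, of s] s by auto
    then have kin: "\<tau> k \<in> {t..T}" "\<tau> (Suc k) \<in> {t..T}" using tau_in by auto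
    have "\<bar>(x + y) / 2 - z\<bar> \<le> 4 * K" if "\<bar>x\<bar> \<le> 2 * K" "\<bar>y\<bar> \<le> 2 * K" "\<bar>z\<bar> \<le> 2 * K" for x y z K :: real
      using that by (auto simp: field_simps abs_le_iff)
    then show ?thesis
      unfolding eq[OF s k] using c_le(1)[OF kin(1)] c_le(1)[OF kin(2)] c_le(1)[OF s] by blast
  qed
  show "(\<lambda>n. \<Sum>j\<le>n. D12 j j s) \<longlonglongrightarrow> ?d s" if s: "t < s" "s \<le> T" for s
  proof -
    from s have s': "s \<in> {t..T}" by simp
    obtain k where k: "k < N" "\<tau> k < s" "s \<le> \<tau> (Suc k)"
      using is_partition_cell[OF part s] by auto
    then have kin: "\<tau> k \<in> {t..T}" "\<tau> (Suc k) \<in> {t..T}" using tau_in by auto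
    have "(\<lambda>n. \<Sum>j\<le>n. D12 j j s) \<longlonglongrightarrow> ((\<tau> k - t) / 2 + (\<tau> (Suc k) - t) / 2) / 2 - (s - t) / 2"
      unfolding eq[OF s' k] by (intro tendsto_intros c_tendsto kin s') simp
    moreover have "?d s = ((\<tau> k - t) / 2 + (\<tau> (Suc k) - t) / 2) / 2 - (s - t) / 2"
      by (subst sum_cells[OF part k]) (simp add: field_simps)
    ultimately show ?thesis by (simp only:)
  qed
qed

lemma trap12_limit_le:
  "(\<integral>s. ((\<Sum>l<N. ((\<tau> l - t) + (\<tau> (Suc l) - t)) / 4 * cell \<tau> l s) - (s - t) / 2)\<^sup>2 \<partial>U) \<le> \<delta>\<^sup>2 * L"
  (is "(\<integral>s. (?d s)\<^sup>2 \<partial>U) \<le> _")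
proof (rule integral_square_le)
  have "nice (\<lambda>s. (s - t) / 2)" by (auto intro!: nice_continuous continuous_intros)
  then show "nice ?d" by (intro nice_rules) auto
  show "\<bar>?d s\<bar> \<le> \<delta>" if s: "s \<in> {t..T}" for s
  proof (cases "s = t")
    case True
    show ?thesis unfolding True step_at_start[OF part] using mesh_nonneg by simp
  next
    case False
    then obtain k where k: "k < N" "\<tau> k < s" "s \<le> \<tau> (Suc k)"
      using is_partition_cell[OF part, of s] s by auto
    show ?thesis
      unfolding sum_cells[OF part k] using k mesh[OF k(1)] mesh_nonneg by (auto simp: abs_le_iff field_simps)
  qed
qed

lemma sum_D13:
  "(\<Sum>j\<le>n. D13 j v) = (\<Sum>l<N. (indicator {t<..\<tau> l} v + indicator {t<..\<tau> (Suc l)} v) / 2 *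
     ((\<Sum>j\<le>n. \<Phi> j v * \<Phi> j (\<tau> (Suc l))) - (\<Sum>j\<le>n. \<Phi> j v * \<Phi> j (\<tau> l))))"
  unfolding D13_def by (subst sum.swap) (simp add: sum_distrib_left sum_subtractf[symmetric] right_diff_distrib)

text \<open>In the limit the summand of cell \<open>l\<close> vanishes unless \<open>s\<close> lies
  in that cell: the indicators vanish for \<open>s\<close> beyond it, the difference of minima for
  \<open>s\<close> before it. Inside, only the right end point contributes, with weight one half,
  and \<open>c13 n\<close> tends to 0.\<close>

lemma trap13_tendsto:
  "(\<lambda>n. \<integral>s. ((\<Sum>j\<le>n. D13 j s) - c13 n s)\<^sup>2 \<partial>U) \<longlonglongrightarrow>
    (\<integral>s. (\<Sum>l<N. (s - \<tau> l) / 2 * cell \<tau> l s)\<^sup>2 \<partial>U)"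
\<comment> \<open>The dominating constant grows with \<open>N\<close>, which is harmless since the
  partition is fixed while \<open>n\<close> tends to infinity.\<close>
proof (rule integral_square_tendsto[where K = "real N * (2 * L) + 2 * L"])
  have "nice (\<lambda>s. (s - \<tau> l) / 2)" for l by (auto intro!: nice_continuous continuous_intros)
  then show "nice (\<lambda>s. \<Sum>l<N. (s - \<tau> l) / 2 * cell \<tau> l s)" by (intro nice_rules) auto
  show "nice (\<lambda>s. (\<Sum>j\<le>n. D13 j s) - c13 n s)" for n by (intro nice_diff nice_sum nice_D nice_c)
  show "\<bar>(\<Sum>j\<le>n. D13 j s) - c13 n s\<bar> \<le> real N * (2 * L) + 2 * L" if s: "s \<in> {t..T}" for n s
  proof -
    have "\<bar>\<Sum>j\<le>n. D13 j s\<bar> \<le> (\<Sum>l<N. 2 * L)"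
      unfolding sum_D13
    proof (rule order_trans[OF sum_abs sum_mono])
      fix l assume "l \<in> {..<N}"
      then have l: "\<tau> l \<in> {t..T}" "\<tau> (Suc l) \<in> {t..T}" using tau_in by auto
      have "\<bar>w / 2 * (x - y)\<bar> \<le> 2 * K" if "0 \<le> w" "w \<le> 2" "\<bar>x\<bar> \<le> K" "\<bar>y\<bar> \<le> K" for w x y K :: real
      proof -
        have "\<bar>w / 2\<bar> * \<bar>x - y\<bar> \<le> 1 * (2 * K)" using that by (intro mult_mono) auto
        then show ?thesis by (simp add: abs_mult)
      qed
      then show "\<bar>(indicator {t<..\<tau> l} s + indicator {t<..\<tau> (Suc l)} s) / 2 *
          ((\<Sum>j\<le>n. \<Phi> j s * \<Phi> j (\<tau> (Suc l))) - (\<Sum>j\<le>n. \<Phi> j s * \<Phi> j (\<tau> l)))\<bar> \<le> 2 * L"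
        using sum_Phi_Phi_le[OF s l(1), of "{..n}"] sum_Phi_Phi_le[OF s l(2), of "{..n}"]
        by (auto simp: indicator_def)
    qed
    then show ?thesis using c_le(2)[OF s, of n] by (simp add: abs_le_iff)
  qed
  show "(\<lambda>n. (\<Sum>j\<le>n. D13 j s) - c13 n s) \<longlonglongrightarrow> (\<Sum>l<N. (s - \<tau> l) / 2 * cell \<tau> l s)"
    if s: "t < s" "s \<le> T" for s
  proof -
    from s have s': "s \<in> {t..T}" by simp
    have "(\<lambda>n. (\<Sum>j\<le>n. D13 j s) - c13 n s) \<longlonglongrightarrow> (\<Sum>l<N. (indicator {t<..\<tau> l} s + indicator {t<..\<tau> (Suc l)} s) / 2 *
        ((min s (\<tau> (Suc l)) - t) - (min s (\<tau> l) - t))) - 0"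
      unfolding sum_D13 using tau_in by (intro tendsto_intros c_tendsto parseval_polarized s') auto
    moreover have "(indicator {t<..\<tau> l} s + indicator {t<..\<tau> (Suc l)} s) / 2 *
        ((min s (\<tau> (Suc l)) - t) - (min s (\<tau> l) - t)) = (s - \<tau> l) / 2 * cell \<tau> l s"
      if "l < N" for l
      using is_partition_mono[OF part, of l "Suc l"] that s by (auto simp: indicator_def min_def)
    ultimately show ?thesis by simp
  qed
qed

lemma trap13_limit_le: "(\<integral>s. (\<Sum>l<N. (s - \<tau> l) / 2 * cell \<tau> l s)\<^sup>2 \<partial>U) \<le> \<delta>\<^sup>2 * L"
  (is "(\<integral>s. (?d s)\<^sup>2 \<partial>U) \<le> _")
proof (rule integral_square_le)
  have "nice (\<lambda>s. (s - \<tau> l) / 2)" for l by (auto intro!: nice_continuous continuous_intros)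
  then show "nice ?d" by (intro nice_rules) auto
  show "\<bar>?d s\<bar> \<le> \<delta>" if s: "s \<in> {t..T}" for s
  proof (cases "s = t")
    case True
    show ?thesis unfolding True step_at_start[OF part] using mesh_nonneg by simp
  next
    case False
    then obtain k where k: "k < N" "\<tau> k < s" "s \<le> \<tau> (Suc k)"
      using is_partition_cell[OF part, of s] s by auto
    show ?thesis
      unfolding sum_cells[OF part k] using k mesh[OF k(1)] mesh_nonneg by (auto simp: abs_le_iff field_simps)
  qed
qed

text \<open>The truncated covariance kernel of the Wiener process started at \<open>t\<close>; on
  the interval its limit is \<open>min a b - t\<close>.\<close>

definition \<kappa> :: "nat \<Rightarrow> real \<Rightarrow> real \<Rightarrow> real" where
  "\<kappa> n a b = (\<Sum>j\<le>n. \<Phi> j a * \<Phi> j b)"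

lemma sum_D23:
  "(\<Sum>j\<le>n. D23 j u) = (\<Sum>l<N.
     (indicator {t<..\<tau> l} u * ((\<kappa> n (\<tau> l) (\<tau> (Suc l)) - \<kappa> n (\<tau> l) (\<tau> l)) - (\<kappa> n u (\<tau> (Suc l)) - \<kappa> n u (\<tau> l))) +
      indicator {t<..\<tau> (Suc l)} u * ((\<kappa> n (\<tau> (Suc l)) (\<tau> (Suc l)) - \<kappa> n (\<tau> (Suc l)) (\<tau> l)) -
        (\<kappa> n u (\<tau> (Suc l)) - \<kappa> n u (\<tau> l)))) / 2)"
  unfolding D23_def
proof (subst sum.swap, rule sum.cong, rule refl)
  fix l
  have *: "(\<Sum>j\<le>n. (\<Phi> j a - \<Phi> j u) * (\<Phi> j c - \<Phi> j b)) = (\<kappa> n a c - \<kappa> n a b) - (\<kappa> n u c - \<kappa> n u b)" for a b c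
    unfolding \<kappa>_def sum_subtractf[symmetric] by (intro sum.cong) (auto simp: algebra_simps)
  have "(\<Sum>j\<le>n. ((\<Phi> j (\<tau> l) - \<Phi> j u) * indicator {t<..\<tau> l} u + (\<Phi> j (\<tau> (Suc l)) - \<Phi> j u) * indicator {t<..\<tau> (Suc l)} u) / 2 *
        (\<Phi> j (\<tau> (Suc l)) - \<Phi> j (\<tau> l))) =
      (\<Sum>j\<le>n. (indicator {t<..\<tau> l} u * ((\<Phi> j (\<tau> l) - \<Phi> j u) * (\<Phi> j (\<tau> (Suc l)) - \<Phi> j (\<tau> l))) +
        indicator {t<..\<tau> (Suc l)} u * ((\<Phi> j (\<tau> (Suc l)) - \<Phi> j u) * (\<Phi> j (\<tau> (Suc l)) - \<Phi> j (\<tau> l)))) / 2)"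
    by (intro sum.cong) (auto simp: algebra_simps)
  also have "\<dots> = (indicator {t<..\<tau> l} u * ((\<kappa> n (\<tau> l) (\<tau> (Suc l)) - \<kappa> n (\<tau> l) (\<tau> l)) - (\<kappa> n u (\<tau> (Suc l)) - \<kappa> n u (\<tau> l))) +
      indicator {t<..\<tau> (Suc l)} u * ((\<kappa> n (\<tau> (Suc l)) (\<tau> (Suc l)) - \<kappa> n (\<tau> (Suc l)) (\<tau> l)) -
        (\<kappa> n u (\<tau> (Suc l)) - \<kappa> n u (\<tau> l)))) / 2"
    unfolding sum_divide_distrib[symmetric] sum.distrib sum_distrib_left[symmetric] * ..
  finally show "(\<Sum>j\<le>n. ((\<Phi> j (\<tau> l) - \<Phi> j u) * indicator {t<..\<tau> l} u + (\<Phi> j (\<tau> (Suc l)) - \<Phi> j u) * indicator {t<..\<tau> (Suc l)} u) / 2 *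
        (\<Phi> j (\<tau> (Suc l)) - \<Phi> j (\<tau> l))) = \<dots>" .
qed

text \<open>In the limit each cell contributes half the increment of \<open>max s\<close> between
  its nodes. These increments telescope to \<open>(T - s) / 2\<close>, the limit of
  \<open>c23 n\<close>, so this contraction error vanishes for every partition and not only for
  small mesh.\<close>

lemma trap23_tendsto: "(\<lambda>n. \<integral>s. ((\<Sum>j\<le>n. D23 j s) - c23 n s)\<^sup>2 \<partial>U) \<longlonglongrightarrow> (\<integral>s. 0\<^sup>2 \<partial>U)"
proof (rule integral_square_tendsto[where K = "real N * (4 * L) + 2 * L"])
  show "nice (\<lambda>s. (\<Sum>j\<le>n. D23 j s) - c23 n s)" for n by (intro nice_diff nice_sum nice_D nice_c)
  show "nice (\<lambda>_. 0)" by (rule nice_const)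
  show "\<bar>(\<Sum>j\<le>n. D23 j s) - c23 n s\<bar> \<le> real N * (4 * L) + 2 * L" if s: "s \<in> {t..T}" for n s
  proof -
    have "\<bar>\<Sum>j\<le>n. D23 j s\<bar> \<le> (\<Sum>l<N. 4 * L)"
      unfolding sum_D23
    proof (rule order_trans[OF sum_abs sum_mono])
      fix l assume "l \<in> {..<N}"
      then have l: "\<tau> l \<in> {t..T}" "\<tau> (Suc l) \<in> {t..T}" using tau_in by auto
      have le: "\<bar>\<kappa> n a b\<bar> \<le> L" if "a \<in> {t..T}" "b \<in> {t..T}" for a b
        unfolding \<kappa>_def by (rule sum_Phi_Phi_le[OF that])
      have one: "\<bar>w * ((x - y) - (z - x'))\<bar> \<le> 4 * K"
        if "w = 0 \<or> w = 1" "\<bar>x\<bar> \<le> K" "\<bar>y\<bar> \<le> K" "\<bar>z\<bar> \<le> K" "\<bar>x'\<bar> \<le> K" for w x y z x' K :: real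
        using that by auto
      have two: "\<bar>(x + y) / 2\<bar> \<le> K" if "\<bar>x\<bar> \<le> K" "\<bar>y\<bar> \<le> K" for x y K :: real
        using that by (auto simp: abs_le_iff)
      show "\<bar>(indicator {t<..\<tau> l} s * ((\<kappa> n (\<tau> l) (\<tau> (Suc l)) - \<kappa> n (\<tau> l) (\<tau> l)) - (\<kappa> n s (\<tau> (Suc l)) - \<kappa> n s (\<tau> l))) +
        indicator {t<..\<tau> (Suc l)} s * ((\<kappa> n (\<tau> (Suc l)) (\<tau> (Suc l)) - \<kappa> n (\<tau> (Suc l)) (\<tau> l)) -
        (\<kappa> n s (\<tau> (Suc l)) - \<kappa> n s (\<tau> l)))) / 2\<bar> \<le> 4 * L"
        by (intro two one le l s) (auto simp: indicator_def)
    qed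
    then show ?thesis using c_le(3)[OF s, of n] by (simp add: abs_le_iff)
  qed
  show "(\<lambda>n. (\<Sum>j\<le>n. D23 j s) - c23 n s) \<longlonglongrightarrow> 0" if s: "t < s" "s \<le> T" for s
  proof -
    from s have s': "s \<in> {t..T}" by simp
    have k: "(\<lambda>n. \<kappa> n a b) \<longlonglongrightarrow> min a b - t" if "a \<in> {t..T}" "b \<in> {t..T}" for a b
      unfolding \<kappa>_def by (rule parseval_polarized[OF that])
    let ?m = "\<lambda>a b. min a b - t"
    have "(\<lambda>n. (\<Sum>j\<le>n. D23 j s) - c23 n s) \<longlonglongrightarrow> (\<Sum>l<N.
     (indicator {t<..\<tau> l} s * ((?m (\<tau> l) (\<tau> (Suc l)) - ?m (\<tau> l) (\<tau> l)) - (?m s (\<tau> (Suc l)) - ?m s (\<tau> l))) +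
      indicator {t<..\<tau> (Suc l)} s * ((?m (\<tau> (Suc l)) (\<tau> (Suc l)) - ?m (\<tau> (Suc l)) (\<tau> l)) -
        (?m s (\<tau> (Suc l)) - ?m s (\<tau> l)))) / 2) - (T - s) / 2"
      unfolding sum_D23 using tau_in by (intro tendsto_intros c_tendsto k s') auto
    moreover have "(\<Sum>l<N. (indicator {t<..\<tau> l} s * ((?m (\<tau> l) (\<tau> (Suc l)) - ?m (\<tau> l) (\<tau> l)) - (?m s (\<tau> (Suc l)) - ?m s (\<tau> l))) +
      indicator {t<..\<tau> (Suc l)} s * ((?m (\<tau> (Suc l)) (\<tau> (Suc l)) - ?m (\<tau> (Suc l)) (\<tau> l)) -
        (?m s (\<tau> (Suc l)) - ?m s (\<tau> l)))) / 2) = (\<Sum>l<N. max s (\<tau> (Suc l)) / 2 - max s (\<tau> l) / 2)"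
    proof (rule sum.cong[OF refl])
      fix l assume "l \<in> {..<N}"
      then show "(indicator {t<..\<tau> l} s * ((?m (\<tau> l) (\<tau> (Suc l)) - ?m (\<tau> l) (\<tau> l)) - (?m s (\<tau> (Suc l)) - ?m s (\<tau> l))) +
        indicator {t<..\<tau> (Suc l)} s * ((?m (\<tau> (Suc l)) (\<tau> (Suc l)) - ?m (\<tau> (Suc l)) (\<tau> l)) -
        (?m s (\<tau> (Suc l)) - ?m s (\<tau> l)))) / 2 = max s (\<tau> (Suc l)) / 2 - max s (\<tau> l) / 2"
        using is_partition_mono[OF part, of l "Suc l"] s
        by (auto simp: indicator_def min_def max_def field_simps)
    qed
    moreover have "(\<Sum>l<N. max s (\<tau> (Suc l)) / 2 - max s (\<tau> l) / 2) = max s (\<tau> N) / 2 - max s (\<tau> 0) / 2"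
      by (rule sum_lessThan_telescope)
    moreover have "max s (\<tau> N) / 2 - max s (\<tau> 0) / 2 = (T - s) / 2"
      using part s by (simp add: is_partition_def max_def diff_divide_distrib)
    ultimately show ?thesis by (simp only: diff_self)
  qed
qed

text \<open>For fixed \<open>n\<close> the contraction errors come with no estimate in terms of the
  mesh; only their limits as \<open>n\<close> grows do. The statement therefore supplies bounds
  \<open>b n\<close> whose limit is small, which is just what a Fatou argument consumes.\<close>

lemma tensor_bound3_trapezoid:
  "\<exists>b B. b \<longlonglongrightarrow> B \<and> B \<le> 6 * (\<delta> * L * L) + 6 * (\<delta>\<^sup>2 * L) \<and>
    (\<forall>n. tensor_bound3 n (\<lambda>j1 j2 j3. C_trap \<tau> N j1 j2 j3 - C j1 j2 j3) \<le> b n)"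
proof -
  let ?e1 = "\<lambda>n. \<integral>s. (\<Sum>j\<le>n. D12 j j s)\<^sup>2 \<partial>U"
  let ?e2 = "\<lambda>n. \<integral>s. ((\<Sum>j\<le>n. D13 j s) - c13 n s)\<^sup>2 \<partial>U"
  let ?e3 = "\<lambda>n. \<integral>s. ((\<Sum>j\<le>n. D23 j s) - c23 n s)\<^sup>2 \<partial>U"
  obtain B1 where B1: "?e1 \<longlonglongrightarrow> B1" "B1 \<le> \<delta>\<^sup>2 * L" using trap12_tendsto trap12_limit_le by blast
  obtain B2 where B2: "?e2 \<longlonglongrightarrow> B2" "B2 \<le> \<delta>\<^sup>2 * L" using trap13_tendsto trap13_limit_le by blast
  have B3: "?e3 \<longlonglongrightarrow> 0" using trap23_tendsto by simp
  show ?thesis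
  proof (intro exI conjI allI)
    show "(\<lambda>n. 6 * (\<delta> * L * L) + 3 * (?e1 n + ?e2 n + ?e3 n)) \<longlonglongrightarrow> 6 * (\<delta> * L * L) + 3 * (B1 + B2 + 0)"
      by (intro tendsto_intros B1 B2 B3)
    show "6 * (\<delta> * L * L) + 3 * (B1 + B2 + 0) \<le> 6 * (\<delta> * L * L) + 6 * (\<delta>\<^sup>2 * L)" using B1 B2 by simp
    show "tensor_bound3 n (\<lambda>j1 j2 j3. C_trap \<tau> N j1 j2 j3 - C j1 j2 j3) \<le> 6 * (\<delta> * L * L) + 3 * (?e1 n + ?e2 n + ?e3 n)" for n
      unfolding tensor_bound3_def contract12_trap contract13_trap contract23_trap
      by (intro add_mono mult_left_mono sum_C_trap_diff_square_le bessel nice_sum nice_diff nice_D nice_c) auto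
  qed
qed

end

end

subsection \<open>The pairings of a squared cubic form\<close>

lemma sum_if_const: "(\<Sum>x\<in>A. if P then g x else 0) = (if P then \<Sum>x\<in>A. g x else (0::real))"
  by simp

text \<open>Keeping the pairing condition inside six full sums lets the Kronecker deltas be
  collapsed by rewriting once a concrete \<open>P\<close> is inserted.\<close>

definition sum6 :: "nat \<Rightarrow> (nat \<Rightarrow> nat \<Rightarrow> nat \<Rightarrow> real) \<Rightarrow> (nat \<Rightarrow> nat \<Rightarrow> nat \<Rightarrow> nat \<Rightarrow> nat \<Rightarrow> nat \<Rightarrow> bool) \<Rightarrow> real" where
  "sum6 n h P = (\<Sum>a\<le>n. \<Sum>b\<le>n. \<Sum>c\<le>n. \<Sum>d\<le>n. \<Sum>e\<le>n. \<Sum>f\<le>n. if P a b c d e f then h a b c * h d e f else 0)"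

context
  fixes n :: nat and h :: "nat \<Rightarrow> nat \<Rightarrow> nat \<Rightarrow> real"
begin

abbreviation "h12 k \<equiv> \<Sum>j\<le>n. h j j k"
abbreviation "h13 k \<equiv> \<Sum>j\<le>n. h j k j"
abbreviation "h23 k \<equiv> \<Sum>j\<le>n. h k j j"
abbreviation "hnorm \<equiv> \<Sum>a\<le>n. \<Sum>b\<le>n. \<Sum>c\<le>n. (h a b c)\<^sup>2"

lemma if_conj3: "(if P \<and> Q \<and> R then x else 0) = (if P then if Q then if R then x else 0 else 0 else (0::real))"
  by simp

lemmas collapse = sum6_def if_conj3 sum_if_const sum.delta sum.delta' sum_product

text \<open>Of the fifteen pairings, nine join two indices within each copy of \<open>h\<close>;
  each is an inner product of two contractions.\<close>

lemma pairings_contract: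
  "sum6 n h (\<lambda>a b c d e f. a = b \<and> c = d \<and> e = f) = (\<Sum>k\<le>n. h12 k * h23 k)"
  "sum6 n h (\<lambda>a b c d e f. a = b \<and> c = e \<and> d = f) = (\<Sum>k\<le>n. h12 k * h13 k)"
  "sum6 n h (\<lambda>a b c d e f. a = b \<and> c = f \<and> d = e) = (\<Sum>k\<le>n. h12 k * h12 k)"
  "sum6 n h (\<lambda>a b c d e f. a = c \<and> b = d \<and> e = f) = (\<Sum>k\<le>n. h13 k * h23 k)"
  "sum6 n h (\<lambda>a b c d e f. a = c \<and> b = e \<and> d = f) = (\<Sum>k\<le>n. h13 k * h13 k)"
  "sum6 n h (\<lambda>a b c d e f. a = c \<and> b = f \<and> d = e) = (\<Sum>k\<le>n. h13 k * h12 k)"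
  "sum6 n h (\<lambda>a b c d e f. a = d \<and> b = c \<and> e = f) = (\<Sum>k\<le>n. h23 k * h23 k)"
  "sum6 n h (\<lambda>a b c d e f. a = e \<and> b = c \<and> d = f) = (\<Sum>k\<le>n. h23 k * h13 k)"
  "sum6 n h (\<lambda>a b c d e f. a = f \<and> b = c \<and> d = e) = (\<Sum>k\<le>n. h23 k * h12 k)"
  by (simp_all add: collapse) (rule sum.swap)+

text \<open>The remaining six pairings match the indices of one copy with those of the other, one
  for each permutation.\<close>

lemma pairings_full:
  "sum6 n h (\<lambda>a b c d e f. a = d \<and> b = e \<and> c = f) = (\<Sum>a\<le>n. \<Sum>b\<le>n. \<Sum>c\<le>n. h a b c * h a b c)"
  "sum6 n h (\<lambda>a b c d e f. a = d \<and> b = f \<and> c = e) = (\<Sum>a\<le>n. \<Sum>b\<le>n. \<Sum>c\<le>n. h a b c * h a c b)"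
  "sum6 n h (\<lambda>a b c d e f. a = e \<and> b = d \<and> c = f) = (\<Sum>a\<le>n. \<Sum>b\<le>n. \<Sum>c\<le>n. h a b c * h b a c)"
  "sum6 n h (\<lambda>a b c d e f. a = e \<and> b = f \<and> c = d) = (\<Sum>a\<le>n. \<Sum>b\<le>n. \<Sum>c\<le>n. h a b c * h c a b)"
  "sum6 n h (\<lambda>a b c d e f. a = f \<and> b = d \<and> c = e) = (\<Sum>a\<le>n. \<Sum>b\<le>n. \<Sum>c\<le>n. h a b c * h b c a)"
  "sum6 n h (\<lambda>a b c d e f. a = f \<and> b = e \<and> c = d) = (\<Sum>a\<le>n. \<Sum>b\<le>n. \<Sum>c\<le>n. h a b c * h c b a)"
  by (simp_all add: collapse)

lemma hnorm_perm:
  "(\<Sum>a\<le>n. \<Sum>b\<le>n. \<Sum>c\<le>n. (h a c b)\<^sup>2) = hnorm"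
  "(\<Sum>a\<le>n. \<Sum>b\<le>n. \<Sum>c\<le>n. (h b a c)\<^sup>2) = hnorm"
  "(\<Sum>a\<le>n. \<Sum>b\<le>n. \<Sum>c\<le>n. (h c a b)\<^sup>2) = hnorm"
  "(\<Sum>a\<le>n. \<Sum>b\<le>n. \<Sum>c\<le>n. (h b c a)\<^sup>2) = hnorm"
  "(\<Sum>a\<le>n. \<Sum>b\<le>n. \<Sum>c\<le>n. (h c b a)\<^sup>2) = hnorm"
proof -
  have s23: "(\<Sum>a\<le>n. \<Sum>b\<le>n. \<Sum>c\<le>n. g a c b) = (\<Sum>a\<le>n. \<Sum>b\<le>n. \<Sum>c\<le>n. g a b c)" for g :: "nat \<Rightarrow> nat \<Rightarrow> nat \<Rightarrow> real"
    by (rule sum.cong[OF refl]) (rule sum.swap)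
  have s12: "(\<Sum>a\<le>n. \<Sum>b\<le>n. \<Sum>c\<le>n. g b a c) = (\<Sum>a\<le>n. \<Sum>b\<le>n. \<Sum>c\<le>n. g a b c)" for g :: "nat \<Rightarrow> nat \<Rightarrow> nat \<Rightarrow> real"
    by (rule sum.swap)
  show "(\<Sum>a\<le>n. \<Sum>b\<le>n. \<Sum>c\<le>n. (h a c b)\<^sup>2) = hnorm" by (rule s23)
  show 12: "(\<Sum>a\<le>n. \<Sum>b\<le>n. \<Sum>c\<le>n. (h b a c)\<^sup>2) = hnorm" by (rule s12)
  show 3: "(\<Sum>a\<le>n. \<Sum>b\<le>n. \<Sum>c\<le>n. (h c a b)\<^sup>2) = hnorm"
    using s23[of "\<lambda>a b c. (h b a c)\<^sup>2"] 12 by simp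
  show "(\<Sum>a\<le>n. \<Sum>b\<le>n. \<Sum>c\<le>n. (h b c a)\<^sup>2) = hnorm"
    using s12[of "\<lambda>a b c. (h a c b)\<^sup>2"] s23[of "\<lambda>a b c. (h a b c)\<^sup>2"] by simp
  show "(\<Sum>a\<le>n. \<Sum>b\<le>n. \<Sum>c\<le>n. (h c b a)\<^sup>2) = hnorm"
    using s12[of "\<lambda>a b c. (h c a b)\<^sup>2"] 3 by simp
qed

lemma abs_sum3_product_le:
  fixes x y :: "nat \<Rightarrow> nat \<Rightarrow> nat \<Rightarrow> real"
  shows "\<bar>\<Sum>a\<le>n. \<Sum>b\<le>n. \<Sum>c\<le>n. x a b c * y a b c\<bar> \<le>
    ((\<Sum>a\<le>n. \<Sum>b\<le>n. \<Sum>c\<le>n. (x a b c)\<^sup>2) + (\<Sum>a\<le>n. \<Sum>b\<le>n. \<Sum>c\<le>n. (y a b c)\<^sup>2)) / 2"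
  using abs_sum_product_le[of "\<lambda>(a, b, c). x a b c" "\<lambda>(a, b, c). y a b c" "{..n} \<times> {..n} \<times> {..n}"]
  by (simp add: sum.cartesian_product case_prod_unfold)

text \<open>Coincidences of the component indices only multiply each pairing by 0 or 1. Bounding
  every pairing in absolute value therefore gives one estimate for all choices of \<open>i1\<close>,
  \<open>i2\<close>, \<open>i3\<close>.\<close>

lemma wick_sum6_le:
  fixes i1 i2 i3 :: nat
  defines "D \<equiv> \<lambda>(i::nat) (a::nat) (j::nat) (b::nat). of_bool (i = j) * of_bool (a = b) :: real"
  shows "(\<Sum>a\<le>n. \<Sum>b\<le>n. \<Sum>c\<le>n. \<Sum>d\<le>n. \<Sum>e\<le>n. \<Sum>f\<le>n. h a b c * h d e f * (
      D i1 a i2 b * (D i3 c i1 d * D i2 e i3 f + D i3 c i2 e * D i1 d i3 f + D i3 c i3 f * D i1 d i2 e) +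
      D i1 a i3 c * (D i2 b i1 d * D i2 e i3 f + D i2 b i2 e * D i1 d i3 f + D i2 b i3 f * D i1 d i2 e) +
      D i1 a i1 d * (D i2 b i3 c * D i2 e i3 f + D i2 b i2 e * D i3 c i3 f + D i2 b i3 f * D i3 c i2 e) +
      D i1 a i2 e * (D i2 b i3 c * D i1 d i3 f + D i2 b i1 d * D i3 c i3 f + D i2 b i3 f * D i3 c i1 d) +
      D i1 a i3 f * (D i2 b i3 c * D i1 d i2 e + D i2 b i1 d * D i3 c i2 e + D i2 b i2 e * D i3 c i1 d))) \<le> tensor_bound3 n h" (is "?lhs \<le> _")
proof -
  define N12 N13 N23 where "N12 = (\<Sum>k\<le>n. (h12 k)\<^sup>2)" and "N13 = (\<Sum>k\<le>n. (h13 k)\<^sup>2)" and "N23 = (\<Sum>k\<le>n. (h23 k)\<^sup>2)"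
  have conj: "(if P \<and> Q \<and> R then x else 0) = of_bool P * of_bool Q * of_bool R * (x::real)" for P Q R x
    by simp
  have "?lhs = (\<Sum>a\<le>n. \<Sum>b\<le>n. \<Sum>c\<le>n. \<Sum>d\<le>n. \<Sum>e\<le>n. \<Sum>f\<le>n.
      (of_bool (i1 = i2) * of_bool (i3 = i1) * of_bool (i2 = i3)) * (if a = b \<and> c = d \<and> e = f then h a b c * h d e f else 0) +
      (of_bool (i1 = i2) * of_bool (i3 = i2) * of_bool (i1 = i3)) * (if a = b \<and> c = e \<and> d = f then h a b c * h d e f else 0) +
      (of_bool (i1 = i2) * of_bool (i3 = i3) * of_bool (i1 = i2)) * (if a = b \<and> c = f \<and> d = e then h a b c * h d e f else 0) +
      (of_bool (i1 = i3) * of_bool (i2 = i1) * of_bool (i2 = i3)) * (if a = c \<and> b = d \<and> e = f then h a b c * h d e f else 0) +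
      (of_bool (i1 = i3) * of_bool (i2 = i2) * of_bool (i1 = i3)) * (if a = c \<and> b = e \<and> d = f then h a b c * h d e f else 0) +
      (of_bool (i1 = i3) * of_bool (i2 = i3) * of_bool (i1 = i2)) * (if a = c \<and> b = f \<and> d = e then h a b c * h d e f else 0) +
      (of_bool (i1 = i1) * of_bool (i2 = i3) * of_bool (i2 = i3)) * (if a = d \<and> b = c \<and> e = f then h a b c * h d e f else 0) +
      (of_bool (i1 = i1) * of_bool (i2 = i2) * of_bool (i3 = i3)) * (if a = d \<and> b = e \<and> c = f then h a b c * h d e f else 0) +
      (of_bool (i1 = i1) * of_bool (i2 = i3) * of_bool (i3 = i2)) * (if a = d \<and> b = f \<and> c = e then h a b c * h d e f else 0) +
      (of_bool (i1 = i2) * of_bool (i2 = i3) * of_bool (i1 = i3)) * (if a = e \<and> b = c \<and> d = f then h a b c * h d e f else 0) +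
      (of_bool (i1 = i2) * of_bool (i2 = i1) * of_bool (i3 = i3)) * (if a = e \<and> b = d \<and> c = f then h a b c * h d e f else 0) +
      (of_bool (i1 = i2) * of_bool (i2 = i3) * of_bool (i3 = i1)) * (if a = e \<and> b = f \<and> c = d then h a b c * h d e f else 0) +
      (of_bool (i1 = i3) * of_bool (i2 = i3) * of_bool (i1 = i2)) * (if a = f \<and> b = c \<and> d = e then h a b c * h d e f else 0) +
      (of_bool (i1 = i3) * of_bool (i2 = i1) * of_bool (i3 = i2)) * (if a = f \<and> b = d \<and> c = e then h a b c * h d e f else 0) +
      (of_bool (i1 = i3) * of_bool (i2 = i2) * of_bool (i3 = i1)) * (if a = f \<and> b = e \<and> c = d then h a b c * h d e f else 0))"
    unfolding D_def conj by (intro sum.cong refl) (simp only: distrib_left distrib_right mult_ac add_ac)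
  also have "\<dots> = (of_bool (i1 = i2) * of_bool (i3 = i1) * of_bool (i2 = i3)) * sum6 n h (\<lambda>a b c d e f. a = b \<and> c = d \<and> e = f) +
      (of_bool (i1 = i2) * of_bool (i3 = i2) * of_bool (i1 = i3)) * sum6 n h (\<lambda>a b c d e f. a = b \<and> c = e \<and> d = f) +
      (of_bool (i1 = i2) * of_bool (i3 = i3) * of_bool (i1 = i2)) * sum6 n h (\<lambda>a b c d e f. a = b \<and> c = f \<and> d = e) +
      (of_bool (i1 = i3) * of_bool (i2 = i1) * of_bool (i2 = i3)) * sum6 n h (\<lambda>a b c d e f. a = c \<and> b = d \<and> e = f) +
      (of_bool (i1 = i3) * of_bool (i2 = i2) * of_bool (i1 = i3)) * sum6 n h (\<lambda>a b c d e f. a = c \<and> b = e \<and> d = f) +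
      (of_bool (i1 = i3) * of_bool (i2 = i3) * of_bool (i1 = i2)) * sum6 n h (\<lambda>a b c d e f. a = c \<and> b = f \<and> d = e) +
      (of_bool (i1 = i1) * of_bool (i2 = i3) * of_bool (i2 = i3)) * sum6 n h (\<lambda>a b c d e f. a = d \<and> b = c \<and> e = f) +
      (of_bool (i1 = i1) * of_bool (i2 = i2) * of_bool (i3 = i3)) * sum6 n h (\<lambda>a b c d e f. a = d \<and> b = e \<and> c = f) +
      (of_bool (i1 = i1) * of_bool (i2 = i3) * of_bool (i3 = i2)) * sum6 n h (\<lambda>a b c d e f. a = d \<and> b = f \<and> c = e) +
      (of_bool (i1 = i2) * of_bool (i2 = i3) * of_bool (i1 = i3)) * sum6 n h (\<lambda>a b c d e f. a = e \<and> b = c \<and> d = f) +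
      (of_bool (i1 = i2) * of_bool (i2 = i1) * of_bool (i3 = i3)) * sum6 n h (\<lambda>a b c d e f. a = e \<and> b = d \<and> c = f) +
      (of_bool (i1 = i2) * of_bool (i2 = i3) * of_bool (i3 = i1)) * sum6 n h (\<lambda>a b c d e f. a = e \<and> b = f \<and> c = d) +
      (of_bool (i1 = i3) * of_bool (i2 = i3) * of_bool (i1 = i2)) * sum6 n h (\<lambda>a b c d e f. a = f \<and> b = c \<and> d = e) +
      (of_bool (i1 = i3) * of_bool (i2 = i1) * of_bool (i3 = i2)) * sum6 n h (\<lambda>a b c d e f. a = f \<and> b = d \<and> c = e) +
      (of_bool (i1 = i3) * of_bool (i2 = i2) * of_bool (i3 = i1)) * sum6 n h (\<lambda>a b c d e f. a = f \<and> b = e \<and> c = d)"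
    unfolding sum6_def by (simp only: sum.distrib sum_distrib_left)
  \<comment> \<open>Inner products are bounded by means of squared norms. The six cross pairings
    give 6 times \<open>hnorm\<close>; among the nine others each of \<open>N12\<close>,
    \<open>N13\<close>, \<open>N23\<close> occurs six times with weight one half, giving the factor
    3.\<close>
  also have "\<dots> \<le> (N12 + N23) / 2 + (N12 + N13) / 2 + (N12 + N12) / 2 + (N13 + N23) / 2 + (N13 + N13) / 2 + (N13 + N12) / 2 + (N23 + N23) / 2 + hnorm + hnorm + (N23 + N13) / 2 + hnorm + hnorm + (N23 + N12) / 2 + hnorm + hnorm"
  proof -
    have w: "(of_bool P * of_bool Q * of_bool R) * S \<le> K" if "\<bar>S\<bar> \<le> K" for P Q R and S K :: real
      using that by (cases P; cases Q; cases R) auto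
    have le: "\<bar>\<Sum>k\<le>n. h12 k * h23 k\<bar> \<le> (N12 + N23) / 2" "\<bar>\<Sum>k\<le>n. h12 k * h13 k\<bar> \<le> (N12 + N13) / 2"
      "\<bar>\<Sum>k\<le>n. h12 k * h12 k\<bar> \<le> (N12 + N12) / 2" "\<bar>\<Sum>k\<le>n. h13 k * h23 k\<bar> \<le> (N13 + N23) / 2"
      "\<bar>\<Sum>k\<le>n. h13 k * h13 k\<bar> \<le> (N13 + N13) / 2" "\<bar>\<Sum>k\<le>n. h13 k * h12 k\<bar> \<le> (N13 + N12) / 2"
      "\<bar>\<Sum>k\<le>n. h23 k * h23 k\<bar> \<le> (N23 + N23) / 2" "\<bar>\<Sum>k\<le>n. h23 k * h13 k\<bar> \<le> (N23 + N13) / 2"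
      "\<bar>\<Sum>k\<le>n. h23 k * h12 k\<bar> \<le> (N23 + N12) / 2"
      unfolding N12_def N13_def N23_def by (rule abs_sum_product_le)+
    have le3: "\<bar>\<Sum>a\<le>n. \<Sum>b\<le>n. \<Sum>c\<le>n. h a b c * g a b c\<bar> \<le> hnorm"
      if "(\<Sum>a\<le>n. \<Sum>b\<le>n. \<Sum>c\<le>n. (g a b c)\<^sup>2) = hnorm" for g
      using abs_sum3_product_le[of h g] that by simp
    show ?thesis
      unfolding pairings_contract pairings_full
      by (intro add_mono w le le3 hnorm_perm refl)
  qed
  also have "\<dots> = tensor_bound3 n h"
    unfolding tensor_bound3_def N12_def[symmetric] N13_def[symmetric] N23_def[symmetric] by (simp add: field_simps)
  finally show ?thesis .
qed

end

lemma wick_sum4_le: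
  fixes i1 i2 :: nat and h :: "nat \<Rightarrow> nat \<Rightarrow> real"
  defines "D \<equiv> \<lambda>(i::nat) (a::nat) (j::nat) (b::nat). of_bool (i = j) * of_bool (a = b) :: real"
  shows "(\<Sum>a\<le>n. \<Sum>b\<le>n. \<Sum>c\<le>n. \<Sum>d\<le>n. h a b * h c d * (
      D i1 a i2 b * D i1 c i2 d + D i1 a i1 c * D i2 b i2 d + D i1 a i2 d * D i2 b i1 c)) \<le> tensor_bound2 n h" (is "?lhs \<le> _")
proof -
  let ?s = "\<lambda>P. \<Sum>a\<le>n. \<Sum>b\<le>n. \<Sum>c\<le>n. \<Sum>d\<le>n. if P a b c d then h a b * h c d else 0"
  have conj: "(if P \<and> Q then x else 0) = of_bool P * of_bool Q * (x::real)" for P Q x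
    by simp
  have if_conj2: "(if P \<and> Q then x else 0) = (if P then if Q then x else 0 else (0::real))" for P Q x
    by simp
  have "?lhs = (of_bool (i1 = i2) * of_bool (i1 = i2)) * ?s (\<lambda>a b c d. a = b \<and> c = d) +
      (of_bool (i1 = i1) * of_bool (i2 = i2)) * ?s (\<lambda>a b c d. a = c \<and> b = d) +
      (of_bool (i1 = i2) * of_bool (i2 = i1)) * ?s (\<lambda>a b c d. a = d \<and> b = c)"
    unfolding D_def conj sum_distrib_left sum.distrib[symmetric]
    by (intro sum.cong refl) (simp only: distrib_left distrib_right mult_ac add_ac)
  also have "\<dots> \<le> (\<Sum>j\<le>n. h j j)\<^sup>2 + (\<Sum>a\<le>n. \<Sum>b\<le>n. (h a b)\<^sup>2) + (\<Sum>a\<le>n. \<Sum>b\<le>n. (h a b)\<^sup>2)"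
  proof -
    have w: "(of_bool P * of_bool Q) * S \<le> K" if "\<bar>S\<bar> \<le> K" for P Q and S K :: real
      using that by (cases P; cases Q) auto
    have 1: "?s (\<lambda>a b c d. a = b \<and> c = d) = (\<Sum>j\<le>n. h j j)\<^sup>2"
      by (simp add: if_conj2 sum_if_const sum.delta sum.delta' power2_eq_square sum_product)
    have 2: "?s (\<lambda>a b c d. a = c \<and> b = d) = (\<Sum>a\<le>n. \<Sum>b\<le>n. h a b * h a b)"
      by (simp add: if_conj2 sum_if_const sum.delta sum.delta')
    have 3: "?s (\<lambda>a b c d. a = d \<and> b = c) = (\<Sum>a\<le>n. \<Sum>b\<le>n. h a b * h b a)"
      by (simp add: if_conj2 sum_if_const sum.delta sum.delta')
    have "\<bar>\<Sum>a\<le>n. \<Sum>b\<le>n. h a b * h b a\<bar> \<le> ((\<Sum>a\<le>n. \<Sum>b\<le>n. (h a b)\<^sup>2) + (\<Sum>a\<le>n. \<Sum>b\<le>n. (h b a)\<^sup>2)) / 2"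
      using abs_sum_product_le[of "\<lambda>(a, b). h a b" "\<lambda>(a, b). h b a" "{..n} \<times> {..n}"]
      by (simp add: sum.cartesian_product case_prod_unfold)
    moreover have "(\<Sum>a\<le>n. \<Sum>b\<le>n. (h b a)\<^sup>2) = (\<Sum>a\<le>n. \<Sum>b\<le>n. (h a b)\<^sup>2)" by (rule sum.swap)
    ultimately have 4: "\<bar>\<Sum>a\<le>n. \<Sum>b\<le>n. h a b * h b a\<bar> \<le> (\<Sum>a\<le>n. \<Sum>b\<le>n. (h a b)\<^sup>2)" by simp
    have 5: "\<bar>\<Sum>a\<le>n. \<Sum>b\<le>n. h a b * h a b\<bar> \<le> (\<Sum>a\<le>n. \<Sum>b\<le>n. (h a b)\<^sup>2)"
      by (simp add: power2_eq_square sum_nonneg)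
    show ?thesis
      unfolding 1 2 3 by (intro add_mono w 4 5) simp
  qed
  also have "\<dots> = tensor_bound2 n h" by (simp add: tensor_bound2_def)
  finally show ?thesis .
qed

subsection \<open>Integrals of deterministic functions\<close>

lemma (in orthonormal_basis) riemann_step_tendsto:
  fixes g :: "real \<Rightarrow> real"
  assumes g: "continuous_on {t..T} g" and s: "t < s" "s \<le> T"
  shows "(\<lambda>q. \<Sum>k<Suc q. g (unif_part t T q k) * cell (unif_part t T q) k s) \<longlonglongrightarrow> g s"
proof -
  note part = is_partition_uniform[OF t_less_T]
  have "\<exists>k<Suc q. unif_part t T q k < s \<and> s \<le> unif_part t T q (Suc k)" for q
    by (rule is_partition_cell[OF part s]) blast
  then obtain k where k: "\<And>q. k q < Suc q" "\<And>q. unif_part t T q (k q) < s"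
      "\<And>q. s \<le> unif_part t T q (Suc (k q))" by metis
  define x where "x q = unif_part t T q (k q)" for q
  have x: "x q \<in> {t..T}" for q
    unfolding x_def using is_partition_bounds[OF part, of "k q" q] k(1)[of q] by auto
  have "(\<lambda>q. s - (T - t) / real (Suc q)) \<longlonglongrightarrow> s - 0"
    by (intro tendsto_diff tendsto_const uniform_mesh_tendsto_0)
  moreover have "s - (T - t) / real (Suc q) \<le> x q" "x q \<le> s" for q
    using k(2,3)[of q] unif_part_step[of t T q "k q"] by (auto simp: x_def)
  ultimately have "x \<longlonglongrightarrow> s"
    by (intro tendsto_sandwich[of "\<lambda>q. s - (T - t) / real (Suc q)" x _ "\<lambda>_. s"]) (auto intro: always_eventually)
  then have "(\<lambda>q. g (x q)) \<longlonglongrightarrow> g s"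
    using g x s by (auto simp: continuous_on_sequentially comp_def)
  moreover have "(\<Sum>k<Suc q. g (unif_part t T q k) * cell (unif_part t T q) k s) = g (x q)" for q
    unfolding x_def by (rule sum_cells[OF part k])
  ultimately show ?thesis by (simp del: sum.lessThan_Suc)
qed

lemma (in orthonormal_basis) riemann_step_bound:
  fixes g :: "real \<Rightarrow> real"
  assumes K: "\<And>u. u \<in> {t..T} \<Longrightarrow> \<bar>g u\<bar> \<le> K" and s: "s \<in> {t..T}"
  shows "\<bar>\<Sum>k<Suc q. g (unif_part t T q k) * cell (unif_part t T q) k s\<bar> \<le> K"
proof (cases "s = t")
  case True
  have "0 \<le> K" using K[OF t_in] by linarith
  then show ?thesis unfolding True step_at_start[OF is_partition_uniform[OF t_less_T]] by simp
next
  case False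
  note part = is_partition_uniform[OF t_less_T, of q]
  obtain k where k: "k < Suc q" "unif_part t T q k < s" "s \<le> unif_part t T q (Suc k)"
    using is_partition_cell[OF part, of s] s False by auto
  have "unif_part t T q k \<in> {t..T}"
    using is_partition_bounds[OF part, of k] k by auto
  then show ?thesis unfolding sum_cells[OF part k] by (rule K)
qed

lemma (in orthonormal_basis) riemann_tendsto:
  fixes g :: "real \<Rightarrow> real"
  assumes g: "continuous_on {t..T} g"
  shows "(\<lambda>q. (T - t) / real (Suc q) * (\<Sum>k<Suc q. g (unif_part t T q k))) \<longlonglongrightarrow> (\<integral>s. g s \<partial>U)"
proof -
  let ?h = "\<lambda>q s. \<Sum>k<Suc q. g (unif_part t T q k) * cell (unif_part t T q) k s"
  obtain K where K: "\<And>u. u \<in> {t..T} \<Longrightarrow> \<bar>g u\<bar> \<le> K"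
    using nice_continuous[OF g] unfolding nice_def by metis
  have nh: "nice (?h q)" for q by (intro nice_rules; simp)
  have "(\<lambda>q. \<integral>s. ?h q s \<partial>U) \<longlonglongrightarrow> (\<integral>s. g s \<partial>U)"
  proof (rule integral_dominated_convergence[where w = "\<lambda>_. K"])
    show "g \<in> borel_measurable U" using nice_continuous[OF g] by (simp add: nice_def)
    show "?h q \<in> borel_measurable U" for q using nh unfolding nice_def by blast
    show "integrable U (\<lambda>_. K)" by (intro nice_integrable nice_const)
    show "AE s in U. (\<lambda>q. ?h q s) \<longlonglongrightarrow> g s"
      using AE_U by eventually_elim (rule riemann_step_tendsto[OF g], auto)
    show "AE s in U. norm (?h q s) \<le> K" for q
      using AE_U
    proof eventually_elim
      case (elim s)
      then show ?case unfolding real_norm_def by (intro riemann_step_bound K) auto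
    qed
  qed
  moreover have "(\<integral>s. ?h q s \<partial>U) = (T - t) / real (Suc q) * (\<Sum>k<Suc q. g (unif_part t T q k))" for q
  proof -
    note part = is_partition_uniform[OF t_less_T, of q]
    have "(\<integral>s. ?h q s \<partial>U) = (\<Sum>k<Suc q. \<integral>s. g (unif_part t T q k) * cell (unif_part t T q) k s \<partial>U)"
      by (intro Bochner_Integration.integral_sum nice_integrable nice_rules) simp
    also have "\<dots> = (\<Sum>k<Suc q. g (unif_part t T q k) * ((T - t) / real (Suc q)))"
    proof (rule sum.cong[OF refl])
      fix k assume "k \<in> {..<Suc q}"
      then have "t \<le> unif_part t T q k" "unif_part t T q k \<le> unif_part t T q (Suc k)"
        "unif_part t T q (Suc k) \<le> T"
        using is_partition_bounds[OF part, of k] is_partition_bounds[OF part, of "Suc k"] is_partition_mono[OF part, of k "Suc k"] by auto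
      then show "(\<integral>s. g (unif_part t T q k) * cell (unif_part t T q) k s \<partial>U) =
          g (unif_part t T q k) * ((T - t) / real (Suc q))"
        using integral_indicator[of "unif_part t T q k" "unif_part t T q (Suc k)"] unif_part_step[of t T q k] by simp
    qed
    finally show ?thesis by (simp add: sum_distrib_left mult.commute del: sum.lessThan_Suc)
  qed
  ultimately show ?thesis by (simp del: sum.lessThan_Suc)
qed

section \<open>Existence of Ito integrals of Lipschitz functions\<close>

context wiener
begin

definition ito_sum :: "nat \<Rightarrow> (real \<Rightarrow> real) \<Rightarrow> (nat \<Rightarrow> real) \<Rightarrow> nat \<Rightarrow> 'a \<Rightarrow> real" where
  "ito_sum i g \<tau> N \<omega> = (\<Sum>k<N. g (\<tau> k) * (f i (\<tau> (Suc k)) \<omega> - f i (\<tau> k) \<omega>))"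

lemma ito_sum_measurable:
  assumes "i \<in> {1..m}" "\<And>k. k \<le> N \<Longrightarrow> \<tau> k \<in> {t..T}"
  shows "ito_sum i g \<tau> N \<in> borel_measurable M"
  unfolding ito_sum_def[abs_def]
  by (intro borel_measurable_sum borel_measurable_times borel_measurable_const borel_measurable_diff f_measurable') (use assms in auto)

text \<open>The two partitions are merged into one family over a disjoint sum of index sets, with
  negative coefficients on the second part; the isometry for overlapping intervals applies
  directly.\<close>

lemma ito_sum_diff_isometry:
  assumes i: "i \<in> {1..m}"
    and \<tau>: "\<And>k. k < N \<Longrightarrow> t \<le> \<tau> k \<and> \<tau> k \<le> \<tau> (Suc k) \<and> \<tau> (Suc k) \<le> T"
    and \<sigma>: "\<And>k. k < N' \<Longrightarrow> t \<le> \<sigma> k \<and> \<sigma> k \<le> \<sigma> (Suc k) \<and> \<sigma> (Suc k) \<le> T"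
  shows "msq M (\<lambda>\<omega>. ito_sum i g \<tau> N \<omega> - ito_sum i h \<sigma> N' \<omega>) =
    ennreal (\<integral>s. ((\<Sum>k<N. g (\<tau> k) * cell \<tau> k s) - (\<Sum>k<N'. h (\<sigma> k) * cell \<sigma> k s))\<^sup>2 \<partial>unif_on t T)"
proof -
  define A where "A = {..<N} <+> {..<N'}"
  define c where "c = case_sum (\<lambda>k. g (\<tau> k)) (\<lambda>k. - h (\<sigma> k))"
  define u where "u = case_sum \<tau> \<sigma>"
  define v where "v = case_sum (\<lambda>k. \<tau> (Suc k)) (\<lambda>k. \<sigma> (Suc k))"
  have A: "(\<Sum>a\<in>A. c a * y a) = (\<Sum>k<N. g (\<tau> k) * y (Inl k)) - (\<Sum>k<N'. h (\<sigma> k) * y (Inr k))" for y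
    by (simp add: A_def sum.Plus c_def sum_negf)
  have "msq M (\<lambda>\<omega>. \<Sum>a\<in>A. c a * (f i (v a) \<omega> - f i (u a) \<omega>)) =
    ennreal (\<integral>s. (\<Sum>a\<in>A. c a * indicator {u a<..v a} s)\<^sup>2 \<partial>unif_on t T)"
    using \<tau> \<sigma> by (intro increment_isometry i) (auto simp: A_def u_def v_def)
  then show ?thesis unfolding A by (simp add: u_def v_def ito_sum_def)
qed

text \<open>For each \<open>s\<close>, the cells of the two partitions that contain \<open>s\<close>
  have left end points at most \<open>\<delta> + \<delta>'\<close> apart, so by the Lipschitz
  condition the two step functions differ by at most
  \<open>K * (\<delta> + \<delta>')\<close>.\<close>

lemma ito_sum_diff_bound:
  assumes i: "i \<in> {1..m}" and g: "\<And>x y. \<bar>g x - g y\<bar> \<le> K * \<bar>x - y\<bar>"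
    and \<tau>: "is_partition t T \<tau> N" "\<And>k. k < N \<Longrightarrow> \<tau> (Suc k) - \<tau> k \<le> \<delta>"
    and \<sigma>: "is_partition t T \<sigma> N'" "\<And>k. k < N' \<Longrightarrow> \<sigma> (Suc k) - \<sigma> k \<le> \<delta>'"
  shows "msq M (\<lambda>\<omega>. ito_sum i g \<tau> N \<omega> - ito_sum i g \<sigma> N' \<omega>) \<le> ennreal ((K * (\<delta> + \<delta>'))\<^sup>2 * (T - t))"
proof -
  have K: "0 \<le> K" using g[of 1 0] by simp
  have "(\<integral>s. ((\<Sum>k<N. g (\<tau> k) * cell \<tau> k s) - (\<Sum>k<N'. g (\<sigma> k) * cell \<sigma> k s))\<^sup>2 \<partial>unif_on t T)
      \<le> (K * (\<delta> + \<delta>'))\<^sup>2 * (T - t)" (is "(\<integral>s. (?d s)\<^sup>2 \<partial>_) \<le> _")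
  proof (rule integral_unif_on_le)
    show "(\<lambda>s. (?d s)\<^sup>2) \<in> borel_measurable (unif_on t T)"
      by (rule borel_measurable_unif_on) measurable
    show "\<bar>(?d s)\<^sup>2\<bar> \<le> (K * (\<delta> + \<delta>'))\<^sup>2" if s: "s \<in> {t..T}" for s
    proof -
      have "\<bar>?d s\<bar> \<le> \<bar>K * (\<delta> + \<delta>')\<bar>"
      proof (cases "s = t")
        case True
        have "(\<Sum>k<N. g (\<tau> k) * cell \<tau> k t) = 0"
          using is_partition_bounds(1)[OF \<tau>(1)] by (intro sum.neutral) (auto simp: indicator_def not_less)
        moreover have "(\<Sum>k<N'. g (\<sigma> k) * cell \<sigma> k t) = 0"
          using is_partition_bounds(1)[OF \<sigma>(1)] by (intro sum.neutral) (auto simp: indicator_def not_less)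
        ultimately show ?thesis unfolding True by simp
      next
        case False
        obtain k where k: "k < N" "\<tau> k < s" "s \<le> \<tau> (Suc k)"
          using is_partition_cell[OF \<tau>(1), of s] s False by auto
        obtain l where l: "l < N'" "\<sigma> l < s" "s \<le> \<sigma> (Suc l)"
          using is_partition_cell[OF \<sigma>(1), of s] s False by auto
        have "\<bar>?d s\<bar> = \<bar>g (\<tau> k) - g (\<sigma> l)\<bar>" unfolding sum_cells[OF \<tau>(1) k] sum_cells[OF \<sigma>(1) l] ..
        also have "\<dots> \<le> K * \<bar>\<tau> k - \<sigma> l\<bar>" by (rule g)
        also have "\<dots> \<le> K * (\<delta> + \<delta>')"
          using k l \<tau>(2)[OF k(1)] \<sigma>(2)[OF l(1)] by (intro mult_left_mono K) auto
        finally show ?thesis by simp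
      qed
      then show ?thesis unfolding abs_le_square_iff by simp
    qed
  qed (use tT in auto)
  moreover have "t \<le> \<tau> k \<and> \<tau> k \<le> \<tau> (Suc k) \<and> \<tau> (Suc k) \<le> T" if "k < N" for k
    using that is_partition_bounds[OF \<tau>(1), of k] is_partition_bounds[OF \<tau>(1), of "Suc k"] is_partition_mono[OF \<tau>(1), of k "Suc k"] by auto
  moreover have "t \<le> \<sigma> k \<and> \<sigma> k \<le> \<sigma> (Suc k) \<and> \<sigma> (Suc k) \<le> T" if "k < N'" for k
    using that is_partition_bounds[OF \<sigma>(1), of k] is_partition_bounds[OF \<sigma>(1), of "Suc k"] is_partition_mono[OF \<sigma>(1), of k "Suc k"] by auto
  ultimately show ?thesis by (subst ito_sum_diff_isometry[OF i]) (auto intro: ennreal_leI)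
qed

text \<open>The integral is obtained from the uniform grids. An arbitrary sequence of partitions is
  then compared with the uniform grids at each stage, and refining the latter leaves a bound in its
  own mesh.\<close>

lemma has_ito_integral_exists:
  assumes i: "i \<in> {1..m}" and g: "\<And>x y. \<bar>g x - g y\<bar> \<le> K * \<bar>x - y\<bar>"
  shows "\<exists>I. has_ito_integral_det M g (f i) t T I"
proof -
  note up = is_partition_uniform[OF tT]
  define X where "X q = ito_sum i g (unif_part t T q) (Suc q)" for q
  define \<delta> where "\<delta> q = (T - t) / real (Suc q)" for q
  have \<delta>: "\<delta> \<longlonglongrightarrow> 0" unfolding \<delta>_def by (rule uniform_mesh_tendsto_0)
  have \<delta>_mono: "\<delta> m \<le> \<delta> k" if "k \<le> m" for k m
    using that tT unfolding \<delta>_def by (intro divide_left_mono) auto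
  have \<delta>_nonneg: "0 \<le> \<delta> q" for q using tT by (simp add: \<delta>_def)
  have K: "0 \<le> K" using g[of 1 0] by simp
  have X[measurable]: "X q \<in> borel_measurable M" for q
    unfolding X_def using is_partition_bounds[OF up] by (intro ito_sum_measurable i) auto
  have bound: "msq M (\<lambda>\<omega>. ito_sum i g \<tau> N \<omega> - X q \<omega>) \<le> ennreal ((K * (d + \<delta> q))\<^sup>2 * (T - t))"
    if "is_partition t T \<tau> N" "\<And>k. k < N \<Longrightarrow> \<tau> (Suc k) - \<tau> k \<le> d" for \<tau> N d q
    unfolding X_def by (rule ito_sum_diff_bound[OF i g that up]) (simp_all add: \<delta>_def unif_part_step)
  obtain I where I[measurable]: "I \<in> borel_measurable M" and conv: "ms_conv M X I sequentially"
  proof (rule ms_complete[of X])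
    fix \<epsilon> :: real assume "0 < \<epsilon>"
    have "(\<lambda>q. (K * (\<delta> q + \<delta> q))\<^sup>2 * (T - t)) \<longlonglongrightarrow> (K * (0 + 0))\<^sup>2 * (T - t)" by (intro tendsto_intros \<delta>)
    then have "eventually (\<lambda>q. (K * (\<delta> q + \<delta> q))\<^sup>2 * (T - t) < \<epsilon>) sequentially"
      using \<open>0 < \<epsilon>\<close> by (intro order_tendstoD(2)) auto
    then obtain Q where Q: "\<And>q. Q \<le> q \<Longrightarrow> (K * (\<delta> q + \<delta> q))\<^sup>2 * (T - t) < \<epsilon>" by (auto simp: eventually_sequentially)
    show "\<exists>Q. \<forall>k\<ge>Q. \<forall>m\<ge>k. msq M (\<lambda>\<omega>. X k \<omega> - X m \<omega>) \<le> ennreal \<epsilon>"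
    proof (intro exI[of _ Q] allI impI)
      fix k m :: nat assume km: "Q \<le> k" "k \<le> m"
      have "msq M (\<lambda>\<omega>. X k \<omega> - X m \<omega>) \<le> ennreal ((K * (\<delta> k + \<delta> m))\<^sup>2 * (T - t))"
        unfolding X_def[of k] by (rule bound[OF up]) (simp add: \<delta>_def unif_part_step)
      also have "\<dots> \<le> ennreal ((K * (\<delta> k + \<delta> k))\<^sup>2 * (T - t))"
        using K tT \<delta>_nonneg \<delta>_mono[OF km(2)]
        by (intro ennreal_leI mult_right_mono power_mono mult_left_mono add_mono mult_nonneg_nonneg) auto
      also have "\<dots> \<le> ennreal \<epsilon>" using Q[OF km(1)] by (intro ennreal_leI) simp
      finally show "msq M (\<lambda>\<omega>. X k \<omega> - X m \<omega>) \<le> ennreal \<epsilon>" .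
    qed
  qed (auto intro: X)
  have "has_ito_integral_det M g (f i) t T I"
    unfolding has_ito_integral_det_def
  proof (intro conjI allI impI I)
    fix \<tau> N assume fine: "fine_partitions t T \<tau> N"
    then obtain d where d: "d \<longlonglongrightarrow> 0" "\<And>q k. k < N q \<Longrightarrow> \<tau> q (Suc k) - \<tau> q k \<le> d q"
      and part: "\<And>q. is_partition t T (\<tau> q) (N q)" by (auto simp: fine_partitions_def)
    show "ms_conv M (\<lambda>q \<omega>. \<Sum>k<N q. g (\<tau> q k) * (f i (\<tau> q (Suc k)) \<omega> - f i (\<tau> q k) \<omega>)) I sequentially"
    proof (rule ms_conv_of_bound)
      \<comment> \<open>The summand 0 is the limit of the mesh \<open>\<delta> n\<close> of the
        uniform grids, kept in place so that the bound has the form of the limit below.\<close>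
      have "(\<lambda>q. (K * (d q + 0))\<^sup>2 * (T - t)) \<longlonglongrightarrow> (K * (0 + 0))\<^sup>2 * (T - t)" by (intro tendsto_intros d)
      then show "(\<lambda>q. (K * (d q + 0))\<^sup>2 * (T - t)) \<longlonglongrightarrow> 0" by simp
      have "msq M (\<lambda>\<omega>. ito_sum i g (\<tau> q) (N q) \<omega> - I \<omega>) \<le> ennreal ((K * (d q + 0))\<^sup>2 * (T - t))" for q
      proof (rule ms_limit_bound[of "{()}" M "\<lambda>_. X" "\<lambda>_. I" "\<lambda>n \<omega>. ito_sum i g (\<tau> q) (N q) \<omega> - X n \<omega>" _ "\<lambda>n. (K * (d q + \<delta> n))\<^sup>2 * (T - t)"])
        have [measurable]: "ito_sum i g (\<tau> q) (N q) \<in> borel_measurable M"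
          using is_partition_bounds[OF part] by (intro ito_sum_measurable i) auto
        show "(\<lambda>\<omega>. ito_sum i g (\<tau> q) (N q) \<omega> - X n \<omega>) \<in> borel_measurable M" for n by measurable
        show "(\<lambda>n. ito_sum i g (\<tau> q) (N q) \<omega> - X (r n) \<omega>) \<longlonglongrightarrow> ito_sum i g (\<tau> q) (N q) \<omega> - I \<omega>"
          if "\<And>i. i \<in> {()} \<Longrightarrow> (\<lambda>q. X (r q) \<omega>) \<longlonglongrightarrow> I \<omega>" for r \<omega>
          using that by (intro tendsto_intros) auto
        show "msq M (\<lambda>\<omega>. ito_sum i g (\<tau> q) (N q) \<omega> - X n \<omega>) \<le> ennreal ((K * (d q + \<delta> n))\<^sup>2 * (T - t))" for n
          by (rule bound[OF part d(2)])
        show "(\<lambda>n. (K * (d q + \<delta> n))\<^sup>2 * (T - t)) \<longlonglongrightarrow> (K * (d q + 0))\<^sup>2 * (T - t)" by (intro tendsto_intros \<delta>)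
      qed (use conv in auto)
      then show "eventually (\<lambda>q. msq M (\<lambda>\<omega>. (\<Sum>k<N q. g (\<tau> q k) * (f i (\<tau> q (Suc k)) \<omega> - f i (\<tau> q k) \<omega>)) - I \<omega>)
          \<le> ennreal ((K * (d q + 0))\<^sup>2 * (T - t))) sequentially"
        by (simp add: ito_sum_def)
    qed
  qed
  then show ?thesis by blast
qed

end

subsection \<open>The second moment inequality\<close>

text \<open>The pairing sums are polynomials in an arbitrary covariance, so replacing the grid
  covariances by their limits is a matter of continuity.\<close>

definition wick4 :: "('b \<Rightarrow> 'b \<Rightarrow> real) \<Rightarrow> 'b \<Rightarrow> 'b \<Rightarrow> 'b \<Rightarrow> 'b \<Rightarrow> real" where
  "wick4 \<kappa> a b c d = \<kappa> a b * \<kappa> c d + \<kappa> a c * \<kappa> b d + \<kappa> a d * \<kappa> b c"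

definition wick6 :: "('b \<Rightarrow> 'b \<Rightarrow> real) \<Rightarrow> 'b \<Rightarrow> 'b \<Rightarrow> 'b \<Rightarrow> 'b \<Rightarrow> 'b \<Rightarrow> 'b \<Rightarrow> real" where
  "wick6 \<kappa> a b c d e f =
    \<kappa> a b * (\<kappa> c d * \<kappa> e f + \<kappa> c e * \<kappa> d f + \<kappa> c f * \<kappa> d e) +
    \<kappa> a c * (\<kappa> b d * \<kappa> e f + \<kappa> b e * \<kappa> d f + \<kappa> b f * \<kappa> d e) +
    \<kappa> a d * (\<kappa> b c * \<kappa> e f + \<kappa> b e * \<kappa> c f + \<kappa> b f * \<kappa> c e) +
    \<kappa> a e * (\<kappa> b c * \<kappa> d f + \<kappa> b d * \<kappa> c f + \<kappa> b f * \<kappa> c d) +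
    \<kappa> a f * (\<kappa> b c * \<kappa> d e + \<kappa> b d * \<kappa> c e + \<kappa> b e * \<kappa> c d)"

lemma nn_integral_quadratic_form:
  fixes P :: "'i \<Rightarrow> 'a \<Rightarrow> real"
  assumes int: "\<And>x y. x \<in> I \<Longrightarrow> y \<in> I \<Longrightarrow> integrable M (\<lambda>\<omega>. P x \<omega> * P y \<omega>)"
    and ex: "\<And>x y. x \<in> I \<Longrightarrow> y \<in> I \<Longrightarrow> (\<integral>\<omega>. P x \<omega> * P y \<omega> \<partial>M) = w x y"
  shows "msq M (\<lambda>\<omega>. \<Sum>x\<in>I. c x * P x \<omega>) = ennreal (\<Sum>x\<in>I. \<Sum>y\<in>I. c x * c y * w x y)"
proof -
  have eq: "(\<Sum>x\<in>I. c x * P x \<omega>)\<^sup>2 = (\<Sum>x\<in>I. \<Sum>y\<in>I. c x * c y * (P x \<omega> * P y \<omega>))" for \<omega>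
    by (simp add: power2_eq_square sum_product algebra_simps)
  have i: "integrable M (\<lambda>\<omega>. (\<Sum>x\<in>I. c x * P x \<omega>)\<^sup>2)"
    unfolding eq using int by (intro Bochner_Integration.integrable_sum integrable_mult_right)
  have "msq M (\<lambda>\<omega>. \<Sum>x\<in>I. c x * P x \<omega>) = ennreal (\<integral>\<omega>. (\<Sum>x\<in>I. c x * P x \<omega>)\<^sup>2 \<partial>M)"
    by (rule nn_integral_eq_integral[OF i]) simp
  also have "(\<integral>\<omega>. (\<Sum>x\<in>I. c x * P x \<omega>)\<^sup>2 \<partial>M) = (\<Sum>x\<in>I. \<Sum>y\<in>I. c x * c y * w x y)"
    unfolding eq using int ex by (simp add: Bochner_Integration.integral_sum)
  finally show ?thesis .
qed

locale expansion = wiener M F f m t T + orthonormal_basis t T \<phi> \<Phi>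
  for M :: "'a measure" and F f m t T \<phi> \<Phi> +
  fixes \<zeta> :: "nat \<Rightarrow> nat \<Rightarrow> 'a \<Rightarrow> real"
  assumes zeta: "i \<in> {1..m} \<Longrightarrow> has_ito_integral_det M (\<phi> j) (f i) t T (\<zeta> i j)"
begin

lemma zeta_measurable: "i \<in> {1..m} \<Longrightarrow> \<zeta> i j \<in> borel_measurable M"
  using zeta by (simp add: has_ito_integral_det_def)

definition zq :: "nat \<Rightarrow> nat \<Rightarrow> nat \<Rightarrow> 'a \<Rightarrow> real" where
  "zq q i j = ito_sum i (\<phi> j) (unif_part t T q) (Suc q)"

lemma zq_measurable: "i \<in> {1..m} \<Longrightarrow> zq q i j \<in> borel_measurable M"
  unfolding zq_def using is_partition_bounds[OF is_partition_uniform[OF tT]] by (intro ito_sum_measurable) auto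

lemma zq_conv: "i \<in> {1..m} \<Longrightarrow> ms_conv M (\<lambda>q. zq q i j) (\<zeta> i j) sequentially"
  using zeta[of i j] fine_partitions_uniform[OF tT]
  unfolding has_ito_integral_det_def zq_def ito_sum_def by blast

text \<open>The coefficient vector of \<open>zq q i j\<close> as a linear form in all increments of
  the grid: it lives on the component \<open>i\<close> and carries the left end values of
  \<open>\<phi> j\<close>.\<close>

definition gc :: "nat \<Rightarrow> nat \<times> nat \<Rightarrow> nat \<times> nat \<Rightarrow> real" where
  "gc q = (\<lambda>(i, j) (i', k). of_bool (i' = i) * \<phi> j (unif_part t T q k))"

abbreviation "lin q \<equiv> gaussian_family.lin ({1..m} \<times> {..<Suc q}) (incr q)"
abbreviation "cov q x y \<equiv> gaussian_family.cov ({1..m} \<times> {..<Suc q}) ((T - t) / real (Suc q)) (gc q x) (gc q y)"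

lemma zq_eq_lin:
  assumes "i \<in> {1..m}"
  shows "zq q i j \<omega> = lin q (gc q (i, j)) \<omega>"
proof -
  have "lin q (gc q (i, j)) \<omega> = (\<Sum>i'\<in>{1..m}. \<Sum>k<Suc q. of_bool (i' = i) * (\<phi> j (unif_part t T q k) * incr q (i', k) \<omega>))"
    unfolding grid.lin_def sum.cartesian_product by (intro sum.cong refl) (auto simp: gc_def)
  also have "\<dots> = (\<Sum>i'\<in>{1..m}. if i' = i then \<Sum>k<Suc q. \<phi> j (unif_part t T q k) * incr q (i', k) \<omega> else 0)"
    by (intro sum.cong refl) (auto simp del: sum.lessThan_Suc)
  also have "\<dots> = zq q i j \<omega>"
    using assms by (simp add: zq_def ito_sum_def incr_def del: sum.lessThan_Suc)
  finally show ?thesis by simp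
qed

text \<open>For equal components the covariance is a Riemann sum of the product of
  \<open>\<phi> j\<close> and \<open>\<phi> l\<close>, so orthonormality gives the limit; for
  different components the coefficient vectors have disjoint supports.\<close>

lemma cov_tendsto:
  assumes "a \<in> {1..m}"
  shows "(\<lambda>q. cov q (a, j) (b, l)) \<longlonglongrightarrow> of_bool (a = b) * of_bool (j = l)"
proof -
  have "cov q (a, j) (b, l) = of_bool (a = b) * ((T - t) / real (Suc q) * (\<Sum>k<Suc q. \<phi> j (unif_part t T q k) * \<phi> l (unif_part t T q k)))" for q
  proof -
    have "(\<Sum>v\<in>{1..m} \<times> {..<Suc q}. gc q (a, j) v * gc q (b, l) v) =
        (\<Sum>i'\<in>{1..m}. \<Sum>k<Suc q. gc q (a, j) (i', k) * gc q (b, l) (i', k))"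
      by (simp add: sum.cartesian_product case_prod_unfold del: sum.lessThan_Suc)
    also have "\<dots> = (\<Sum>i'\<in>{1..m}. if i' = a then of_bool (a = b) * (\<Sum>k<Suc q. \<phi> j (unif_part t T q k) * \<phi> l (unif_part t T q k)) else 0)"
      by (intro sum.cong refl) (auto simp: gc_def simp del: sum.lessThan_Suc)
    also have "\<dots> = of_bool (a = b) * (\<Sum>k<Suc q. \<phi> j (unif_part t T q k) * \<phi> l (unif_part t T q k))"
      using assms by (simp del: sum.lessThan_Suc)
    finally show ?thesis unfolding grid.cov_def by (simp del: sum.lessThan_Suc)
  qed
  moreover have "(\<lambda>q. of_bool (a = b) * ((T - t) / real (Suc q) * (\<Sum>k<Suc q. \<phi> j (unif_part t T q k) * \<phi> l (unif_part t T q k))))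
      \<longlonglongrightarrow> of_bool (a = b) * (fcoeff j (\<phi> l))"
    by (intro tendsto_mult tendsto_const riemann_tendsto continuous_on_mult continuous_phi)
  ultimately show ?thesis by (simp add: ortho del: sum.lessThan_Suc)
qed

definition S3 :: "nat \<Rightarrow> nat \<Rightarrow> nat \<Rightarrow> nat \<Rightarrow> (nat \<Rightarrow> nat \<Rightarrow> nat \<Rightarrow> real) \<Rightarrow> 'a \<Rightarrow> real" where
  "S3 i1 i2 i3 n c \<omega> = (\<Sum>j1\<le>n. \<Sum>j2\<le>n. \<Sum>j3\<le>n. c j1 j2 j3 * \<zeta> i1 j1 \<omega> * \<zeta> i2 j2 \<omega> * \<zeta> i3 j3 \<omega>)"

definition S2 :: "nat \<Rightarrow> nat \<Rightarrow> nat \<Rightarrow> (nat \<Rightarrow> nat \<Rightarrow> real) \<Rightarrow> 'a \<Rightarrow> real" where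
  "S2 i1 i2 n c \<omega> = (\<Sum>j1\<le>n. \<Sum>j2\<le>n. c j1 j2 * \<zeta> i1 j1 \<omega> * \<zeta> i2 j2 \<omega>)"

definition S1 :: "nat \<Rightarrow> nat \<Rightarrow> real \<Rightarrow> 'a \<Rightarrow> real" where
  "S1 i n s \<omega> = (\<Sum>j\<le>n. \<Phi> j s * \<zeta> i j \<omega>)"

lemma S_measurable:
  "i1 \<in> {1..m} \<Longrightarrow> i2 \<in> {1..m} \<Longrightarrow> i3 \<in> {1..m} \<Longrightarrow> S3 i1 i2 i3 n c \<in> borel_measurable M"
  "i1 \<in> {1..m} \<Longrightarrow> i2 \<in> {1..m} \<Longrightarrow> S2 i1 i2 n c' \<in> borel_measurable M"
  "i1 \<in> {1..m} \<Longrightarrow> S1 i1 n s \<in> borel_measurable M"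
  unfolding S3_def[abs_def] S2_def[abs_def] S1_def[abs_def]
  by (intro borel_measurable_sum borel_measurable_times borel_measurable_const zeta_measurable; assumption)+

text \<open>On the grid the second moment equals the pairing sum of the grid covariances. These
  converge to Kronecker deltas, Fatou's lemma gives the inequality for the limit variables, and
  \<open>wick_sum6_le\<close> bounds the limiting pairing sum.\<close>

lemma S3_bound:
  assumes i: "i1 \<in> {1..m}" "i2 \<in> {1..m}" "i3 \<in> {1..m}"
  shows "msq M (S3 i1 i2 i3 n c) \<le> ennreal (tensor_bound3 n c)"
proof -
  define I where "I = {..n} \<times> {..n} \<times> {..n}"
  define h where "h = (\<lambda>(a, b, d). c a b d)"
  have I3: "(\<Sum>x\<in>I. g x) = (\<Sum>a\<le>n. \<Sum>b\<le>n. \<Sum>d\<le>n. g (a, b, d))" for g :: "_ \<Rightarrow> real"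
    by (simp add: I_def sum.cartesian_product case_prod_unfold)
  define P where "P q = (\<lambda>(a, b, d) \<omega>. zq q i1 a \<omega> * zq q i2 b \<omega> * zq q i3 d \<omega>)" for q
  define w where "w \<kappa> = (\<lambda>(a, b, d) (a', b', d'). wick6 \<kappa> (i1, a) (i2, b) (i3, d) (i1, a') (i2, b') (i3, d'))"
    for \<kappa> :: "nat \<times> nat \<Rightarrow> nat \<times> nat \<Rightarrow> real"
  let ?D = "\<lambda>(x::nat \<times> nat) (y::nat \<times> nat). of_bool (fst x = fst y) * of_bool (snd x = snd y) :: real"
  have "msq M (S3 i1 i2 i3 n c) \<le> ennreal (\<Sum>x\<in>I. \<Sum>y\<in>I. h x * h y * w ?D x y)"
  proof (rule ms_limit_bound[of "{i1, i2, i3} \<times> {..n}" M "\<lambda>(i, j) q. zq q i j" "\<lambda>(i, j). \<zeta> i j"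
        "\<lambda>q \<omega>. \<Sum>x\<in>I. h x * P q x \<omega>" _ "\<lambda>q. \<Sum>x\<in>I. \<Sum>y\<in>I. h x * h y * w (cov q) x y"])
    show "(\<lambda>\<omega>. \<Sum>x\<in>I. h x * P q x \<omega>) \<in> borel_measurable M" for q
      unfolding P_def case_prod_unfold
      by (intro borel_measurable_sum borel_measurable_times borel_measurable_const zq_measurable i)
    show "(\<lambda>q. \<Sum>x\<in>I. h x * P (r q) x \<omega>) \<longlonglongrightarrow> S3 i1 i2 i3 n c \<omega>"
      if "\<And>x. x \<in> {i1, i2, i3} \<times> {..n} \<Longrightarrow> (\<lambda>q. (case x of (i, j) \<Rightarrow> \<lambda>q. zq q i j) (r q) \<omega>) \<longlonglongrightarrow> (case x of (i, j) \<Rightarrow> \<zeta> i j) \<omega>"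
      for \<omega> r
    proof -
      have z: "(\<lambda>q. zq (r q) i j \<omega>) \<longlonglongrightarrow> \<zeta> i j \<omega>" if "i \<in> {i1, i2, i3}" "j \<le> n" for i j
        using \<open>\<And>x. x \<in> {i1, i2, i3} \<times> {..n} \<Longrightarrow> _\<close>[of "(i, j)"] that by simp
      show ?thesis
        unfolding S3_def I3 P_def h_def prod.case mult.assoc
        by (intro tendsto_sum tendsto_mult tendsto_const z) auto
    qed
    show "msq M (\<lambda>\<omega>. \<Sum>x\<in>I. h x * P q x \<omega>) \<le> ennreal (\<Sum>x\<in>I. \<Sum>y\<in>I. h x * h y * w (cov q) x y)" for q
    proof (rule eq_refl, rule nn_integral_quadratic_form)
      fix x y :: "nat \<times> nat \<times> nat"
      obtain a b d a' b' d' where xy: "x = (a, b, d)" "y = (a', b', d')" by (metis prod.exhaust)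
      show "integrable M (\<lambda>\<omega>. P q x \<omega> * P q y \<omega>)"
        unfolding xy P_def prod.case zq_eq_lin[OF i(1)] zq_eq_lin[OF i(2)] zq_eq_lin[OF i(3)] by (rule grid.integrable_lin6)
      show "expectation (\<lambda>\<omega>. P q x \<omega> * P q y \<omega>) = w (cov q) x y"
        unfolding xy P_def w_def prod.case zq_eq_lin[OF i(1)] zq_eq_lin[OF i(2)] zq_eq_lin[OF i(3)] wick6_def
        by (rule grid.expectation_lin6)
    qed
    show "(\<lambda>q. \<Sum>x\<in>I. \<Sum>y\<in>I. h x * h y * w (cov q) x y) \<longlonglongrightarrow> (\<Sum>x\<in>I. \<Sum>y\<in>I. h x * h y * w ?D x y)"
    proof (intro tendsto_sum tendsto_mult tendsto_const)
      fix x y :: "nat \<times> nat \<times> nat"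
      obtain a b d a' b' d' where xy: "x = (a, b, d)" "y = (a', b', d')" by (metis prod.exhaust)
      have cl: "(\<lambda>q. cov q u v) \<longlonglongrightarrow> ?D u v" if "fst u \<in> {1..m}" for u v
        using cov_tendsto[of "fst u" "snd u" "fst v" "snd v"] that by simp
      show "(\<lambda>q. w (cov q) x y) \<longlonglongrightarrow> w ?D x y"
        unfolding xy w_def prod.case wick6_def by (intro tendsto_add tendsto_mult cl; simp only: fst_conv i)
    qed
  qed (use i zq_conv zq_measurable zeta_measurable in auto)
  also have "(\<Sum>x\<in>I. \<Sum>y\<in>I. h x * h y * w ?D x y) \<le> tensor_bound3 n c"
    unfolding I3 h_def w_def prod.case wick6_def fst_conv snd_conv by (rule wick_sum6_le)
  finally show ?thesis by (simp add: ennreal_leI)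
qed

lemma S2_bound:
  assumes i: "i1 \<in> {1..m}" "i2 \<in> {1..m}"
  shows "msq M (S2 i1 i2 n c) \<le> ennreal (tensor_bound2 n c)"
proof -
  define I where "I = {..n} \<times> {..n}"
  define h where "h = (\<lambda>(a, b). c a b)"
  have I2: "(\<Sum>x\<in>I. g x) = (\<Sum>a\<le>n. \<Sum>b\<le>n. g (a, b))" for g :: "_ \<Rightarrow> real"
    by (simp add: I_def sum.cartesian_product case_prod_unfold)
  define P where "P q = (\<lambda>(a, b) \<omega>. zq q i1 a \<omega> * zq q i2 b \<omega>)" for q
  define w where "w \<kappa> = (\<lambda>(a, b) (a', b'). wick4 \<kappa> (i1, a) (i2, b) (i1, a') (i2, b'))"
    for \<kappa> :: "nat \<times> nat \<Rightarrow> nat \<times> nat \<Rightarrow> real"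
  let ?D = "\<lambda>(x::nat \<times> nat) (y::nat \<times> nat). of_bool (fst x = fst y) * of_bool (snd x = snd y) :: real"
  have "msq M (S2 i1 i2 n c) \<le> ennreal (\<Sum>x\<in>I. \<Sum>y\<in>I. h x * h y * w ?D x y)"
  proof (rule ms_limit_bound[of "{i1, i2} \<times> {..n}" M "\<lambda>(i, j) q. zq q i j" "\<lambda>(i, j). \<zeta> i j"
        "\<lambda>q \<omega>. \<Sum>x\<in>I. h x * P q x \<omega>" _ "\<lambda>q. \<Sum>x\<in>I. \<Sum>y\<in>I. h x * h y * w (cov q) x y"])
    show "(\<lambda>\<omega>. \<Sum>x\<in>I. h x * P q x \<omega>) \<in> borel_measurable M" for q
      unfolding P_def case_prod_unfold
      by (intro borel_measurable_sum borel_measurable_times borel_measurable_const zq_measurable i)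
    show "(\<lambda>q. \<Sum>x\<in>I. h x * P (r q) x \<omega>) \<longlonglongrightarrow> S2 i1 i2 n c \<omega>"
      if "\<And>x. x \<in> {i1, i2} \<times> {..n} \<Longrightarrow> (\<lambda>q. (case x of (i, j) \<Rightarrow> \<lambda>q. zq q i j) (r q) \<omega>) \<longlonglongrightarrow> (case x of (i, j) \<Rightarrow> \<zeta> i j) \<omega>"
      for \<omega> r
    proof -
      have z: "(\<lambda>q. zq (r q) i j \<omega>) \<longlonglongrightarrow> \<zeta> i j \<omega>" if "i \<in> {i1, i2}" "j \<le> n" for i j
        using \<open>\<And>x. x \<in> {i1, i2} \<times> {..n} \<Longrightarrow> _\<close>[of "(i, j)"] that by simp
      show ?thesis
        unfolding S2_def I2 P_def h_def prod.case mult.assoc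
        by (intro tendsto_sum tendsto_mult tendsto_const z) auto
    qed
    show "msq M (\<lambda>\<omega>. \<Sum>x\<in>I. h x * P q x \<omega>) \<le> ennreal (\<Sum>x\<in>I. \<Sum>y\<in>I. h x * h y * w (cov q) x y)" for q
    proof (rule eq_refl, rule nn_integral_quadratic_form)
      fix x y :: "nat \<times> nat"
      obtain a b a' b' where xy: "x = (a, b)" "y = (a', b')" by (metis prod.exhaust)
      show "integrable M (\<lambda>\<omega>. P q x \<omega> * P q y \<omega>)"
        unfolding xy P_def prod.case zq_eq_lin[OF i(1)] zq_eq_lin[OF i(2)] by (rule grid.integrable_lin4)
      show "expectation (\<lambda>\<omega>. P q x \<omega> * P q y \<omega>) = w (cov q) x y"
        unfolding xy P_def w_def prod.case zq_eq_lin[OF i(1)] zq_eq_lin[OF i(2)] wick4_def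
        by (rule grid.expectation_lin4)
    qed
    show "(\<lambda>q. \<Sum>x\<in>I. \<Sum>y\<in>I. h x * h y * w (cov q) x y) \<longlonglongrightarrow> (\<Sum>x\<in>I. \<Sum>y\<in>I. h x * h y * w ?D x y)"
    proof (intro tendsto_sum tendsto_mult tendsto_const)
      fix x y :: "nat \<times> nat"
      obtain a b a' b' where xy: "x = (a, b)" "y = (a', b')" by (metis prod.exhaust)
      have cl: "(\<lambda>q. cov q u v) \<longlonglongrightarrow> ?D u v" if "fst u \<in> {1..m}" for u v
        using cov_tendsto[of "fst u" "snd u" "fst v" "snd v"] that by simp
      show "(\<lambda>q. w (cov q) x y) \<longlonglongrightarrow> w ?D x y"
        unfolding xy w_def prod.case wick4_def by (intro tendsto_add tendsto_mult cl; simp only: fst_conv i)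
    qed
  qed (use i zq_conv zq_measurable zeta_measurable in auto)
  also have "(\<Sum>x\<in>I. \<Sum>y\<in>I. h x * h y * w ?D x y) \<le> tensor_bound2 n c"
    unfolding I2 h_def w_def prod.case wick4_def fst_conv snd_conv by (rule wick_sum4_le)
  finally show ?thesis by (simp add: ennreal_leI)
qed

text \<open>By the isometry the error is at most the squared distance between the indicator of
  \<open>{t<..s}\<close> and its \<open>n\<close>-th Fourier partial sum, which is the Parseval
  defect of that indicator.\<close>

lemma S1_conv:
  assumes i: "i \<in> {1..m}" and s: "s \<in> {t..T}"
  shows "ms_conv M (\<lambda>n. S1 i n s) (\<lambda>\<omega>. f i s \<omega> - f i t \<omega>) sequentially"
proof (rule ms_conv_of_bound)
  have "(\<lambda>n. (s - t) - (\<Sum>j\<le>n. (\<Phi> j s)\<^sup>2)) \<longlonglongrightarrow> (s - t) - (s - t)"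
    by (intro tendsto_intros parseval s)
  then show "(\<lambda>n. (s - t) - (\<Sum>j\<le>n. (\<Phi> j s)\<^sup>2)) \<longlonglongrightarrow> 0" by simp
  have "msq M (\<lambda>\<omega>. S1 i n s \<omega> - (f i s \<omega> - f i t \<omega>)) \<le> ennreal ((s - t) - (\<Sum>j\<le>n. (\<Phi> j s)\<^sup>2))" for n
  proof -
    define g where "g u = (\<Sum>j\<le>n. \<Phi> j s * \<phi> j u)" for u
    \<comment> \<open>The increment of \<open>f i\<close> from \<open>t\<close> to \<open>s\<close>
      is written as the Ito sum of the constant 1 over the single interval between the nodes
      \<open>t\<close> and \<open>s\<close>, so that it fits the isometry.\<close>
    define \<sigma> where "\<sigma> k = (if k = 0 then t else s)" for k :: nat
    have gcont: "continuous_on {t..T} g"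
      unfolding g_def by (intro continuous_intros continuous_phi)
    let ?h = "\<lambda>q u. \<Sum>k<Suc q. g (unif_part t T q k) * cell (unif_part t T q) k u"
    let ?d = "\<lambda>q u. ?h q u - (\<Sum>k<Suc 0. 1 * cell \<sigma> k u)"
    have lim: "(\<lambda>q. \<integral>u. (?d q u)\<^sup>2 \<partial>U) \<longlonglongrightarrow> (\<integral>u. (g u - indicator {t<..s} u)\<^sup>2 \<partial>U)"
    proof -
      obtain K where K: "\<And>u. u \<in> {t..T} \<Longrightarrow> \<bar>g u\<bar> \<le> K"
        using nice_continuous[OF gcont] unfolding nice_def by metis
      show ?thesis
      proof (rule integral_square_tendsto[where K = "K + 1"])
        show "nice (?d q)" for q by (intro nice_rules; simp)
        show "nice (\<lambda>u. g u - indicator {t<..s} u)" by (intro nice_rules nice_continuous[OF gcont]) simp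
        show "\<bar>?d q u\<bar> \<le> K + 1" if "u \<in> {t..T}" for q u
        proof -
          have "\<bar>?h q u\<bar> \<le> K" by (rule riemann_step_bound[OF K that])
          moreover have "\<bar>\<Sum>k<Suc 0. 1 * cell \<sigma> k u\<bar> \<le> (1::real)" by (simp add: indicator_def)
          ultimately show ?thesis by (simp only: abs_le_iff) linarith
        qed
        show "(\<lambda>q. ?d q u) \<longlonglongrightarrow> g u - indicator {t<..s} u" if "t < u" "u \<le> T" for u
          using tendsto_diff[OF riemann_step_tendsto[OF gcont that] tendsto_const[of "\<Sum>k<Suc 0. 1 * cell \<sigma> k u"]]
          by (simp add: \<sigma>_def del: sum.lessThan_Suc)
      qed
    qed
    have val: "(\<integral>u. (g u - indicator {t<..s} u)\<^sup>2 \<partial>U) = (s - t) - (\<Sum>j\<le>n. (\<Phi> j s)\<^sup>2)"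
    proof -
      have "(\<integral>u. (g u - indicator {t<..s} u)\<^sup>2 \<partial>U) = (\<integral>u. (indicator {t<..s} u - (\<Sum>j\<le>n. \<Phi> j s * \<phi> j u))\<^sup>2 \<partial>U)"
        unfolding g_def by (simp add: power2_commute)
      also have "\<dots> = (\<integral>u. (indicator {t<..s} u)\<^sup>2 \<partial>U) - 2 * (\<Sum>j\<le>n. \<Phi> j s * (\<integral>u. \<phi> j u * indicator {t<..s} u \<partial>U)) + (\<Sum>j\<le>n. (\<Phi> j s)\<^sup>2)"
        by (rule integral_square_expansion[OF nice_indicator]) simp
      also have "(\<integral>u. (indicator {t<..s} u)\<^sup>2 \<partial>U) = (\<integral>u. (indicator {t<..s} u :: real) \<partial>U)"
        by (intro Bochner_Integration.integral_cong) (auto simp: indicator_def)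
      also have "\<dots> = s - t" using s by (intro integral_indicator) auto
      also have "(\<Sum>j\<le>n. \<Phi> j s * (\<integral>u. \<phi> j u * indicator {t<..s} u \<partial>U)) = (\<Sum>j\<le>n. (\<Phi> j s)\<^sup>2)"
        using Phi_eq[OF s] by (simp add: power2_eq_square)
      finally show ?thesis by simp
    qed
    have eqg: "(\<Sum>j\<le>n. \<Phi> j s * zq q i j \<omega>) = ito_sum i g (unif_part t T q) (Suc q) \<omega>" for q \<omega>
    proof -
      have "(\<Sum>j\<le>n. \<Phi> j s * zq q i j \<omega>) = (\<Sum>j\<le>n. \<Sum>k<Suc q. \<Phi> j s * \<phi> j (unif_part t T q k) *
          (f i (unif_part t T q (Suc k)) \<omega> - f i (unif_part t T q k) \<omega>))"
        unfolding zq_def ito_sum_def by (simp add: sum_distrib_left mult.assoc del: sum.lessThan_Suc)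
      then show ?thesis
        unfolding ito_sum_def g_def by (subst (asm) sum.swap) (simp add: sum_distrib_right del: sum.lessThan_Suc)
    qed
    show ?thesis
    proof (rule ms_limit_bound[of "{..n}" M "\<lambda>j q. zq q i j" "\<zeta> i"
        "\<lambda>q \<omega>. (\<Sum>j\<le>n. \<Phi> j s * zq q i j \<omega>) - (f i s \<omega> - f i t \<omega>)" _ "\<lambda>q. \<integral>u. (?d q u)\<^sup>2 \<partial>U"])
      show "(\<lambda>\<omega>. (\<Sum>j\<le>n. \<Phi> j s * zq q i j \<omega>) - (f i s \<omega> - f i t \<omega>)) \<in> borel_measurable M" for q
        using s tT by (intro borel_measurable_diff borel_measurable_sum borel_measurable_times borel_measurable_const zq_measurable f_measurable' i) auto
      show "(\<lambda>q. (\<Sum>j\<le>n. \<Phi> j s * zq (r q) i j \<omega>) - (f i s \<omega> - f i t \<omega>)) \<longlonglongrightarrow> S1 i n s \<omega> - (f i s \<omega> - f i t \<omega>)"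
        if "\<And>j. j \<in> {..n} \<Longrightarrow> (\<lambda>q. zq (r q) i j \<omega>) \<longlonglongrightarrow> \<zeta> i j \<omega>" for r \<omega>
        unfolding S1_def using that by (intro tendsto_diff tendsto_const tendsto_sum tendsto_mult) auto
      show "msq M (\<lambda>\<omega>. (\<Sum>j\<le>n. \<Phi> j s * zq q i j \<omega>) - (f i s \<omega> - f i t \<omega>)) \<le> ennreal (\<integral>u. (?d q u)\<^sup>2 \<partial>U)" for q
      proof (rule eq_refl)
        note part = is_partition_uniform[OF tT, of q]
        have "msq M (\<lambda>\<omega>. ito_sum i g (unif_part t T q) (Suc q) \<omega> - ito_sum i (\<lambda>_. 1) \<sigma> (Suc 0) \<omega>) = ennreal (\<integral>u. (?d q u)\<^sup>2 \<partial>U)"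
        proof (rule ito_sum_diff_isometry[OF i])
          show "t \<le> unif_part t T q k \<and> unif_part t T q k \<le> unif_part t T q (Suc k) \<and> unif_part t T q (Suc k) \<le> T"
            if "k < Suc q" for k
            using that is_partition_bounds[OF part, of k] is_partition_bounds[OF part, of "Suc k"] is_partition_mono[OF part, of k "Suc k"] by auto
          show "t \<le> \<sigma> k \<and> \<sigma> k \<le> \<sigma> (Suc k) \<and> \<sigma> (Suc k) \<le> T" if "k < Suc 0" for k
            using s by (auto simp: \<sigma>_def)
        qed
        moreover have "ito_sum i (\<lambda>_. 1) \<sigma> (Suc 0) \<omega> = f i s \<omega> - f i t \<omega>" for \<omega>
          by (simp add: ito_sum_def \<sigma>_def)
        ultimately show "msq M (\<lambda>\<omega>. (\<Sum>j\<le>n. \<Phi> j s * zq q i j \<omega>) - (f i s \<omega> - f i t \<omega>)) = ennreal (\<integral>u. (?d q u)\<^sup>2 \<partial>U)"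
          unfolding eqg by simp
      qed
      show "(\<lambda>q. \<integral>u. (?d q u)\<^sup>2 \<partial>U) \<longlonglongrightarrow> (s - t) - (\<Sum>j\<le>n. (\<Phi> j s)\<^sup>2)" using lim unfolding val .
    qed (use i zq_conv zq_measurable zeta_measurable in auto)
  qed
  then show "eventually (\<lambda>n. msq M (\<lambda>\<omega>. S1 i n s \<omega> - (f i s \<omega> - f i t \<omega>)) \<le> ennreal ((s - t) - (\<Sum>j\<le>n. (\<Phi> j s)\<^sup>2))) sequentially"
    by simp
qed

end

subsection \<open>Iterated Stratonovich integrals\<close>

lemma sum_restrict_box:
  fixes k n :: nat
  assumes "k \<le> n"
  shows "(\<Sum>j\<le>n. of_bool (j \<le> k) * a j) = (\<Sum>j\<le>k. a j :: real)"
  using assms by (intro sum.mono_neutral_cong_right) auto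

abbreviation trap_sum :: "(real \<Rightarrow> 'a \<Rightarrow> real) \<Rightarrow> (real \<Rightarrow> 'a \<Rightarrow> real) \<Rightarrow> (nat \<Rightarrow> real) \<Rightarrow> nat \<Rightarrow> 'a \<Rightarrow> real" where
  "trap_sum X W \<tau> N \<omega> \<equiv> \<Sum>k<N. (X (\<tau> k) \<omega> + X (\<tau> (Suc k)) \<omega>) / 2 * (W (\<tau> (Suc k)) \<omega> - W (\<tau> k) \<omega>)"

lemma trapezoid_sum_bilinear:
  fixes A :: "'j \<Rightarrow> real \<Rightarrow> real" and B :: "'k \<Rightarrow> real \<Rightarrow> real"
  shows "(\<Sum>l<N. ((\<Sum>j\<in>J. A j (\<tau> l) * a j) + (\<Sum>j\<in>J. A j (\<tau> (Suc l)) * a j)) / 2 *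
       ((\<Sum>k\<in>K. B k (\<tau> (Suc l)) * b k) - (\<Sum>k\<in>K. B k (\<tau> l) * b k))) =
    (\<Sum>j\<in>J. \<Sum>k\<in>K. (\<Sum>l<N. (A j (\<tau> l) + A j (\<tau> (Suc l))) / 2 * (B k (\<tau> (Suc l)) - B k (\<tau> l))) * a j * b k)"
proof -
  have "((\<Sum>j\<in>J. A j (\<tau> l) * a j) + (\<Sum>j\<in>J. A j (\<tau> (Suc l)) * a j)) / 2 *
       ((\<Sum>k\<in>K. B k (\<tau> (Suc l)) * b k) - (\<Sum>k\<in>K. B k (\<tau> l) * b k)) =
      (\<Sum>j\<in>J. \<Sum>k\<in>K. (A j (\<tau> l) + A j (\<tau> (Suc l))) / 2 * (B k (\<tau> (Suc l)) - B k (\<tau> l)) * a j * b k)" for l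
  proof -
    have 1: "((\<Sum>j\<in>J. A j (\<tau> l) * a j) + (\<Sum>j\<in>J. A j (\<tau> (Suc l)) * a j)) / 2 = (\<Sum>j\<in>J. (A j (\<tau> l) + A j (\<tau> (Suc l))) / 2 * a j)"
      by (simp add: sum.distrib[symmetric] sum_divide_distrib algebra_simps)
    have 2: "(\<Sum>k\<in>K. B k (\<tau> (Suc l)) * b k) - (\<Sum>k\<in>K. B k (\<tau> l) * b k) = (\<Sum>k\<in>K. (B k (\<tau> (Suc l)) - B k (\<tau> l)) * b k)"
      by (simp add: sum_subtractf[symmetric] algebra_simps)
    show ?thesis unfolding 1 2 sum_product by (intro sum.cong refl) simp
  qed
  then have "(\<Sum>l<N. ((\<Sum>j\<in>J. A j (\<tau> l) * a j) + (\<Sum>j\<in>J. A j (\<tau> (Suc l)) * a j)) / 2 *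
       ((\<Sum>k\<in>K. B k (\<tau> (Suc l)) * b k) - (\<Sum>k\<in>K. B k (\<tau> l) * b k))) =
     (\<Sum>l<N. \<Sum>j\<in>J. \<Sum>k\<in>K. (A j (\<tau> l) + A j (\<tau> (Suc l))) / 2 * (B k (\<tau> (Suc l)) - B k (\<tau> l)) * a j * b k)"
    by simp
  also have "\<dots> = (\<Sum>j\<in>J. \<Sum>l<N. \<Sum>k\<in>K. (A j (\<tau> l) + A j (\<tau> (Suc l))) / 2 * (B k (\<tau> (Suc l)) - B k (\<tau> l)) * a j * b k)"
    by (rule sum.swap)
  also have "\<dots> = (\<Sum>j\<in>J. \<Sum>k\<in>K. \<Sum>l<N. (A j (\<tau> l) + A j (\<tau> (Suc l))) / 2 * (B k (\<tau> (Suc l)) - B k (\<tau> l)) * a j * b k)"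
    by (rule sum.cong[OF refl], rule sum.swap)
  also have "\<dots> = (\<Sum>j\<in>J. \<Sum>k\<in>K. (\<Sum>l<N. (A j (\<tau> l) + A j (\<tau> (Suc l))) / 2 * (B k (\<tau> (Suc l)) - B k (\<tau> l))) * a j * b k)"
    by (simp add: sum_distrib_right)
  finally show ?thesis .
qed

context expansion
begin

context
  fixes i1 i2 i3 :: nat
  assumes i1: "i1 \<in> {1..m}" and i2: "i2 \<in> {1..m}" and i3: "i3 \<in> {1..m}"
begin

abbreviation "A2 n s \<equiv> S2 i1 i2 n (\<lambda>j1 j2. G j2 j1 s)"
abbreviation "A3 n \<equiv> S3 i1 i2 i3 n C"

text \<open>The smaller sum is extended to the larger cube with zero coefficients, so the difference
  of two truncations becomes a single form to which the second moment inequality applies.\<close>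

lemma A2_diff:
  assumes "k \<le> n"
  shows "A2 k s \<omega> - A2 n s \<omega> = - S2 i1 i2 n (\<lambda>j1 j2. of_bool (\<not> (j1 \<le> k \<and> j2 \<le> k)) * G j2 j1 s) \<omega>"
proof -
  have "A2 k s \<omega> = (\<Sum>j1\<le>n. of_bool (j1 \<le> k) * (\<Sum>j2\<le>n. of_bool (j2 \<le> k) * (G j2 j1 s * \<zeta> i1 j1 \<omega> * \<zeta> i2 j2 \<omega>)))"
    unfolding S2_def sum_restrict_box[OF assms] ..
  also have "\<dots> = A2 n s \<omega> - S2 i1 i2 n (\<lambda>j1 j2. of_bool (\<not> (j1 \<le> k \<and> j2 \<le> k)) * G j2 j1 s) \<omega>"
    unfolding S2_def sum_subtractf[symmetric] sum_distrib_left by (intro sum.cong refl) auto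
  finally show ?thesis by simp
qed

lemma A3_diff:
  assumes "p1 \<le> n" "p2 \<le> n" "p3 \<le> n"
  shows "(\<Sum>j1\<le>p1. \<Sum>j2\<le>p2. \<Sum>j3\<le>p3. C j1 j2 j3 * \<zeta> i1 j1 \<omega> * \<zeta> i2 j2 \<omega> * \<zeta> i3 j3 \<omega>) - A3 n \<omega> =
    - S3 i1 i2 i3 n (\<lambda>j1 j2 j3. of_bool (\<not> (j1 \<le> p1 \<and> j2 \<le> p2 \<and> j3 \<le> p3)) * C j1 j2 j3) \<omega>"
proof -
  have "(\<Sum>j1\<le>p1. \<Sum>j2\<le>p2. \<Sum>j3\<le>p3. C j1 j2 j3 * \<zeta> i1 j1 \<omega> * \<zeta> i2 j2 \<omega> * \<zeta> i3 j3 \<omega>) =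
      (\<Sum>j1\<le>n. of_bool (j1 \<le> p1) * (\<Sum>j2\<le>n. of_bool (j2 \<le> p2) * (\<Sum>j3\<le>n. of_bool (j3 \<le> p3) *
        (C j1 j2 j3 * \<zeta> i1 j1 \<omega> * \<zeta> i2 j2 \<omega> * \<zeta> i3 j3 \<omega>))))"
    unfolding sum_restrict_box[OF assms(1)] sum_restrict_box[OF assms(2)] sum_restrict_box[OF assms(3)] ..
  also have "\<dots> = A3 n \<omega> - S3 i1 i2 i3 n (\<lambda>j1 j2 j3. of_bool (\<not> (j1 \<le> p1 \<and> j2 \<le> p2 \<and> j3 \<le> p3)) * C j1 j2 j3) \<omega>"
    unfolding S3_def sum_subtractf[symmetric] sum_distrib_left by (intro sum.cong refl) auto
  finally show ?thesis by simp
qed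

lemma A2_limit:
  assumes s: "s \<in> {t..T}"
  shows "\<exists>J. J \<in> borel_measurable M \<and> ms_conv M (\<lambda>n. A2 n s) J sequentially"
proof (rule ms_complete[of "\<lambda>n. A2 n s"])
  show "A2 q s \<in> borel_measurable M" for q by (intro S_measurable i1 i2)
  fix \<epsilon> :: real assume "0 < \<epsilon>"
  then obtain Q where Q: "\<And>p n. Q \<le> p \<Longrightarrow> Q \<le> n \<Longrightarrow>
      tensor_bound2 n (\<lambda>j1 j2. of_bool (\<not> (j1 \<le> p \<and> j2 \<le> p)) * G j2 j1 s) \<le> \<epsilon>"
    using tensor_bound2_outside_box[OF s \<open>0 < \<epsilon>\<close>] by blast
  show "\<exists>Q. \<forall>k\<ge>Q. \<forall>m\<ge>k. msq M (\<lambda>\<omega>. A2 k s \<omega> - A2 m s \<omega>) \<le> ennreal \<epsilon>"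
  proof (intro exI[of _ Q] allI impI)
    fix k m' assume "Q \<le> k" "k \<le> m'"
    then show "msq M (\<lambda>\<omega>. A2 k s \<omega> - A2 m' s \<omega>) \<le> ennreal \<epsilon>"
      using order_trans[OF S2_bound[OF i1 i2] ennreal_leI[OF Q[of k m']]] by (simp add: A2_diff)
  qed
qed blast

lemma A3_limit: "\<exists>J. J \<in> borel_measurable M \<and> ms_conv M A3 J sequentially"
proof (rule ms_complete[of A3])
  show "A3 q \<in> borel_measurable M" for q by (intro S_measurable i1 i2 i3)
  fix \<epsilon> :: real assume "0 < \<epsilon>"
  then obtain Q where Q: "\<And>p1 p2 p3 n. Q \<le> p1 \<Longrightarrow> Q \<le> p2 \<Longrightarrow> Q \<le> p3 \<Longrightarrow> Q \<le> n \<Longrightarrow>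
      tensor_bound3 n (\<lambda>j1 j2 j3. of_bool (\<not> (j1 \<le> p1 \<and> j2 \<le> p2 \<and> j3 \<le> p3)) * C j1 j2 j3) \<le> \<epsilon>"
    using tensor_bound3_outside_box[OF \<open>0 < \<epsilon>\<close>] by blast
  show "\<exists>Q. \<forall>k\<ge>Q. \<forall>m\<ge>k. msq M (\<lambda>\<omega>. A3 k \<omega> - A3 m \<omega>) \<le> ennreal \<epsilon>"
  proof (intro exI[of _ Q] allI impI)
    fix k m' assume k: "Q \<le> k" "k \<le> m'"
    have "A3 k \<omega> - A3 m' \<omega> = - S3 i1 i2 i3 m' (\<lambda>j1 j2 j3. of_bool (\<not> (j1 \<le> k \<and> j2 \<le> k \<and> j3 \<le> k)) * C j1 j2 j3) \<omega>" for \<omega>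
      using A3_diff[OF k(2) k(2) k(2), of \<omega>] by (simp only: S3_def[of i1 i2 i3 k C])
    then show "msq M (\<lambda>\<omega>. A3 k \<omega> - A3 m' \<omega>) \<le> ennreal \<epsilon>"
      using order_trans[OF S3_bound[OF i1 i2 i3] ennreal_leI[OF Q[of k k k m']]] k by simp
  qed
qed blast

text \<open>The integral is chosen as the mean-square limit of its own expansion; that it is the
  Stratonovich integral is proved afterwards.\<close>

definition J2 :: "real \<Rightarrow> 'a \<Rightarrow> real" where
  "J2 s = (SOME J. J \<in> borel_measurable M \<and> ms_conv M (\<lambda>n. A2 n s) J sequentially)"

definition J3 :: "'a \<Rightarrow> real" where
  "J3 = (SOME J. J \<in> borel_measurable M \<and> ms_conv M A3 J sequentially)"

lemma J2: "s \<in> {t..T} \<Longrightarrow> J2 s \<in> borel_measurable M" "s \<in> {t..T} \<Longrightarrow> ms_conv M (\<lambda>n. A2 n s) (J2 s) sequentially"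
  unfolding J2_def using someI_ex[OF A2_limit[of s]] by auto

lemma J3: "J3 \<in> borel_measurable M" "ms_conv M A3 J3 sequentially"
  unfolding J3_def using someI_ex[OF A3_limit] by auto

text \<open>For a fixed partition every variable in the trapezoidal sum is a mean-square limit of
  truncations. At level \<open>n\<close> the error is a quadratic form with coefficients
  \<open>G_trap - G\<close>, whose bound is uniform in \<open>n\<close>; letting \<open>n\<close>
  tend to infinity leaves an estimate in the mesh.\<close>

lemma J2_strat:
  assumes s: "s \<in> {t..T}"
  shows "has_strat_integral M (\<lambda>u \<omega>. f i1 u \<omega> - f i1 t \<omega>) (f i2) t s (J2 s)"
  unfolding has_strat_integral_def
proof (intro conjI allI impI J2(1)[OF s])
  fix \<tau> N assume "fine_partitions t s \<tau> N"
  then obtain d where d: "d \<longlonglongrightarrow> 0" "\<And>q k. k < N q \<Longrightarrow> \<tau> q (Suc k) - \<tau> q k \<le> d q"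
    and part: "\<And>q. is_partition t s (\<tau> q) (N q)" by (auto simp: fine_partitions_def)
  have bound: "msq M (\<lambda>\<omega>. (trap_sum (\<lambda>u \<omega>. f i1 u \<omega> - f i1 t \<omega>) (f i2) \<tau> N \<omega>) - J2 s \<omega>) \<le> ennreal (2 * (\<delta> * L))"
    if part: "is_partition t s \<tau> N" and mesh: "\<And>k. k < N \<Longrightarrow> \<tau> (Suc k) - \<tau> k \<le> \<delta>" and "0 \<le> \<delta>" for \<tau> N \<delta>
  proof -
    have tau: "\<tau> k \<in> {t..T}" if "k \<le> N" for k
      using is_partition_bounds[OF part that] s by auto
    \<comment> \<open>The tag \<open>a\<close> distinguishes the candidate integral and the two
      component processes, so that all of them form one finite family and share one almost surely
      convergent subsequence.\<close>
    define X where "X = (\<lambda>(a, k) n. if a = (0::nat) then A2 n s else if a = 1 then S1 i1 n (\<tau> k) else S1 i2 n (\<tau> k))"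
    define Y where "Y = (\<lambda>(a, k) \<omega>. if a = (0::nat) then J2 s \<omega> else if a = 1 then f i1 (\<tau> k) \<omega> - f i1 t \<omega> else f i2 (\<tau> k) \<omega> - f i2 t \<omega>)"
    define Z where "Z n \<omega> = (\<Sum>l<N. (S1 i1 n (\<tau> l) \<omega> + S1 i1 n (\<tau> (Suc l)) \<omega>) / 2 * (S1 i2 n (\<tau> (Suc l)) \<omega> - S1 i2 n (\<tau> l) \<omega>)) - A2 n s \<omega>" for n \<omega>
    have Z: "Z n = S2 i1 i2 n (\<lambda>j1 j2. G_trap \<tau> N j1 j2 - G j2 j1 s)" for n
    proof
      fix \<omega>
      have "Z n \<omega> = (\<Sum>j1\<le>n. \<Sum>j2\<le>n. G_trap \<tau> N j1 j2 * \<zeta> i1 j1 \<omega> * \<zeta> i2 j2 \<omega>) - A2 n s \<omega>"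
        unfolding Z_def S1_def G_trap_def by (rule arg_cong2[where f = "(-)"], rule trapezoid_sum_bilinear, rule refl)
      then show "Z n \<omega> = S2 i1 i2 n (\<lambda>j1 j2. G_trap \<tau> N j1 j2 - G j2 j1 s) \<omega>"
        by (simp add: S2_def sum_subtractf[symmetric] left_diff_distrib)
    qed
    show ?thesis
    proof (rule ms_limit_bound[of "{0, 1, 2} \<times> {..N}" M X Y Z _ "\<lambda>_. 2 * (\<delta> * L)"])
      show "ms_conv M (X x) (Y x) sequentially" if "x \<in> {0, 1, 2} \<times> {..N}" for x
        using that J2(2)[OF s] S1_conv[OF i1 tau] S1_conv[OF i2 tau] by (auto simp: X_def Y_def)
      show "X x n \<in> borel_measurable M" if "x \<in> {0, 1, 2} \<times> {..N}" for x n
        using that S_measurable i1 i2 by (auto simp: X_def)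
      show "Y x \<in> borel_measurable M" if "x \<in> {0, 1, 2} \<times> {..N}" for x
        using that J2(1)[OF s] f_measurable'[OF i1 tau] f_measurable'[OF i2 tau] f_measurable'[OF i1 t_in] f_measurable'[OF i2 t_in]
        by (auto simp: Y_def)
      show "Z n \<in> borel_measurable M" for n unfolding Z by (intro S_measurable i1 i2)
      show "msq M (Z n) \<le> ennreal (2 * (\<delta> * L))" for n
        unfolding Z by (rule order_trans[OF S2_bound[OF i1 i2] ennreal_leI[OF tensor_bound2_trapezoid[OF s part mesh \<open>0 \<le> \<delta>\<close>]]])
      show "(\<lambda>n. Z (r n) \<omega>) \<longlonglongrightarrow> (trap_sum (\<lambda>u \<omega>. f i1 u \<omega> - f i1 t \<omega>) (f i2) \<tau> N \<omega>) - J2 s \<omega>"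
        if lim: "\<And>x. x \<in> {0, 1, 2} \<times> {..N} \<Longrightarrow> (\<lambda>n. X x (r n) \<omega>) \<longlonglongrightarrow> Y x \<omega>" for r \<omega>
      proof -
        have l: "(\<lambda>n. A2 (r n) s \<omega>) \<longlonglongrightarrow> J2 s \<omega>"
          "\<And>k. k \<le> N \<Longrightarrow> (\<lambda>n. S1 i1 (r n) (\<tau> k) \<omega>) \<longlonglongrightarrow> f i1 (\<tau> k) \<omega> - f i1 t \<omega>"
          "\<And>k. k \<le> N \<Longrightarrow> (\<lambda>n. S1 i2 (r n) (\<tau> k) \<omega>) \<longlonglongrightarrow> f i2 (\<tau> k) \<omega> - f i2 t \<omega>"
          using lim[of "(0, 0)"] lim[of "(1, k)" for k] lim[of "(2, k)" for k] by (auto simp: X_def Y_def)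
        have "(\<lambda>n. Z (r n) \<omega>) \<longlonglongrightarrow> (\<Sum>k<N. ((f i1 (\<tau> k) \<omega> - f i1 t \<omega>) + (f i1 (\<tau> (Suc k)) \<omega> - f i1 t \<omega>)) / 2 *
          ((f i2 (\<tau> (Suc k)) \<omega> - f i2 t \<omega>) - (f i2 (\<tau> k) \<omega> - f i2 t \<omega>))) - J2 s \<omega>"
          unfolding Z_def by (intro tendsto_intros l) auto
        then show ?thesis by simp
      qed
    qed (auto intro: tendsto_const)
  qed
  show "ms_conv M (\<lambda>q \<omega>. trap_sum (\<lambda>u \<omega>. f i1 u \<omega> - f i1 t \<omega>) (f i2) (\<tau> q) (N q) \<omega>) (J2 s) sequentially"
  proof (rule ms_conv_of_bound)
    \<comment> \<open>For \<open>s = t\<close> a partition has no cells and the mesh bound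
      \<open>d\<close> may be negative; hence the absolute value.\<close>
    have "(\<lambda>q. 2 * (\<bar>d q\<bar> * L)) \<longlonglongrightarrow> 2 * (\<bar>0\<bar> * L)" by (intro tendsto_intros d)
    then show "(\<lambda>q. 2 * (\<bar>d q\<bar> * L)) \<longlonglongrightarrow> 0" by simp
    show "eventually (\<lambda>q. msq M (\<lambda>\<omega>. (trap_sum (\<lambda>u \<omega>. f i1 u \<omega> - f i1 t \<omega>) (f i2) (\<tau> q) (N q) \<omega>) - J2 s \<omega>) \<le> ennreal (2 * (\<bar>d q\<bar> * L))) sequentially"
      by (intro always_eventually allI bound[OF part]) (auto intro: order_trans[OF d(2)])
  qed
qed

text \<open>The integrand at the nodes is the limit of \<open>A2\<close>, so at level
  \<open>n\<close> the error is a cubic form with coefficients \<open>C_trap - C\<close>. The bound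
  \<open>b n\<close> is small only in the limit, hence the mesh estimate is drawn from
  \<open>B\<close>.\<close>

lemma J3_strat: "has_strat_integral M J2 (f i3) t T J3"
  unfolding has_strat_integral_def
proof (intro conjI allI impI J3(1))
  fix \<tau> N assume "fine_partitions t T \<tau> N"
  then obtain d where d: "d \<longlonglongrightarrow> 0" "\<And>q k. k < N q \<Longrightarrow> \<tau> q (Suc k) - \<tau> q k \<le> d q"
    and part: "\<And>q. is_partition t T (\<tau> q) (N q)" by (auto simp: fine_partitions_def)
  have bound: "msq M (\<lambda>\<omega>. (trap_sum J2 (f i3) \<tau> N \<omega>) - J3 \<omega>) \<le> ennreal (6 * (\<delta> * L * L) + 6 * (\<delta>\<^sup>2 * L))"
    if part: "is_partition t T \<tau> N" and mesh: "\<And>k. k < N \<Longrightarrow> \<tau> (Suc k) - \<tau> k \<le> \<delta>" for \<tau> N \<delta>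
  proof -
    obtain b B where b: "b \<longlonglongrightarrow> B" and B: "B \<le> 6 * (\<delta> * L * L) + 6 * (\<delta>\<^sup>2 * L)"
      and tb: "\<And>n. tensor_bound3 n (\<lambda>j1 j2 j3. C_trap \<tau> N j1 j2 j3 - C j1 j2 j3) \<le> b n"
      using tensor_bound3_trapezoid[OF part mesh] by blast
    have tau: "\<tau> k \<in> {t..T}" if "k \<le> N" for k
      using is_partition_bounds[OF part that] by auto
    define X where "X = (\<lambda>(a, k) n. if a = (0::nat) then A3 n else if a = 1 then A2 n (\<tau> k) else S1 i3 n (\<tau> k))"
    define Y where "Y = (\<lambda>(a, k) \<omega>. if a = (0::nat) then J3 \<omega> else if a = 1 then J2 (\<tau> k) \<omega> else f i3 (\<tau> k) \<omega> - f i3 t \<omega>)"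
    define Z where "Z n \<omega> = (\<Sum>l<N. (A2 n (\<tau> l) \<omega> + A2 n (\<tau> (Suc l)) \<omega>) / 2 * (S1 i3 n (\<tau> (Suc l)) \<omega> - S1 i3 n (\<tau> l) \<omega>)) - A3 n \<omega>" for n \<omega>
    have Z: "Z n = S3 i1 i2 i3 n (\<lambda>j1 j2 j3. C_trap \<tau> N j1 j2 j3 - C j1 j2 j3)" for n
    proof
      fix \<omega>
      \<comment> \<open>The pair of inner indices is treated as one index, which reduces the
        trilinear identity to \<open>trapezoid_sum_bilinear\<close>.\<close>
      define J where "J = {..n} \<times> {..n}"
      have J: "(\<Sum>x\<in>J. h x) = (\<Sum>a\<le>n. \<Sum>b\<le>n. h (a, b))" for h :: "nat \<times> nat \<Rightarrow> real"
        by (simp add: J_def sum.cartesian_product case_prod_unfold)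
      have A2J: "A2 n u \<omega> = (\<Sum>x\<in>J. G (snd x) (fst x) u * (\<zeta> i1 (fst x) \<omega> * \<zeta> i2 (snd x) \<omega>))" for u
        unfolding J by (simp add: S2_def mult.assoc)
      have "(\<Sum>l<N. (A2 n (\<tau> l) \<omega> + A2 n (\<tau> (Suc l)) \<omega>) / 2 * (S1 i3 n (\<tau> (Suc l)) \<omega> - S1 i3 n (\<tau> l) \<omega>)) =
          (\<Sum>x\<in>J. \<Sum>j3\<le>n. C_trap \<tau> N (fst x) (snd x) j3 * (\<zeta> i1 (fst x) \<omega> * \<zeta> i2 (snd x) \<omega>) * \<zeta> i3 j3 \<omega>)"
        unfolding A2J S1_def C_trap_def
        by (rule trapezoid_sum_bilinear)
      also have "\<dots> = (\<Sum>j1\<le>n. \<Sum>j2\<le>n. \<Sum>j3\<le>n. C_trap \<tau> N j1 j2 j3 * \<zeta> i1 j1 \<omega> * \<zeta> i2 j2 \<omega> * \<zeta> i3 j3 \<omega>)"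
        unfolding J by (simp add: mult.assoc)
      finally show "Z n \<omega> = S3 i1 i2 i3 n (\<lambda>j1 j2 j3. C_trap \<tau> N j1 j2 j3 - C j1 j2 j3) \<omega>"
        unfolding Z_def by (simp add: S3_def sum_subtractf[symmetric] left_diff_distrib)
    qed
    have "msq M (\<lambda>\<omega>. (trap_sum J2 (f i3) \<tau> N \<omega>) - J3 \<omega>) \<le> ennreal B"
    proof (rule ms_limit_bound[of "{0, 1, 2} \<times> {..N}" M X Y Z _ b])
      show "ms_conv M (X x) (Y x) sequentially" if "x \<in> {0, 1, 2} \<times> {..N}" for x
        using that J3(2) J2(2)[OF tau] S1_conv[OF i3 tau] by (auto simp: X_def Y_def)
      show "X x n \<in> borel_measurable M" if "x \<in> {0, 1, 2} \<times> {..N}" for x n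
        using that S_measurable i1 i2 i3 by (auto simp: X_def)
      show "Y x \<in> borel_measurable M" if "x \<in> {0, 1, 2} \<times> {..N}" for x
        using that J3(1) J2(1)[OF tau] f_measurable'[OF i3 tau] f_measurable'[OF i3 t_in]
        by (auto simp: Y_def)
      show "Z n \<in> borel_measurable M" for n unfolding Z by (intro S_measurable i1 i2 i3)
      show "msq M (Z n) \<le> ennreal (b n)" for n
        unfolding Z by (rule order_trans[OF S3_bound[OF i1 i2 i3] ennreal_leI[OF tb]])
      show "(\<lambda>n. Z (r n) \<omega>) \<longlonglongrightarrow> (trap_sum J2 (f i3) \<tau> N \<omega>) - J3 \<omega>"
        if lim: "\<And>x. x \<in> {0, 1, 2} \<times> {..N} \<Longrightarrow> (\<lambda>n. X x (r n) \<omega>) \<longlonglongrightarrow> Y x \<omega>" for r \<omega>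
      proof -
        have l: "(\<lambda>n. A3 (r n) \<omega>) \<longlonglongrightarrow> J3 \<omega>"
          "\<And>k. k \<le> N \<Longrightarrow> (\<lambda>n. A2 (r n) (\<tau> k) \<omega>) \<longlonglongrightarrow> J2 (\<tau> k) \<omega>"
          "\<And>k. k \<le> N \<Longrightarrow> (\<lambda>n. S1 i3 (r n) (\<tau> k) \<omega>) \<longlonglongrightarrow> f i3 (\<tau> k) \<omega> - f i3 t \<omega>"
          using lim[of "(0, 0)"] lim[of "(1, k)" for k] lim[of "(2, k)" for k] by (auto simp: X_def Y_def)
        have "(\<lambda>n. Z (r n) \<omega>) \<longlonglongrightarrow> (\<Sum>k<N. (J2 (\<tau> k) \<omega> + J2 (\<tau> (Suc k)) \<omega>) / 2 *
          ((f i3 (\<tau> (Suc k)) \<omega> - f i3 t \<omega>) - (f i3 (\<tau> k) \<omega> - f i3 t \<omega>))) - J3 \<omega>"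
          unfolding Z_def by (intro tendsto_intros l) auto
        then show ?thesis by simp
      qed
    qed (auto intro: b)
    also have "\<dots> \<le> ennreal (6 * (\<delta> * L * L) + 6 * (\<delta>\<^sup>2 * L))" using B by (rule ennreal_leI)
    finally show ?thesis .
  qed
  show "ms_conv M (\<lambda>q \<omega>. trap_sum J2 (f i3) (\<tau> q) (N q) \<omega>) J3 sequentially"
  proof (rule ms_conv_of_bound)
    have "(\<lambda>q. 6 * (d q * L * L) + 6 * ((d q)\<^sup>2 * L)) \<longlonglongrightarrow> 6 * (0 * L * L) + 6 * (0\<^sup>2 * L)" by (intro tendsto_intros d)
    then show "(\<lambda>q. 6 * (d q * L * L) + 6 * ((d q)\<^sup>2 * L)) \<longlonglongrightarrow> 0" by simp
    show "eventually (\<lambda>q. msq M (\<lambda>\<omega>. (trap_sum J2 (f i3) (\<tau> q) (N q) \<omega>) - J3 \<omega>) \<le> ennreal (6 * (d q * L * L) + 6 * ((d q)\<^sup>2 * L))) sequentially"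
      by (intro always_eventually allI bound[OF part d(2)])
  qed
qed

lemma iter_strat3_exists: "iter_strat3 M f t T i1 i2 i3 J2 J3"
  unfolding iter_strat3_def using J2_strat J3_strat by blast

text \<open>A box sum is compared with the cubes that contain it; the bound outside the box does not
  depend on the cube, so the cube can grow to the limit \<open>J3\<close> while the box stays
  fixed.\<close>

lemma J3_expansion:
  "ms_conv M (\<lambda>(p1, p2, p3) \<omega>. \<Sum>j1\<le>p1. \<Sum>j2\<le>p2. \<Sum>j3\<le>p3. C j1 j2 j3 * \<zeta> i1 j1 \<omega> * \<zeta> i2 j2 \<omega> * \<zeta> i3 j3 \<omega>)
    J3 (sequentially \<times>\<^sub>F sequentially \<times>\<^sub>F sequentially)"
proof (rule ms_convI)
  fix \<epsilon> :: real assume "0 < \<epsilon>"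
  then obtain Q where Q: "\<And>p1 p2 p3 n. Q \<le> p1 \<Longrightarrow> Q \<le> p2 \<Longrightarrow> Q \<le> p3 \<Longrightarrow> Q \<le> n \<Longrightarrow>
      tensor_bound3 n (\<lambda>j1 j2 j3. of_bool (\<not> (j1 \<le> p1 \<and> j2 \<le> p2 \<and> j3 \<le> p3)) * C j1 j2 j3) \<le> \<epsilon>"
    using tensor_bound3_outside_box[OF \<open>0 < \<epsilon>\<close>] by blast
  have bound: "msq M (\<lambda>\<omega>. (\<Sum>j1\<le>p1. \<Sum>j2\<le>p2. \<Sum>j3\<le>p3. C j1 j2 j3 * \<zeta> i1 j1 \<omega> * \<zeta> i2 j2 \<omega> * \<zeta> i3 j3 \<omega>) - J3 \<omega>) \<le> ennreal \<epsilon>"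
    if p: "Q \<le> p1" "Q \<le> p2" "Q \<le> p3" for p1 p2 p3
  proof -
    \<comment> \<open>Shifting the cubes by \<open>P\<close> makes each of them contain the box from
      the start.\<close>
    define P where "P = max p1 (max p2 p3)"
    let ?S = "\<lambda>\<omega>. \<Sum>j1\<le>p1. \<Sum>j2\<le>p2. \<Sum>j3\<le>p3. C j1 j2 j3 * \<zeta> i1 j1 \<omega> * \<zeta> i2 j2 \<omega> * \<zeta> i3 j3 \<omega>"
    have S: "?S \<in> borel_measurable M"
      by (intro borel_measurable_sum borel_measurable_times borel_measurable_const zeta_measurable i1 i2 i3)
    show ?thesis
    proof (rule ms_limit_bound[of "{()}" M "\<lambda>_ n. A3 (n + P)" "\<lambda>_. J3" "\<lambda>n \<omega>. ?S \<omega> - A3 (n + P) \<omega>" _ "\<lambda>_. \<epsilon>"])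
      show "ms_conv M (\<lambda>n. A3 (n + P)) J3 sequentially"
        using J3(2) LIMSEQ_ignore_initial_segment unfolding ms_conv_def by blast
      show "A3 (n + P) \<in> borel_measurable M" for n by (intro S_measurable i1 i2 i3)
      show "(\<lambda>\<omega>. ?S \<omega> - A3 (n + P) \<omega>) \<in> borel_measurable M" for n by (intro borel_measurable_diff S S_measurable i1 i2 i3)
      show "(\<lambda>n. ?S \<omega> - A3 (r n + P) \<omega>) \<longlonglongrightarrow> ?S \<omega> - J3 \<omega>"
        if "\<And>x. x \<in> {()} \<Longrightarrow> (\<lambda>n. A3 (r n + P) \<omega>) \<longlonglongrightarrow> J3 \<omega>" for r \<omega>
        using that by (intro tendsto_diff tendsto_const) auto
      show "msq M (\<lambda>\<omega>. ?S \<omega> - A3 (n + P) \<omega>) \<le> ennreal \<epsilon>" for n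
      proof -
        have le: "p1 \<le> n + P" "p2 \<le> n + P" "p3 \<le> n + P" by (auto simp: P_def)
        show ?thesis
          unfolding A3_diff[OF le] power2_minus
          using p le by (intro order_trans[OF S3_bound[OF i1 i2 i3] ennreal_leI[OF Q]]) auto
      qed
    qed (use J3 in auto)
  qed
  have "eventually (\<lambda>p. Q \<le> fst p \<and> Q \<le> fst (snd p) \<and> Q \<le> snd (snd p)) (sequentially \<times>\<^sub>F sequentially \<times>\<^sub>F sequentially)"
    by (intro eventually_conj eventually_compose_filterlim[OF eventually_ge_at_top]
        filterlim_fst filterlim_compose[OF filterlim_fst filterlim_snd] filterlim_compose[OF filterlim_snd filterlim_snd])
  then show "eventually (\<lambda>p. msq M (\<lambda>\<omega>. (case p of (p1, p2, p3) \<Rightarrow> \<lambda>\<omega>. \<Sum>j1\<le>p1. \<Sum>j2\<le>p2. \<Sum>j3\<le>p3.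
      C j1 j2 j3 * \<zeta> i1 j1 \<omega> * \<zeta> i2 j2 \<omega> * \<zeta> i3 j3 \<omega>) \<omega> - J3 \<omega>) \<le> ennreal \<epsilon>)
      (sequentially \<times>\<^sub>F sequentially \<times>\<^sub>F sequentially)"
    by eventually_elim (auto simp: case_prod_unfold intro!: bound)
qed

section \<open>Uniqueness of the iterated integral up to null sets\<close>

lemma fine_partitions_exist: "s \<in> {t..T} \<Longrightarrow> \<exists>\<tau> N. fine_partitions t s \<tau> N"
proof (cases "s = t")
  case True
  have "fine_partitions t t (\<lambda>_ _. t) (\<lambda>_. 0)"
    unfolding fine_partitions_def by (auto simp: is_partition_def intro!: exI[of _ "\<lambda>_. 0"])
  then show ?thesis using True by blast
next
  case False
  assume "s \<in> {t..T}"
  with False show ?thesis using fine_partitions_uniform[of t s] by auto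
qed

text \<open>The null set on which two inner integrals differ may depend on \<open>s\<close>, but
  each outer trapezoidal sum involves finitely many nodes. The outer sums therefore agree almost
  surely, and uniqueness of mean-square limits applies.\<close>

lemma iter_strat3_unique:
  assumes "iter_strat3 M f t T i1 i2 i3 J2' J3'"
  shows "AE \<omega> in M. J3 \<omega> = J3' \<omega>"
proof -
  have J2': "has_strat_integral M (\<lambda>u \<omega>. f i1 u \<omega> - f i1 t \<omega>) (f i2) t s (J2' s)" if "s \<in> {t..T}" for s
    using assms that by (auto simp: iter_strat3_def)
  have J3': "has_strat_integral M J2' (f i3) t T J3'" using assms by (simp add: iter_strat3_def)
  have eq2: "AE \<omega> in M. J2 s \<omega> = J2' s \<omega>" if s: "s \<in> {t..T}" for s
  proof -
    obtain \<tau> N where fine: "fine_partitions t s \<tau> N" using fine_partitions_exist[OF s] by blast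
    have tau: "\<tau> q k \<in> {t..T}" if "k \<le> N q" for q k
      using fine is_partition_bounds[of t s "\<tau> q" "N q" k] that s by (auto simp: fine_partitions_def)
    show ?thesis
    proof (rule ms_conv_unique)
      let ?X = "\<lambda>q \<omega>. trap_sum (\<lambda>u \<omega>. f i1 u \<omega> - f i1 t \<omega>) (f i2) (\<tau> q) (N q) \<omega>"
      show "ms_conv M ?X (J2 s) sequentially" using J2_strat[OF s] fine by (simp add: has_strat_integral_def)
      show "ms_conv M ?X (J2' s) sequentially" using J2'[OF s] fine by (simp add: has_strat_integral_def)
      show "?X q \<in> borel_measurable M" for q
        by (intro borel_measurable_sum borel_measurable_times borel_measurable_divide borel_measurable_add borel_measurable_diff
            borel_measurable_const f_measurable' i1 i2 tau t_in) auto
      show "J2 s \<in> borel_measurable M" by (rule J2(1)[OF s])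
      show "J2' s \<in> borel_measurable M" using J2'[OF s] by (simp add: has_strat_integral_def)
    qed
  qed
  obtain \<tau> N where fine: "fine_partitions t T \<tau> N" using fine_partitions_exist[OF T_in] by blast
  have tau: "\<tau> q k \<in> {t..T}" if "k \<le> N q" for q k
    using fine is_partition_bounds[of t T "\<tau> q" "N q" k] that by (auto simp: fine_partitions_def)
  show ?thesis
  proof (rule ms_conv_unique)
    let ?X = "\<lambda>J q \<omega>. \<Sum>k<N q. (J (\<tau> q k) \<omega> + J (\<tau> q (Suc k)) \<omega>) / 2 * (f i3 (\<tau> q (Suc k)) \<omega> - f i3 (\<tau> q k) \<omega>)"
    show "ms_conv M (?X J2) J3 sequentially" using J3_strat fine by (simp add: has_strat_integral_def)
    have "ms_conv M (?X J2') J3' sequentially" using J3' fine by (simp add: has_strat_integral_def)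
    moreover have "AE \<omega> in M. ?X J2 q \<omega> = ?X J2' q \<omega>" for q
    proof -
      have "AE \<omega> in M. \<forall>k\<in>{..N q}. J2 (\<tau> q k) \<omega> = J2' (\<tau> q k) \<omega>"
        by (intro AE_finite_allI eq2 tau) auto
      then show ?thesis by eventually_elim (intro sum.cong refl, simp)
    qed
    ultimately show "ms_conv M (?X J2) J3' sequentially"
      using ms_conv_cong_AE[where X = "?X J2" and X' = "?X J2'" and Y = J3' and Y' = J3'] by simp
    show "?X J2 q \<in> borel_measurable M" for q
      by (intro borel_measurable_sum borel_measurable_times borel_measurable_divide borel_measurable_add borel_measurable_diff
          borel_measurable_const f_measurable' i3 tau J2(1)) auto
    show "J3 \<in> borel_measurable M" by (rule J3(1))
    show "J3' \<in> borel_measurable M" using J3' by (simp add: has_strat_integral_def)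
  qed
qed

lemma iter_strat3_expansion:
  assumes "iter_strat3 M f t T i1 i2 i3 J2' J3'"
  shows "ms_conv M (\<lambda>(p1, p2, p3) \<omega>. \<Sum>j1\<le>p1. \<Sum>j2\<le>p2. \<Sum>j3\<le>p3. C j1 j2 j3 * \<zeta> i1 j1 \<omega> * \<zeta> i2 j2 \<omega> * \<zeta> i3 j3 \<omega>)
    J3' (sequentially \<times>\<^sub>F sequentially \<times>\<^sub>F sequentially)"
  by (rule iffD1[OF ms_conv_cong_AE[OF AE_I2[OF refl] iter_strat3_unique[OF assms]] J3_expansion])

end

end

subsection \<open>The trigonometric system\<close>

lemma abs_cos_diff_le: "\<bar>cos x - cos y\<bar> \<le> \<bar>x - y :: real\<bar>"
proof -
  have "\<bar>cos x - cos y\<bar> = 2 * \<bar>sin ((x + y) / 2)\<bar> * \<bar>sin ((y - x) / 2)\<bar>"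
    by (simp add: cos_diff_cos abs_mult)
  also have "\<dots> \<le> 2 * 1 * \<bar>(y - x) / 2\<bar>"
    by (intro mult_mono abs_sin_x_le_abs_x) auto
  finally show ?thesis by simp
qed

lemma integral_cos_period:
  fixes k :: int
  assumes "t < T"
  shows "(\<integral>s. cos (2 * pi * real_of_int k * (s - t) / (T - t) + c) \<partial>unif_on t T) = (if k = 0 then (T - t) * cos c else 0)"
proof (cases "k = 0")
  case True
  have "(\<integral>s. cos c \<partial>unif_on t T) = T * cos c - t * cos c"
    using assms by (intro integral_unif_on_FTC) (auto intro!: derivative_eq_intros)
  then show ?thesis using True by (simp add: left_diff_distrib)
next
  case False
  let ?w = "2 * pi * real_of_int k / (T - t)"
  have w: "?w \<noteq> 0" using False assms by simp
  have "(\<integral>s. cos (?w * (s - t) + c) \<partial>unif_on t T) = sin (?w * (T - t) + c) / ?w - sin (?w * (t - t) + c) / ?w"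
    using assms w by (intro integral_unif_on_FTC) (auto intro!: derivative_eq_intros continuous_intros)
  also have "sin (?w * (T - t) + c) = sin c"
  proof -
    have "?w * (T - t) + c = c + 2 * pi * real_of_int k" using assms by simp
    then show ?thesis by (simp add: sin_add sin_int_2pin cos_int_2pin)
  qed
  finally show ?thesis using False by (simp add: mult.commute mult.left_commute)
qed

context
  fixes t T :: real
  assumes tT: "t < T"
begin

definition freq :: "nat \<Rightarrow> int" where "freq j = int ((j + 1) div 2)"
definition phase :: "nat \<Rightarrow> real" where "phase j = (if odd j then pi / 2 else 0)"
definition ampl :: "nat \<Rightarrow> real" where "ampl j = (if j = 0 then 1 / sqrt (T - t) else sqrt (2 / (T - t)))"

text \<open>Writing the sines as shifted cosines treats both families at once.\<close>

lemma trig_phi_cos: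
  "trig_phi t T j s = ampl j * cos (2 * pi * real_of_int (freq j) * (s - t) / (T - t) - phase j)"
proof (cases "odd j")
  case True
  then show ?thesis by (auto simp: trig_phi_def ampl_def freq_def phase_def cos_diff)
next
  case False
  then have "(j + 1) div 2 = j div 2" by presburger
  then show ?thesis using False by (auto simp: trig_phi_def ampl_def freq_def phase_def)
qed

text \<open>The constant function has frequency 0 and needs its own case. For the others the added
  \<open>sin (phase j)\<close> normalizes the antiderivative to vanish at \<open>t\<close>.\<close>

definition trig_Phi :: "nat \<Rightarrow> real \<Rightarrow> real" where
  "trig_Phi j s = (if j = 0 then (s - t) / sqrt (T - t) else
     ampl j * (T - t) / (2 * pi * real_of_int (freq j)) *
       (sin (2 * pi * real_of_int (freq j) * (s - t) / (T - t) - phase j) + sin (phase j)))"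

lemma freq_pos: "j \<noteq> 0 \<Longrightarrow> 0 < freq j"
  by (simp add: freq_def)

lemma trig_Phi_deriv: "(trig_Phi j has_real_derivative trig_phi t T j s) (at s)"
proof (cases "j = 0")
  case True
  have "((\<lambda>s. (s - t) / sqrt (T - t)) has_real_derivative 1 / sqrt (T - t)) (at s)"
    by (rule DERIV_cong[OF DERIV_cdivide[OF DERIV_diff[OF DERIV_ident DERIV_const]]]) simp
  then show ?thesis using True by (simp add: trig_Phi_def[abs_def] trig_phi_def)
next
  case False
  define w where "w = 2 * pi * real_of_int (freq j)"
  have w: "w \<noteq> 0" using freq_pos[OF False] by (simp add: w_def)
  have "((\<lambda>s. a * l / w * (sin (w * (s - t) / l - p) + b)) has_real_derivative a * cos (w * (s - t) / l - p)) (at s)"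
    if "l \<noteq> 0" for a b l p :: real
    using that w by (auto intro!: derivative_eq_intros simp: field_simps)
  from this[of "T - t" "ampl j" "phase j" "sin (phase j)"] tT show ?thesis using False unfolding trig_Phi_def[abs_def] trig_phi_cos w_def by simp
qed

lemma trig_phi_Lipschitz: "\<exists>K. \<forall>x y. \<bar>trig_phi t T j x - trig_phi t T j y\<bar> \<le> K * \<bar>x - y\<bar>"
proof (intro exI allI)
  fix x y
  define w where "w = 2 * pi * real_of_int (freq j)"
  have "\<bar>trig_phi t T j x - trig_phi t T j y\<bar> =
      \<bar>ampl j\<bar> * \<bar>cos (w * (x - t) / (T - t) - phase j) - cos (w * (y - t) / (T - t) - phase j)\<bar>"
    unfolding trig_phi_cos w_def by (simp add: abs_mult flip: right_diff_distrib)
  also have "\<dots> \<le> \<bar>ampl j\<bar> * \<bar>(w * (x - t) / (T - t) - phase j) - (w * (y - t) / (T - t) - phase j)\<bar>"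
    by (intro mult_left_mono abs_cos_diff_le) simp
  also have "(w * (x - t) / (T - t) - phase j) - (w * (y - t) / (T - t) - phase j) = (w * (x - t) - w * (y - t)) / (T - t)"
    by (simp add: diff_divide_distrib)
  also have "\<dots> = w / (T - t) * (x - y)"
    by (simp add: algebra_simps)
  finally show "\<bar>trig_phi t T j x - trig_phi t T j y\<bar> \<le> (\<bar>ampl j\<bar> * \<bar>w / (T - t)\<bar>) * \<bar>x - y\<bar>"
    by (simp add: abs_mult mult.assoc)
qed

text \<open>A product of two shifted cosines is a sum of cosines of the difference and the sum of
  the frequencies. The sum vanishes only for two zero indices; the difference vanishes for distinct
  indices only in a sine-cosine pair, where the phase difference of \<open>pi / 2\<close>
  annihilates the term.\<close>

lemma trig_ortho: "(\<integral>s. trig_phi t T i s * trig_phi t T j s \<partial>unif_on t T) = of_bool (i = j)"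
proof -
  let ?w = "2 * pi / (T - t)"
  let ?c = "\<lambda>k c s. cos (2 * pi * real_of_int k * (s - t) / (T - t) + c)"
  have int: "integrable (unif_on t T) (?c k c)" for k c
    using tT by (intro integrable_unif_on_bounded[where K = 1] borel_measurable_unif_on) auto
  have eq: "trig_phi t T i s * trig_phi t T j s = ampl i * ampl j / 2 *
      (?c (freq i - freq j) (phase j - phase i) s + ?c (freq i + freq j) (- phase i - phase j) s)" for s
  proof -
    define A where "A = 2 * pi * (s - t) / (T - t)"
    have arg: "2 * pi * real_of_int k * (s - t) / (T - t) = real_of_int k * A" for k
      by (simp add: A_def)
    define x y where "x = real_of_int (freq i) * A - phase i" and "y = real_of_int (freq j) * A - phase j"
    have xy: "real_of_int (freq i - freq j) * A + (phase j - phase i) = x - y"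
      "real_of_int (freq i + freq j) * A + (- phase i - phase j) = x + y"
      by (simp_all add: x_def y_def algebra_simps)
    show ?thesis unfolding trig_phi_cos arg xy x_def[symmetric] y_def[symmetric]
      by (simp add: cos_add cos_diff)
  qed
  have "(\<integral>s. trig_phi t T i s * trig_phi t T j s \<partial>unif_on t T) = ampl i * ampl j / 2 *
      ((if freq i - freq j = 0 then (T - t) * cos (phase j - phase i) else 0) +
       (if freq i + freq j = 0 then (T - t) * cos (- phase i - phase j) else 0))"
    unfolding eq integral_mult_right_zero Bochner_Integration.integral_add[OF int int] integral_cos_period[OF tT] ..
  also have "\<dots> = of_bool (i = j)"
  proof (cases "i = j")
    case True
    then show ?thesis using tT freq_pos[of j] by (cases "j = 0") (auto simp: ampl_def freq_def phase_def)
  next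
    case False
    have "cos (phase j - phase i) = 0" if "freq i = freq j"
    proof -
      have "(i + 1) div 2 = (j + 1) div 2" using that by (simp add: freq_def)
      with False have "odd i \<noteq> odd j" by presburger
      then show ?thesis by (auto simp: phase_def)
    qed
    moreover have "freq i + freq j \<noteq> 0" using False by (auto simp: freq_def)
    ultimately show ?thesis using False by auto
  qed
  finally show ?thesis .
qed

text \<open>Orthonormality alone is interpreted here, because Bessel's inequality for this system is
  an ingredient of the proof of its Parseval identity.\<close>

interpretation trig: orthonormal_system t T "trig_phi t T" trig_Phi
proof
  show "trig_Phi j t = 0" for j by (simp add: trig_Phi_def)
qed (rule tT trig_Phi_deriv trig_phi_Lipschitz trig_ortho)+

lemma sum_even_split:
  fixes N :: nat
  shows "(\<Sum>j\<le>2 * N. g j) = g 0 + (\<Sum>r<N. g (2 * r + 1) + g (2 * r + 2) :: real)"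
  by (induction N) (auto simp: algebra_simps)

text \<open>A sine and a cosine of the same frequency combine through (1 - cos x)^2 + sin^2 x = 2 (1
  - cos x) into one term with the weight of an inverse square.\<close>

lemma trig_Phi_pair:
  "(trig_Phi (2 * r + 1) s)\<^sup>2 + (trig_Phi (2 * r + 2) s)\<^sup>2 =
    (T - t) / pi\<^sup>2 * (1 / (real r + 1)\<^sup>2) * (1 - cos (2 * pi * real_of_int (int r + 1) * (s - t) / (T - t)))"
proof -
  define x where "x = 2 * pi * real_of_int (int r + 1) * (s - t) / (T - t)"
  define w where "w = 2 * pi * (real r + 1)"
  have f: "freq (2 * r + 1) = int r + 1" "freq (2 * r + 2) = int r + 1" by (auto simp: freq_def)
  have p: "phase (2 * r + 1) = pi / 2" "phase (2 * r + 2) = 0" by (auto simp: phase_def)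
  have a: "ampl (2 * r + 1) = sqrt (2 / (T - t))" "ampl (2 * r + 2) = sqrt (2 / (T - t))" by (auto simp: ampl_def)
  have 1: "trig_Phi (2 * r + 1) s = sqrt (2 / (T - t)) * (T - t) / w * (1 - cos x)"
    unfolding trig_Phi_def f p a by (simp add: x_def w_def sin_diff)
  have 2: "trig_Phi (2 * r + 2) s = sqrt (2 / (T - t)) * (T - t) / w * sin x"
    unfolding trig_Phi_def f p a by (simp add: x_def w_def)
  have "(trig_Phi (2 * r + 1) s)\<^sup>2 + (trig_Phi (2 * r + 2) s)\<^sup>2 =
      (sqrt (2 / (T - t)))\<^sup>2 * (T - t)\<^sup>2 / w\<^sup>2 * ((1 - cos x)\<^sup>2 + (sin x)\<^sup>2)"
    unfolding 1 2 power_mult_distrib power_divide by (simp only: distrib_left)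
  also have "(1 - cos x)\<^sup>2 + (sin x)\<^sup>2 = 2 * (1 - cos x)"
    using sin_cos_squared_add[of x] by (simp add: power2_diff)
  also have "(sqrt (2 / (T - t)))\<^sup>2 * (T - t)\<^sup>2 / w\<^sup>2 * (2 * (1 - cos x)) =
      (T - t) / pi\<^sup>2 * (1 / (real r + 1)\<^sup>2) * (1 - cos x)"
  proof -
    have *: "2 / l * l\<^sup>2 / (2 * pi * p)\<^sup>2 * (2 * z) = l / pi\<^sup>2 * (1 / p\<^sup>2) * z" if "l \<noteq> 0" "p \<noteq> 0" for l p z :: real
      using that by (simp add: power2_eq_square field_simps)
    have sq: "(sqrt (2 / (T - t)))\<^sup>2 = 2 / (T - t)" using tT by simp
    show ?thesis unfolding sq w_def by (rule *) (use tT in auto)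
  qed
  finally show ?thesis unfolding x_def .
qed

text \<open>Even partial sums group the terms into the pairs \<open>g\<close>, and Weierstrass' test
  gives the continuity of their sum \<open>H\<close>. Odd partial sums are finally squeezed between
  the preceding even one and Bessel's bound.\<close>

lemma trig_parseval:
  assumes s: "s \<in> {t..T}"
  shows "(\<lambda>n. \<Sum>j\<le>n. (trig_Phi j s)\<^sup>2) \<longlonglongrightarrow> s - t"
proof -
  define L where "L = T - t"
  have L: "0 < L" using tT by (simp add: L_def)
  define c where "c r u = 1 - cos (2 * pi * real_of_int (int r + 1) * (u - t) / (T - t))" for r u
  define g where "g r u = L / pi\<^sup>2 * (1 / (real r + 1)\<^sup>2) * c r u" for r u
  define H where "H u = (\<Sum>r. g r u)" for u
  define R where "R u = (u - t) - (u - t)\<^sup>2 / L - H u" for u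
  have bas: "(\<lambda>r. 1 / (real r + 1)\<^sup>2) sums (pi\<^sup>2 / 6)" using inverse_squares_sums by (simp add: add_ac)
  have gM: "norm (g r u) \<le> L / pi\<^sup>2 * 2 * (1 / (real r + 1)\<^sup>2)" for r u
  proof -
    have "0 \<le> c r u" "c r u \<le> 2"
      unfolding c_def using cos_le_one cos_ge_minus_one by (smt (verit))+
    then have "\<bar>L / pi\<^sup>2 * (1 / (real r + 1)\<^sup>2)\<bar> * \<bar>c r u\<bar> \<le> L / pi\<^sup>2 * (1 / (real r + 1)\<^sup>2) * 2"
      using L by (intro mult_mono) auto
    then show ?thesis unfolding g_def by (simp add: abs_mult mult_ac)
  qed
  have g0: "0 \<le> g r u" for r u
    unfolding g_def c_def using L by (intro mult_nonneg_nonneg) auto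
  have summ: "summable (\<lambda>r. L / pi\<^sup>2 * 2 * (1 / (real r + 1)\<^sup>2))"
    by (intro summable_mult sums_summable[OF bas])
  have ul: "uniform_limit {t..T} (\<lambda>n u. \<Sum>r<n. g r u) H sequentially"
    unfolding H_def by (rule Weierstrass_m_test[OF gM summ])
  have contH: "continuous_on {t..T} H"
    using tT by (intro uniform_limit_theorem[OF _ ul]) (auto simp: g_def c_def intro!: always_eventually continuous_intros)
  have limH: "(\<lambda>n. \<Sum>r<n. g r u) \<longlonglongrightarrow> H u" if "u \<in> {t..T}" for u
    using tendsto_uniform_limitI[OF ul that] .
  have contR: "continuous_on {t..T} R"
    unfolding R_def using L by (intro continuous_intros contH) auto
  have even_sum: "(\<Sum>j\<le>2 * N. (trig_Phi j u)\<^sup>2) = (u - t)\<^sup>2 / L + (\<Sum>r<N. g r u)" for N u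
    unfolding sum_even_split trig_Phi_pair g_def c_def L_def
    using tT by (simp add: trig_Phi_def power_divide)
  have partial: "(u - t)\<^sup>2 / L + (\<Sum>r<N. g r u) \<le> u - t" if "u \<in> {t..T}" for u N
    using trig.sum_Phi_square_le[OF that, of "{..2 * N}"] unfolding even_sum .
  have R0: "0 \<le> R u" if "u \<in> {t..T}" for u
  proof -
    have "H u \<le> (u - t) - (u - t)\<^sup>2 / L"
      by (rule LIMSEQ_le_const2[OF limH[OF that]]) (use partial[OF that] in \<open>auto simp: algebra_simps\<close>)
    then show ?thesis by (simp add: R_def)
  qed
  let ?U = "unif_on t T"
  have intg: "(\<integral>u. g r u \<partial>?U) = L\<^sup>2 / pi\<^sup>2 * (1 / (real r + 1)\<^sup>2)" and ing: "integrable ?U (g r)" for r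
  proof -
    let ?k = "\<lambda>u. cos (2 * pi * real_of_int (int r + 1) * (u - t) / (T - t) + 0)"
    have k: "integrable ?U ?k"
      using tT by (intro integrable_unif_on_bounded[where K = 1] borel_measurable_unif_on) auto
    have one: "integrable ?U (\<lambda>_. 1 :: real)"
      using tT by (intro integrable_unif_on_bounded[where K = 1] borel_measurable_unif_on) auto
    have "(\<integral>u. 1 - ?k u \<partial>?U) = (\<integral>u. 1 \<partial>?U) - (\<integral>u. ?k u \<partial>?U)"
      by (rule Bochner_Integration.integral_diff[OF one k])
    also have "\<dots> = L"
      unfolding integral_cos_period[OF tT] using tT by (simp add: space_restrict_space measure_unif_on L_def)
    finally have "(\<integral>u. c r u \<partial>?U) = L" by (simp add: c_def)
    then show "(\<integral>u. g r u \<partial>?U) = L\<^sup>2 / pi\<^sup>2 * (1 / (real r + 1)\<^sup>2)"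
      unfolding g_def by (simp add: power2_eq_square)
    have "integrable ?U (\<lambda>u. 1 - ?k u)" using one k by (rule Bochner_Integration.integrable_diff)
    then show "integrable ?U (g r)" unfolding g_def c_def by simp
  qed
  have poly: "(\<integral>u. (u - t) - (u - t)\<^sup>2 / L \<partial>?U) = L\<^sup>2 / 6"
  proof -
    have "(\<integral>u. (u - t) - (u - t)\<^sup>2 / L \<partial>?U) = ((T - t)\<^sup>2 / 2 - (T - t) ^ 3 / (3 * L)) - ((t - t)\<^sup>2 / 2 - (t - t) ^ 3 / (3 * L))"
      using tT L
      by (intro integral_unif_on_FTC) (auto intro!: derivative_eq_intros continuous_intros simp: field_simps power2_eq_square)
    also have "\<dots> = L\<^sup>2 / 6" using L by (simp add: L_def[symmetric] power2_eq_square power3_eq_cube field_simps)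
    finally show ?thesis .
  qed
  have cpoly: "continuous_on {t..T} (\<lambda>u. (u - t) - (u - t)\<^sup>2 / L)" using L by (intro continuous_intros) auto
  \<comment> \<open>Dropping nonnegative terms of the series only enlarges the integrand, so finite
    sums give upper bounds and no interchange of series and integral occurs. With the Basel sum the
    bounds tend to 0.\<close>
  have "(\<integral>u. R u \<partial>?U) \<le> L\<^sup>2 / 6 - L\<^sup>2 / pi\<^sup>2 * (\<Sum>r<N. 1 / (real r + 1)\<^sup>2)" for N
  proof -
    have ip: "integrable ?U (\<lambda>u. (u - t) - (u - t)\<^sup>2 / L)" by (intro trig.nice_integrable trig.nice_continuous cpoly)
    have isum: "integrable ?U (\<lambda>u. \<Sum>r<N. g r u)" by (intro Bochner_Integration.integrable_sum ing)
    have "(\<integral>u. R u \<partial>?U) \<le> (\<integral>u. (u - t) - (u - t)\<^sup>2 / L - (\<Sum>r<N. g r u) \<partial>?U)"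
    proof (rule integral_mono)
      show "integrable ?U R" by (intro trig.nice_integrable trig.nice_continuous contR)
      show "integrable ?U (\<lambda>u. (u - t) - (u - t)\<^sup>2 / L - (\<Sum>r<N. g r u))" using ip isum by (rule Bochner_Integration.integrable_diff)
      fix u assume "u \<in> space ?U"
      then have u: "u \<in> {t..T}" by (simp add: space_restrict_space)
      have "(\<Sum>r<N. g r u) \<le> H u"
        by (rule incseq_le[OF _ limH[OF u]]) (auto intro!: incseq_SucI g0)
      then show "R u \<le> (u - t) - (u - t)\<^sup>2 / L - (\<Sum>r<N. g r u)" by (simp add: R_def)
    qed
    also have "\<dots> = L\<^sup>2 / 6 - (\<Sum>r<N. L\<^sup>2 / pi\<^sup>2 * (1 / (real r + 1)\<^sup>2))"
      unfolding Bochner_Integration.integral_diff[OF ip isum] poly Bochner_Integration.integral_sum[OF ing] intg ..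
    finally show ?thesis by (simp add: sum_distrib_left)
  qed
  moreover have "(\<lambda>N. L\<^sup>2 / 6 - L\<^sup>2 / pi\<^sup>2 * (\<Sum>r<N. 1 / (real r + 1)\<^sup>2)) \<longlonglongrightarrow> L\<^sup>2 / 6 - L\<^sup>2 / pi\<^sup>2 * (pi\<^sup>2 / 6)"
    using bas unfolding sums_def by (intro tendsto_intros)
  ultimately have "(\<integral>u. R u \<partial>?U) \<le> L\<^sup>2 / 6 - L\<^sup>2 / pi\<^sup>2 * (pi\<^sup>2 / 6)"
    by (intro LIMSEQ_le_const) auto
  then have le0: "integral {t..T} R \<le> 0"
    using integral_unif_on_eq_integral[OF less_imp_le[OF tT] contR] by simp
  have hR: "(R has_integral integral {t..T} R) {t..T}"
    by (intro integrable_integral integrable_continuous_interval contR)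
  moreover have "0 \<le> integral {t..T} R" by (rule integral_nonneg) (use hR R0 in auto)
  ultimately have "(R has_integral 0) (cbox t T)" using le0 by simp
  then have "R s = 0"
    using tT s contR R0 by (intro has_integral_0_cbox_imp_0[of t T R s]) auto
  then have Hs: "(s - t)\<^sup>2 / L + H s = s - t" by (simp add: R_def)
  have "(\<lambda>N. \<Sum>j\<le>2 * N. (trig_Phi j s)\<^sup>2) \<longlonglongrightarrow> (s - t)\<^sup>2 / L + H s"
    unfolding even_sum by (intro tendsto_intros limH s)
  then have ev: "(\<lambda>N. \<Sum>j\<le>2 * N. (trig_Phi j s)\<^sup>2) \<longlonglongrightarrow> s - t" unfolding Hs .
  have "filterlim (\<lambda>n::nat. n div 2) sequentially sequentially"
    by (rule filterlim_at_top_div_const_nat) simp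
  with ev have lim: "(\<lambda>n. \<Sum>j\<le>2 * (n div 2). (trig_Phi j s)\<^sup>2) \<longlonglongrightarrow> s - t"
    by (rule filterlim_compose)
  show ?thesis
  proof (rule tendsto_sandwich[OF _ _ lim tendsto_const])
    show "eventually (\<lambda>n. (\<Sum>j\<le>2 * (n div 2). (trig_Phi j s)\<^sup>2) \<le> (\<Sum>j\<le>n. (trig_Phi j s)\<^sup>2)) sequentially"
      by (intro always_eventually allI sum_mono2) auto
    show "eventually (\<lambda>n. (\<Sum>j\<le>n. (trig_Phi j s)\<^sup>2) \<le> s - t) sequentially"
      by (intro always_eventually allI trig.sum_Phi_square_le s)
  qed
qed

lemma trig_basis: "orthonormal_basis t T (trig_phi t T) trig_Phi"
  by unfold_locales (rule trig_parseval)

lemma coefC_eq: "coefC t T j3 j2 j1 = orthonormal_basis.C t T (trig_phi t T) trig_Phi j1 j2 j3"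
proof -
  interpret orthonormal_basis t T "trig_phi t T" trig_Phi by (rule trig_basis)
  have Phi: "integral {t..u} (trig_phi t T j1) = trig_Phi j1 u" if "t \<le> u" for u
  proof -
    have "(trig_phi t T j1 has_integral (trig_Phi j1 u - trig_Phi j1 t)) {t..u}"
      using that Phi_within by (intro fundamental_theorem_of_calculus)
        (auto simp: has_real_derivative_iff_has_vector_derivative[symmetric])
    then show ?thesis by (simp add: trig.Phi_t integral_unique)
  qed
  have G: "integral {t..s} (\<lambda>s1. trig_phi t T j2 s1 * integral {t..s1} (trig_phi t T j1)) = G j2 j1 s" for s
    unfolding G_def by (rule integral_cong) (simp add: Phi)
  have "C j1 j2 j3 = integral {t..T} (\<lambda>s. trig_phi t T j3 s * G j2 j1 s)"
    unfolding C_def using tT by (intro integral_unif_on_eq_integral continuous_on_mult trig.continuous_phi continuous_G) auto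
  then show ?thesis unfolding coefC_def G by simp
qed

end

theorem theorem4:
  fixes M :: "'a measure" and F :: "real \<Rightarrow> 'a measure"
    and f :: "nat \<Rightarrow> real \<Rightarrow> 'a \<Rightarrow> real"
    and m :: nat and t T :: real and i1 i2 i3 :: nat
  assumes "prob_space M" and "complete_measure M"
    and "rc_filtration M F T"
    and "std_wiener M F T m f"
    and "0 \<le> t" and "t < T"
    and "i1 \<in> {1..m}" and "i2 \<in> {1..m}" and "i3 \<in> {1..m}"
  shows "(\<exists>J2 J3. iter_strat3 M f t T i1 i2 i3 J2 J3) \<and>
         (\<exists>\<zeta>. \<forall>i\<in>{1..m}. \<forall>j. has_ito_integral_det M (trig_phi t T j) (f i) t T (\<zeta> i j)) \<and>
         (\<forall>J2 J3 \<zeta>. iter_strat3 M f t T i1 i2 i3 J2 J3 \<longrightarrow>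
            (\<forall>i\<in>{1..m}. \<forall>j. has_ito_integral_det M (trig_phi t T j) (f i) t T (\<zeta> i j)) \<longrightarrow>
            ms_conv M
              (\<lambda>(p1, p2, p3) \<omega>. \<Sum>j1\<le>p1. \<Sum>j2\<le>p2. \<Sum>j3\<le>p3.
                  coefC t T j3 j2 j1 * \<zeta> i1 j1 \<omega> * \<zeta> i2 j2 \<omega> * \<zeta> i3 j3 \<omega>)
              J3 (sequentially \<times>\<^sub>F sequentially \<times>\<^sub>F sequentially))"
proof -
  interpret prob_space M by fact
  interpret wiener M F f m t T by unfold_locales fact+
  interpret orthonormal_basis t T "trig_phi t T" "trig_Phi t T" by (rule trig_basis) fact
  have exp: "expansion M F f m t T (trig_phi t T) (trig_Phi t T) \<zeta>"
    if "\<forall>i\<in>{1..m}. \<forall>j. has_ito_integral_det M (trig_phi t T j) (f i) t T (\<zeta> i j)" for \<zeta>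
    by unfold_locales (use that in blast)
  have "\<exists>I. has_ito_integral_det M (trig_phi t T j) (f i) t T I" if "i \<in> {1..m}" for i j
    using phi_Lipschitz[of j] has_ito_integral_exists[OF that] by metis
  then obtain \<zeta> where \<zeta>: "\<forall>i\<in>{1..m}. \<forall>j. has_ito_integral_det M (trig_phi t T j) (f i) t T (\<zeta> i j)"
    by metis
  show ?thesis
  proof (intro conjI allI impI)
    show "\<exists>J2 J3. iter_strat3 M f t T i1 i2 i3 J2 J3"
      using expansion.iter_strat3_exists[OF exp[OF \<zeta>] assms(7-9)] by blast
    show "\<exists>\<zeta>. \<forall>i\<in>{1..m}. \<forall>j. has_ito_integral_det M (trig_phi t T j) (f i) t T (\<zeta> i j)"
      using \<zeta> by blast
  next
    fix J2 J3 \<zeta>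
    assume J: "iter_strat3 M f t T i1 i2 i3 J2 J3"
      and z: "\<forall>i\<in>{1..m}. \<forall>j. has_ito_integral_det M (trig_phi t T j) (f i) t T (\<zeta> i j)"
    show "ms_conv M
              (\<lambda>(p1, p2, p3) \<omega>. \<Sum>j1\<le>p1. \<Sum>j2\<le>p2. \<Sum>j3\<le>p3.
                  coefC t T j3 j2 j1 * \<zeta> i1 j1 \<omega> * \<zeta> i2 j2 \<omega> * \<zeta> i3 j3 \<omega>)
              J3 (sequentially \<times>\<^sub>F sequentially \<times>\<^sub>F sequentially)"
      unfolding coefC_eq[OF \<open>t < T\<close>]
      by (rule expansion.iter_strat3_expansion[OF exp[OF z] assms(7-9) J])
  qed
qed

end
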